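(* Let $\mathcal{M}$ be a Frobenius manifold with unity field $\mathbb{I}$, multiplication $\circ$, metric $\eta$ and Euler vector field $E$. Let $\mathcal{N}\subset\mathcal{M}$ be a flat submanifold (i.e. the induced metric $\eta_{\mathcal{N}}$ is nondegenerate and flat) with $$\big(\mathbb{I}|_{\mathcal{N}}\big)^\perp=0,\qquad \big((a\circ b)|_{\mathcal{N}}\big)^\perp=0\quad\text{for all } a,b\in T_\tau\mathcal{N},\ \tau\in\mathcal{N},\qquad \big(E|_{\mathcal{N}}\big)^\perp=0.$$ Then $\mathcal{N}$ is a natural Frobenius submanifold.
   Context: Frobenius manifold: a region $\mathcal{M}\subset\mathbb{R}^m$ (or $\mathbb{C}^m$) with coordinates $t^1,\dots,t^m$ and a function $F$ (the prepotential) on $\mathcal{M}$ whose third derivatives $c_{ijk}=\frac{\partial^3F}{\partial t^i\partial t^j\partial t^k}$ satisfy: (1) Normalization: $\eta_{ij}=c_{1ij}$ is a constant nondegenerate matrix, with inverse $\eta^{ij}$; it defines the metric $\eta=\langle\,,\rangle$. (2) Associativity: with $c_{ij}{}^{k}=\eta^{kl}c_{ijl}$, the multiplication $\frac{\partial}{\partial t^i}\circ\frac{\partial}{\partial t^j}=c_{ij}{}^{k}\frac{\partial}{\partial t^k}$ is associative and commutative on each tangent space, with unity $\mathbb{I}=\partial/\partial t^1$. (3) Homogeneity: $\mathcal{L}_EF=d_F\,F+(\text{a polynomial of degree at most two in the } t^i)$ for some constant $d_F$, where $\mathcal{L}_E$ is the Lie derivative along the Euler vector field $E=(q^i_jt^j+r^i)\frac{\partial}{\partial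 t^i}$ with constants $q^i_j,r^i$. Standing conventions on the ambient manifold $\mathcal{M}$: $\eta_{ij}=\delta_{i+j,m+1}$, and $E=\sum_i d_it^i\frac{\partial}{\partial t^i}+\sum_{i:\,d_i=0}r^i\frac{\partial}{\partial t^i}$ with $d_1=1$, $d_i=1-q_i$, $q_i+q_{m+1-i}=d$, where $d=3-d_F$. For $\tau\in\mathcal{N}$ and $v\in T_\tau\mathcal{M}$, $pr(v)$ denotes the $\eta$-orthogonal projection of $v$ onto $T_\tau\mathcal{N}$ and $v^\perp=v-pr(v)$ its component orthogonal to $T_\tau\mathcal{N}$. Induced structures on $\mathcal{N}$: the metric $\eta_{\mathcal{N}}=\eta|_{T\mathcal{N}}$, the multiplication $a\star b=pr(a\circ b)$ for $a,b\in T_\tau\mathcal{N}$, and the vector field $E_{\mathcal{N}}=pr(E|_{\mathcal{N}})$. $\mathcal{N}$ is a Frobenius submanifold if it is a Frobenius manifold with respect to the induced structures: (locally on $\mathcal{N}$) there are coordinates $\tau^\alpha$ on $\mathcal{N}$ and a function $F_{\mathcal{N}}(\tau)$ satisfying (1), (2), (3) (with $m$ replaced by $\dim\mathcal{N}$) whose metric, multiplication, unity $\partial/\partial\tau^1$ and Euler field are $\eta_{\mathcal{N}}$, $\star$, $\mathbb{I}_{\mathcal{N}}=pr(\mathbb{I}|_{\mathcal{N}})$ and $E_{\mathcal{N}}$; in particular $E_{\mathcal{N}}=(q^\alpha_\beta\tau^\beta+r^\alpha)\frac{\partial}{\partial\tau^\alpha}$ with constant coefficients. It is a natural Frobenius submanifold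 if moreover $a\star b=a\circ b$ for all $a,b\in T_\tau\mathcal{N}$ and all $\tau\in\mathcal{N}$. *)

theory Defs
  imports "HOL-Analysis.Analysis"
begin

text \<open>
  The ground field is a type of sort \<open>{real_normed_field, euclidean_space}\<close>; its instances include
  \<open>real\<close> and \<open>complex\<close>, so that everything below covers the real (smooth) and the
  complex (holomorphic) theory at once.  Vectors are elements of \<open>'k ^ 'n\<close>, where the finite linear
  order on \<open>'n\<close> gives the numbering \<open>1, \<dots>, CARD('n)\<close> of the coordinates.
\<close>

definition pos :: "'n::{finite,linorder} \<Rightarrow> nat" where
  "pos i = card {..i}"

definition first :: "'n::{finite,linorder}" where
  "first = Min UNIV"


subsection \<open>Calculus\<close>

definition pd :: "'n::finite \<Rightarrow> ('k::real_normed_field ^ 'n \<Rightarrow> 'k) \<Rightarrow> 'k ^ 'n \<Rightarrow> 'k" where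
  "pd i f x = deriv (\<lambda>s. f (x + s *s axis i 1)) 0"

text \<open>
  All iterated partial derivatives exist and are continuous.  On an open set this is
  \<open>C\<^sup>\<infinity>\<close> for \<open>'k = real\<close> and holomorphy for \<open>'k = complex\<close>.
\<close>

definition smooth_on :: "('k::real_normed_field ^ 'n::finite) set \<Rightarrow> ('k ^ 'n \<Rightarrow> 'k) \<Rightarrow> bool" where
  "smooth_on U f \<longleftrightarrow>
     (\<forall>is. continuous_on U (foldr pd is f) \<and>
           (\<forall>x\<in>U. \<forall>i. (\<lambda>s. foldr pd is f (x + s *s axis i 1)) field_differentiable (at 0)))"

definition pushforward ::
  "('k::real_normed_field ^ 'n::finite \<Rightarrow> 'k ^ 'm::finite) \<Rightarrow> 'k ^ 'n \<Rightarrow> 'k ^ 'n \<Rightarrow> 'k ^ 'm" where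
  "pushforward \<phi> u w = (\<chi> i. \<Sum>\<alpha>\<in>UNIV. w $ \<alpha> * pd \<alpha> (\<lambda>v. \<phi> v $ i) u)"


subsection \<open>Frobenius manifolds\<close>

definition third :: "('k::real_normed_field ^ 'n::finite \<Rightarrow> 'k) \<Rightarrow> 'n \<Rightarrow> 'n \<Rightarrow> 'n \<Rightarrow> 'k ^ 'n \<Rightarrow> 'k" where
  "third F i j k = pd i (pd j (pd k F))"

definition inner_eta :: "'k::real_normed_field ^ 'n::finite ^ 'n \<Rightarrow> 'k ^ 'n \<Rightarrow> 'k ^ 'n \<Rightarrow> 'k" where
  "inner_eta \<eta> a b = (\<Sum>i\<in>UNIV. \<Sum>j\<in>UNIV. \<eta> $ i $ j * a $ i * b $ j)"

text \<open>
  The product of the tangent vectors \<open>a\<close> and \<open>b\<close> at \<open>t\<close>; the structure constants are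
  \<open>c\<^sub>i\<^sub>j\<^sup>k = (\<Sum>l. \<eta>\<^sup>k\<^sup>l * c\<^sub>i\<^sub>j\<^sub>l)\<close>.
\<close>

definition frob_mult ::
  "('k::real_normed_field ^ 'n::finite \<Rightarrow> 'k) \<Rightarrow> 'k ^ 'n ^ 'n \<Rightarrow> 'k ^ 'n \<Rightarrow> 'k ^ 'n \<Rightarrow> 'k ^ 'n \<Rightarrow> 'k ^ 'n" where
  "frob_mult F \<eta> t a b =
     (\<chi> k. \<Sum>i\<in>UNIV. \<Sum>j\<in>UNIV. a $ i * b $ j * (\<Sum>l\<in>UNIV. matrix_inv \<eta> $ k $ l * third F i j l t))"

definition unity :: "('k::real_normed_field, 'n::{finite,linorder}) vec" where
  "unity = axis first 1"

definition frobenius_manifold ::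
  "(('k::real_normed_field, 'n::{finite,linorder}) vec) set \<Rightarrow> (('k, 'n) vec \<Rightarrow> 'k) \<Rightarrow> (('k, 'n) vec, 'n) vec
    \<Rightarrow> (('k, 'n) vec \<Rightarrow> ('k, 'n) vec) \<Rightarrow> 'k \<Rightarrow> bool" where
  "frobenius_manifold M F \<eta> E dF \<longleftrightarrow>
     open M \<and> connected M \<and> M \<noteq> {} \<and> smooth_on M F \<and>
     (\<forall>t\<in>M. \<forall>i j. third F first i j t = \<eta> $ i $ j) \<and> invertible \<eta> \<and>
     (\<forall>t\<in>M. \<forall>a b c. frob_mult F \<eta> t (frob_mult F \<eta> t a b) c = frob_mult F \<eta> t a (frob_mult F \<eta> t b c)) \<and>
     (\<forall>t\<in>M. \<forall>a b. frob_mult F \<eta> t a b = frob_mult F \<eta> t b a) \<and>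
     (\<forall>t\<in>M. \<forall>a. frob_mult F \<eta> t unity a = a) \<and>
     (\<exists>q r. \<forall>t\<in>M. E t = q *v t + r) \<and>
     (\<exists>A B C. \<forall>t\<in>M.
        (\<Sum>i\<in>UNIV. E t $ i * pd i F t) =
        dF * F t + ((\<Sum>i\<in>UNIV. \<Sum>j\<in>UNIV. A i j * t $ i * t $ j) + (\<Sum>i\<in>UNIV. B i * t $ i) + C))"

text \<open>
  Normal form of the metric and of the Euler field on the ambient manifold.  The indices \<open>i\<close> and
  \<open>m + 1 - i\<close> are paired by the condition \<open>pos i + pos j = CARD('m) + 1\<close>; the weights are
  \<open>d\<^sub>i = 1 - q i\<close> and the charge is \<open>d = 3 - dF\<close>.
\<close>

definition standard_form ::
  "(('k::real_normed_field, 'm::{finite,linorder}) vec) set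
    \<Rightarrow> (('k, 'm) vec, 'm) vec \<Rightarrow> (('k, 'm) vec \<Rightarrow> ('k, 'm) vec) \<Rightarrow> 'k \<Rightarrow> bool" where
  "standard_form M \<eta> E dF \<longleftrightarrow>
     (\<forall>i j. \<eta> $ i $ j = (if pos i + pos j = CARD('m) + 1 then 1 else 0)) \<and>
     (\<exists>q r. 1 - q first = 1 \<and>
            (\<forall>i j. pos i + pos j = CARD('m) + 1 \<longrightarrow> q i + q j = 3 - dF) \<and>
            (\<forall>t\<in>M. E t = (\<chi> i. (1 - q i) * t $ i + (if 1 - q i = 0 then r i else 0))))"


subsection \<open>Submanifolds\<close>

text \<open>A local parametrization, i.e. the inverse of a chart, of the subset \<open>N\<close>.\<close>

definition local_param ::
  "('k::real_normed_field ^ 'm::finite) set \<Rightarrow> ('k ^ 'n::finite) set \<Rightarrow> ('k ^ 'n \<Rightarrow> 'k ^ 'm) \<Rightarrow> bool" where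
  "local_param N U \<phi> \<longleftrightarrow>
     open U \<and> (\<forall>i. smooth_on U (\<lambda>u. \<phi> u $ i)) \<and>
     (\<forall>u\<in>U. inj (pushforward \<phi> u)) \<and>
     openin (top_of_set N) (\<phi> ` U) \<and> (\<exists>\<psi>. homeomorphism U (\<phi> ` U) \<phi> \<psi>)"

text \<open>In the following the first argument \<open>TYPE('n)\<close> carries the dimension \<open>CARD('n)\<close> of \<open>N\<close>.\<close>

definition submanifold ::
  "'n::finite itself \<Rightarrow> ('k::real_normed_field ^ 'm::finite) set \<Rightarrow> ('k ^ 'm) set \<Rightarrow> bool" where
  "submanifold n N M \<longleftrightarrow>
     N \<subseteq> M \<and> (\<forall>p\<in>N. \<exists>U (\<phi> :: 'k ^ 'n \<Rightarrow> 'k ^ 'm). local_param N U \<phi> \<and> p \<in> \<phi> ` U)"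

definition tangent_space ::
  "'n::finite itself \<Rightarrow> ('k::real_normed_field ^ 'm::finite) set \<Rightarrow> 'k ^ 'm \<Rightarrow> ('k ^ 'm) set" where
  "tangent_space n N p =
     {v. \<exists>U (\<phi> :: 'k ^ 'n \<Rightarrow> 'k ^ 'm) u w.
           local_param N U \<phi> \<and> u \<in> U \<and> \<phi> u = p \<and> v = pushforward \<phi> u w}"

definition orth_proj :: "'k::real_normed_field ^ 'm::finite ^ 'm \<Rightarrow> ('k ^ 'm) set \<Rightarrow> 'k ^ 'm \<Rightarrow> 'k ^ 'm" where
  "orth_proj \<eta> T v = (THE w. w \<in> T \<and> (\<forall>z\<in>T. inner_eta \<eta> (v - w) z = 0))"

definition perp :: "'k::real_normed_field ^ 'm::finite ^ 'm \<Rightarrow> ('k ^ 'm) set \<Rightarrow> 'k ^ 'm \<Rightarrow> 'k ^ 'm" where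
  "perp \<eta> T v = v - orth_proj \<eta> T v"

text \<open>
  The induced metric is nondegenerate on each tangent space, and it is flat: locally isometric to
  a constant metric, i.e. near each point there are coordinates in which its coefficients are
  constant.
\<close>

definition flat_submanifold ::
  "'n::finite itself \<Rightarrow> 'k::real_normed_field ^ 'm::finite ^ 'm \<Rightarrow> ('k ^ 'm) set \<Rightarrow> ('k ^ 'm) set \<Rightarrow> bool" where
  "flat_submanifold n \<eta> N M \<longleftrightarrow>
     submanifold n N M \<and>
     (\<forall>p\<in>N. \<forall>v\<in>tangent_space n N p.
        (\<forall>w\<in>tangent_space n N p. inner_eta \<eta> v w = 0) \<longrightarrow> v = 0) \<and>
     (\<forall>p\<in>N. \<exists>U (\<phi> :: 'k ^ 'n \<Rightarrow> 'k ^ 'm). local_param N U \<phi> \<and> p \<in> \<phi> ` U \<and>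
        (\<exists>g :: 'k ^ 'n ^ 'n. \<forall>u\<in>U. \<forall>a b.
           inner_eta \<eta> (pushforward \<phi> u a) (pushforward \<phi> u b) = inner_eta g a b))"

definition star ::
  "'n::finite itself \<Rightarrow> ('k::real_normed_field ^ 'm::finite \<Rightarrow> 'k) \<Rightarrow> 'k ^ 'm ^ 'm \<Rightarrow> ('k ^ 'm) set
    \<Rightarrow> 'k ^ 'm \<Rightarrow> 'k ^ 'm \<Rightarrow> 'k ^ 'm \<Rightarrow> 'k ^ 'm" where
  "star n F \<eta> N p a b = orth_proj \<eta> (tangent_space n N p) (frob_mult F \<eta> p a b)"

text \<open>
  Coordinates \<open>\<tau>\<close> on \<open>N\<close> are given by a local parametrization \<open>\<phi>\<close> on a region \<open>V\<close>; the differential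
  of \<open>\<phi>\<close> has to identify the Frobenius structure on \<open>V\<close> with the structure induced on \<open>N\<close>.
\<close>

definition frobenius_submanifold ::
  "'n::{finite,linorder} itself \<Rightarrow> (('k::real_normed_field, 'm::{finite,linorder}) vec \<Rightarrow> 'k)
    \<Rightarrow> (('k, 'm) vec, 'm) vec
    \<Rightarrow> (('k, 'm) vec \<Rightarrow> ('k, 'm) vec) \<Rightarrow> (('k, 'm) vec) set \<Rightarrow> (('k, 'm) vec) set \<Rightarrow> bool" where
  "frobenius_submanifold n F \<eta> E N M \<longleftrightarrow>
     submanifold n N M \<and>
     (\<forall>p\<in>N. \<exists>V (\<phi> :: ('k, 'n) vec \<Rightarrow> ('k, 'm) vec) FN \<eta>N EN dN.
        local_param N V \<phi> \<and> p \<in> \<phi> ` V \<and>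
        frobenius_manifold V FN \<eta>N EN dN \<and>
        (\<forall>\<tau>\<in>V.
           (\<forall>a b. inner_eta \<eta>N a b = inner_eta \<eta> (pushforward \<phi> \<tau> a) (pushforward \<phi> \<tau> b)) \<and>
           (\<forall>a b. pushforward \<phi> \<tau> (frob_mult FN \<eta>N \<tau> a b) =
                  star n F \<eta> N (\<phi> \<tau>) (pushforward \<phi> \<tau> a) (pushforward \<phi> \<tau> b)) \<and>
           pushforward \<phi> \<tau> unity = orth_proj \<eta> (tangent_space n N (\<phi> \<tau>)) unity \<and>
           pushforward \<phi> \<tau> (EN \<tau>) = orth_proj \<eta> (tangent_space n N (\<phi> \<tau>)) (E (\<phi> \<tau>))))"

definition natural_frobenius_submanifold ::
  "'n::{finite,linorder} itself \<Rightarrow> (('k::real_normed_field, 'm::{finite,linorder}) vec \<Rightarrow> 'k)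
    \<Rightarrow> (('k, 'm) vec, 'm) vec
    \<Rightarrow> (('k, 'm) vec \<Rightarrow> ('k, 'm) vec) \<Rightarrow> (('k, 'm) vec) set \<Rightarrow> (('k, 'm) vec) set \<Rightarrow> bool" where
  "natural_frobenius_submanifold n F \<eta> E N M \<longleftrightarrow>
     frobenius_submanifold n F \<eta> E N M \<and>
     (\<forall>p\<in>N. \<forall>a\<in>tangent_space n N p. \<forall>b\<in>tangent_space n N p.
        star n F \<eta> N p a b = frob_mult F \<eta> p a b)"

end

theory Submission
  imports Defs
begin

text \<open>
  Around each point \<open>N\<close> has a chart \<open>\<phi>\<close> in which the induced metric is a constant matrix \<open>g\<close>.  Write
  \<open>\<phi>\<^sub>\<alpha>\<close> and \<open>\<phi>\<^sub>\<alpha>\<^sub>\<delta>\<close> for its first and second partial derivatives, as vectors in the ambient space.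
  Differentiating \<open>\<langle>\<phi>\<^sub>\<alpha>, \<phi>\<^sub>\<beta>\<rangle> = g\<^sub>\<alpha>\<^sub>\<beta>\<close> and permuting the indices as for the Levi-Civita connection shows that all
  \<open>\<phi>\<^sub>\<alpha>\<^sub>\<delta>\<close> are orthogonal to \<open>N\<close> (\<open>second_fundamental_form_normal\<close>).  Hence a vector field \<open>X\<close> along \<open>\<phi>\<close> that is
  tangent to \<open>N\<close> satisfies \<open>\<partial>\<^sub>\<delta> \<langle>X, \<phi>\<^sub>\<beta>\<rangle> = \<langle>\<partial>\<^sub>\<delta> X, \<phi>\<^sub>\<beta>\<rangle>\<close> (\<open>pd_tangent_coefficient\<close>).  Everything
  follows from this and from the tangency of the unity, the products and the Euler field.

  \<^item> The unity is a constant vector tangent to \<open>N\<close>, so its coefficients in the chart are constant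
    (\<open>constant_tangent_field\<close>), and a linear change of the coordinates makes it the first coordinate field
    (\<open>unital_flat_chart\<close>).

  \<^item> The Euler field is affine and its linear part scales the metric.  The functions \<open>G\<^sub>\<beta> = \<langle>E, \<phi>\<^sub>\<beta>\<rangle>\<close>
    therefore have constant \<open>\<partial>\<^sub>\<delta> G\<^sub>\<beta> + \<partial>\<^sub>\<beta> G\<^sub>\<delta>\<close>.  As for Killing fields of a flat metric, their second derivatives
    vanish, and the induced Euler field is affine in the flat coordinates (\<open>affine_tangent_field\<close>).

  \<^item> Let \<open>c\<^sub>\<alpha>\<^sub>\<beta>\<^sub>\<gamma> = c(\<phi>\<^sub>\<alpha>, \<phi>\<^sub>\<beta>, \<phi>\<^sub>\<gamma>)\<close> be the restriction to \<open>N\<close> of the tensor \<open>c(x, y, z) = \<langle>x \<circ> y, z\<rangle>\<close> of third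
    derivatives of \<open>F\<close>.  For a normal vector \<open>X\<close>, \<open>c(X, \<phi>\<^sub>\<beta>, \<phi>\<^sub>\<gamma>) = \<langle>X, \<phi>\<^sub>\<beta> \<circ> \<phi>\<^sub>\<gamma>\<rangle>\<close> vanishes, because products of
    tangent vectors are tangent.  So the terms of \<open>\<partial>\<^sub>\<delta> c\<^sub>\<alpha>\<^sub>\<beta>\<^sub>\<gamma>\<close> that contain second derivatives of \<open>\<phi>\<close> drop out, and what
    remains are the fourth derivatives of \<open>F\<close> in the directions \<open>\<phi>\<^sub>\<delta>, \<phi>\<^sub>\<alpha>, \<phi>\<^sub>\<beta>, \<phi>\<^sub>\<gamma>\<close>, which are symmetric
    (\<open>induced_tensor_closed\<close>).  Integrating three times on a ball yields a prepotential with third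
    derivatives \<open>c\<^sub>\<alpha>\<^sub>\<beta>\<^sub>\<gamma>\<close> (\<open>third_potential\<close>).  Since a nondegenerate metric and the tensor determine the
    product, \<open>\<phi>\<close> intertwines the product of this prepotential with \<open>\<circ>\<close> (\<open>pushforward_mult\<close>), and
    associativity, commutativity and the unity are inherited.

  \<^item> For homogeneity, the third derivatives of \<open>L\<^sub>E F\<^sub>N - d\<^sub>F F\<^sub>N\<close> are the restriction to \<open>N\<close> of those of
    \<open>L\<^sub>E F - d\<^sub>F F\<close>, hence zero (\<open>homogeneity\<close>); so the function is a polynomial of degree at most two, with
    the same \<open>d\<^sub>F\<close> as in the ambient manifold.

  The ground field is any real normed field of finite dimension, so the calculus (total derivatives from
  continuous partial ones, symmetry of second derivatives, chain rule, Poincare lemma) is built on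
  one-variable derivatives over the field and the mean value inequality.  To speak about tangent spaces one also has
  to know that they do not depend on the chart (\<open>tangent_space_eq_range\<close>).
\<close>

section \<open>Partial derivatives over a normed field\<close>

lemma smult_axis: "s *s axis i (1::'a::semiring_1) = axis i s"
  by (simp add: vec_eq_iff axis_def)

lemma norm_axis_eq: "norm (axis i (x::'a::real_normed_vector) :: 'a ^ 'n::finite) = norm x"
proof (rule antisym)
  have "norm (axis i x :: 'a ^ 'n) \<le> (\<Sum>j\<in>UNIV. norm ((axis i x :: 'a ^ 'n) $ j))"
    unfolding norm_vec_def by (rule L2_set_le_sum) simp
  also have "\<dots> = (\<Sum>j\<in>UNIV. if j = i then norm x else 0)"
    by (rule sum.cong) (auto simp: axis_def)
  finally show "norm (axis i x :: 'a ^ 'n) \<le> norm x" by simp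
  have "norm ((axis i x :: 'a ^ 'n) $ i) \<le> norm (axis i x :: 'a ^ 'n)"
    by (rule Finite_Cartesian_Product.norm_nth_le)
  then show "norm x \<le> norm (axis i x :: 'a ^ 'n)" by simp
qed

definition differentiable_along ::
  "('k::real_normed_field ^ 'n::finite \<Rightarrow> 'k) \<Rightarrow> 'n \<Rightarrow> 'k ^ 'n \<Rightarrow> bool" where
  "differentiable_along f i x \<longleftrightarrow> (\<lambda>s. f (x + s *s axis i 1)) field_differentiable (at 0)"

lemma pd_eqI: "((\<lambda>s. f (x + s *s axis i 1)) has_field_derivative D) (at 0) \<Longrightarrow> pd i f x = D"
  unfolding pd_def by (rule DERIV_imp_deriv)

lemma differentiable_alongI:
  "((\<lambda>s. f (x + s *s axis i 1)) has_field_derivative D) (at 0) \<Longrightarrow> differentiable_along f i x"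
  unfolding differentiable_along_def field_differentiable_def by blast

lemma has_pd:
  "differentiable_along f i x \<Longrightarrow> ((\<lambda>s. f (x + s *s axis i 1)) has_field_derivative pd i f x) (at 0)"
  unfolding pd_def differentiable_along_def by (simp add: DERIV_deriv_iff_field_differentiable)

lemma has_pd_at:
  assumes "differentiable_along f i (x + s0 *s axis i 1)"
  shows "((\<lambda>s. f (x + s *s axis i 1)) has_field_derivative pd i f (x + s0 *s axis i 1)) (at s0)"
proof -
  have "((\<lambda>s. f ((x + s0 *s axis i 1) + s *s axis i 1)) has_field_derivative
     pd i f (x + s0 *s axis i 1)) (at 0)"
    by (rule has_pd[OF assms])
  moreover have "(\<lambda>s. f ((x + s0 *s axis i 1) + s *s axis i 1)) = (\<lambda>s. f (x + (s + s0) *s axis i 1))"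
    by (simp add: vector_sadd_rdistrib add.commute add.left_commute)
  ultimately show ?thesis
    using DERIV_shift[of "\<lambda>s. f (x + s *s axis i 1)" _ 0 s0] by simp
qed

lemma continuous_on_vec_components:
  "(\<And>i. continuous_on S (\<lambda>x. g x $ i)) \<Longrightarrow> continuous_on S (g :: 'a::topological_space \<Rightarrow> 'b::real_normed_vector ^ 'n::finite)"
  using continuous_on_vec_lambda[of S "\<lambda>i x. g x $ i"] by simp

lemma continuous_line: "continuous_on S (\<lambda>s. (x::'k::real_normed_field ^ 'n::finite) + s *s axis i 1)"
  by (intro continuous_on_vec_components) (simp add: continuous_on_add continuous_on_mult_right continuous_on_const)

lemma eventually_line_in:
  fixes x :: "'k::real_normed_field ^ 'n::finite"
  assumes "open U" "x \<in> U"
  shows "\<forall>\<^sub>F s in nhds 0. x + s *s axis i 1 \<in> U"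
proof -
  have "isCont (\<lambda>s. x + s *s axis i 1) 0"
    using continuous_line[of UNIV x i] continuous_on_eq_continuous_at by blast
  then have "filterlim (\<lambda>s. x + s *s axis i 1) (nhds x) (nhds 0)"
    using tendsto_at_iff_tendsto_nhds[of "\<lambda>s. x + s *s axis i 1" 0] by (simp add: isCont_def)
  then show ?thesis using assms by (rule topological_tendstoD)
qed

lemma pd_cong:
  assumes "open U" "x \<in> U" "\<And>y. y \<in> U \<Longrightarrow> f y = g y"
  shows "pd i f x = pd i g x"
  unfolding pd_def
  by (rule deriv_cong_ev[OF eventually_mono[OF eventually_line_in[OF assms(1,2)] assms(3)] refl])

lemma differentiable_along_cong:
  assumes "open U" "x \<in> U" "\<And>y. y \<in> U \<Longrightarrow> f y = g y" "differentiable_along f i x"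
  shows "differentiable_along g i x"
proof -
  have ev: "\<forall>\<^sub>F s in nhds 0. f (x + s *s axis i 1) = g (x + s *s axis i 1)"
    by (rule eventually_mono[OF eventually_line_in[OF assms(1,2)] assms(3)])
  have "((\<lambda>s. g (x + s *s axis i 1)) has_field_derivative pd i f x) (at 0)"
    using has_pd[OF assms(4)] DERIV_cong_ev[OF refl ev refl] by blast
  then show ?thesis by (rule differentiable_alongI)
qed

section \<open>Functions of class C^k and smooth functions\<close>

text \<open>
  Smoothness is a statement about all iterated partial derivatives.  The finite orders allow its closure
  properties to be proved by induction on \<open>k\<close>, because the partial derivatives of a sum, a product or
  a composite are built from functions of one order less.
\<close>

primrec Ck :: "nat \<Rightarrow> ('k::real_normed_field ^ 'n::finite) set \<Rightarrow> ('k ^ 'n \<Rightarrow> 'k) \<Rightarrow> bool" where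
  "Ck 0 U f \<longleftrightarrow> continuous_on U f"
| "Ck (Suc k) U f \<longleftrightarrow> continuous_on U f \<and> (\<forall>x\<in>U. \<forall>i. differentiable_along f i x) \<and> (\<forall>i. Ck k U (pd i f))"

text \<open>
  The iterated derivatives are taken from the inside out here: a list of directions is split at its
  last element, which is the derivative applied first.
\<close>

lemma smooth_on_rec:
  "smooth_on U f \<longleftrightarrow> continuous_on U f \<and> (\<forall>x\<in>U. \<forall>i. differentiable_along f i x) \<and> (\<forall>i. smooth_on U (pd i f))"
proof
  assume s: "smooth_on U f"
  have "smooth_on U (pd i f)" for i
    unfolding smooth_on_def
  proof
    fix js
    show "continuous_on U (foldr pd js (pd i f)) \<and>
        (\<forall>x\<in>U. \<forall>j. (\<lambda>s. foldr pd js (pd i f) (x + s *s axis j 1)) field_differentiable at 0)"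
      using s[unfolded smooth_on_def, rule_format, of "js @ [i]"] by simp
  qed
  then show "continuous_on U f \<and> (\<forall>x\<in>U. \<forall>i. differentiable_along f i x) \<and> (\<forall>i. smooth_on U (pd i f))"
    using s[unfolded smooth_on_def, rule_format, of "[]"] by (auto simp: differentiable_along_def)
next
  assume r: "continuous_on U f \<and> (\<forall>x\<in>U. \<forall>i. differentiable_along f i x) \<and> (\<forall>i. smooth_on U (pd i f))"
  show "smooth_on U f"
    unfolding smooth_on_def
  proof
    fix js
    show "continuous_on U (foldr pd js f) \<and>
        (\<forall>x\<in>U. \<forall>j. (\<lambda>s. foldr pd js f (x + s *s axis j 1)) field_differentiable at 0)"
    proof (cases js rule: rev_cases)
      case Nil
      then show ?thesis using r by (simp add: differentiable_along_def)
    next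
      case (snoc ks i)
      then show ?thesis using r unfolding smooth_on_def by simp
    qed
  qed
qed

lemma smooth_on_imp_Ck: "smooth_on U f \<Longrightarrow> Ck k U f"
proof (induction k arbitrary: f)
  case 0
  then show ?case using smooth_on_rec[of U f] by simp
next
  case (Suc k)
  then show ?case using smooth_on_rec[of U f] by simp
qed

lemma Ck_foldr: "Ck (k + length js) U f \<Longrightarrow> Ck k U (foldr pd js f)"
proof (induction js arbitrary: f rule: rev_induct)
  case (snoc i js)
  then show ?case by simp
qed simp

lemma smooth_on_iff_Ck: "smooth_on U f \<longleftrightarrow> (\<forall>k. Ck k U f)"
proof
  assume r: "\<forall>k. Ck k U f"
  have "Ck 1 U (foldr pd js f)" for js
    using r Ck_foldr[of 1 js U f] by blast
  then show "smooth_on U f"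
    unfolding smooth_on_def by (simp add: differentiable_along_def)
qed (blast intro: smooth_on_imp_Ck)

lemma Ck_cong:
  assumes "open U" "\<And>y. y \<in> U \<Longrightarrow> f y = g y" "Ck k U f"
  shows "Ck k U g"
  using assms(2,3)
proof (induction k arbitrary: f g)
  case 0
  then show ?case by (metis Ck.simps(1) continuous_on_cong)
next
  case (Suc k)
  have "continuous_on U g" using Suc.prems by (metis Ck.simps(2) continuous_on_cong)
  moreover have "differentiable_along g i x" if "x \<in> U" for i x
    using differentiable_along_cong[OF assms(1) that Suc.prems(1)] Suc.prems(2) that by auto
  moreover have "Ck k U (pd i g)" for i
  proof (rule Suc.IH)
    show "pd i f y = pd i g y" if "y \<in> U" for y
      by (rule pd_cong[OF assms(1) that Suc.prems(1)])
    show "Ck k U (pd i f)" using Suc.prems(2) by simp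
  qed
  ultimately show ?case by simp
qed

lemma smooth_on_cong:
  assumes "open U" "\<And>y. y \<in> U \<Longrightarrow> f y = g y" "smooth_on U f"
  shows "smooth_on U g"
  using assms(3) Ck_cong[OF assms(1), of f g] assms(2) unfolding smooth_on_iff_Ck by metis

lemma Ck_Suc: "Ck (Suc k) U f \<Longrightarrow> Ck k U f"
  by (induction k arbitrary: f) auto

lemma pd_add:
  assumes "differentiable_along f i x" "differentiable_along g i x"
  shows "pd i (\<lambda>y. f y + g y) x = pd i f x + pd i g x" "differentiable_along (\<lambda>y. f y + g y) i x"
  using DERIV_add[OF has_pd[OF assms(1)] has_pd[OF assms(2)]]
  by (auto intro: pd_eqI differentiable_alongI)

lemma pd_mult:
  assumes "differentiable_along f i x" "differentiable_along g i x"
  shows "pd i (\<lambda>y. f y * g y) x = pd i f x * g x + f x * pd i g x"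
    "differentiable_along (\<lambda>y. f y * g y) i x"
proof -
  have "((\<lambda>s. f (x + s *s axis i 1) * g (x + s *s axis i 1)) has_field_derivative
     pd i f x * g x + f x * pd i g x) (at 0)"
    using DERIV_mult[OF has_pd[OF assms(1)] has_pd[OF assms(2)]] by (simp add: algebra_simps)
  then show "pd i (\<lambda>y. f y * g y) x = pd i f x * g x + f x * pd i g x"
    "differentiable_along (\<lambda>y. f y * g y) i x"
    by (auto intro: pd_eqI differentiable_alongI)
qed

lemma pd_const: "pd i (\<lambda>y. c) x = 0" "differentiable_along (\<lambda>y. c) i x"
  using DERIV_const[of c "at 0"] by (rule pd_eqI, rule differentiable_alongI)

lemma pd_sum:
  assumes "\<And>a. a \<in> A \<Longrightarrow> differentiable_along (f a) i x"
  shows "pd i (\<lambda>y. \<Sum>a\<in>A. f a y) x = (\<Sum>a\<in>A. pd i (f a) x)"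
    "differentiable_along (\<lambda>y. \<Sum>a\<in>A. f a y) i x"
proof -
  have "((\<lambda>s. \<Sum>a\<in>A. f a (x + s *s axis i 1)) has_field_derivative (\<Sum>a\<in>A. pd i (f a) x)) (at 0)"
    by (rule DERIV_sum) (rule has_pd[OF assms])
  then show "pd i (\<lambda>y. \<Sum>a\<in>A. f a y) x = (\<Sum>a\<in>A. pd i (f a) x)"
    "differentiable_along (\<lambda>y. \<Sum>a\<in>A. f a y) i x"
    by (auto intro: pd_eqI differentiable_alongI)
qed

lemma pd_coord: "pd i (\<lambda>y. y $ j) x = (if i = j then 1 else 0)" "differentiable_along (\<lambda>y. y $ j) i x"
proof -
  have "((\<lambda>s. (x + s *s axis i 1) $ j) has_field_derivative (if i = j then 1 else 0)) (at 0)"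
    by (auto simp: axis_def intro!: derivative_eq_intros)
  then show "pd i (\<lambda>y. y $ j) x = (if i = j then 1 else 0)" "differentiable_along (\<lambda>y. y $ j) i x"
    by (auto intro: pd_eqI differentiable_alongI)
qed

lemma Ck_const: "Ck k (U :: ('k::real_normed_field ^ 'n::finite) set) (\<lambda>y. c)"
proof (induction k arbitrary: c)
  case (Suc k)
  have "pd i (\<lambda>y :: 'k ^ 'n. c) = (\<lambda>y. 0)" for i by (simp add: fun_eq_iff pd_const)
  then show ?case using Suc by (simp add: pd_const)
qed simp

lemma Ck_coord: "Ck k (U :: ('k::real_normed_field ^ 'n::finite) set) (\<lambda>y. y $ j)"
proof (cases k)
  case (Suc l)
  have "pd i (\<lambda>y :: 'k ^ 'n. y $ j) = (\<lambda>y. if i = j then 1 else 0)" for i by (simp add: fun_eq_iff pd_coord)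
  then show ?thesis using Suc Ck_const[of l U] by (auto simp: pd_coord intro: continuous_intros)
qed (auto intro: continuous_intros)

lemma Ck_add:
  assumes "open U" "Ck k U f" "Ck k U g"
  shows "Ck k U (\<lambda>y. f y + g y)"
  using assms(2,3)
proof (induction k arbitrary: f g)
  case (Suc k)
  have "Ck k U (pd i (\<lambda>y. f y + g y))" for i
    by (rule Ck_cong[OF assms(1) _ Suc.IH[of "pd i f" "pd i g"]]) (use Suc.prems in \<open>auto simp: pd_add\<close>)
  then show ?case using Suc.prems by (auto intro: continuous_intros pd_add)
qed (auto intro: continuous_intros)

lemma Ck_mult:
  assumes "open U" "Ck k U f" "Ck k U g"
  shows "Ck k U (\<lambda>y. f y * g y)"
  using assms(2,3)
proof (induction k arbitrary: f g)
  case (Suc k)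
  have "Ck k U (\<lambda>y. pd i f y * g y + f y * pd i g y)" for i
    using Suc.prems by (intro Ck_add[OF assms(1)] Suc.IH) (auto intro: Ck_Suc[of k U f, simplified] Ck_Suc[of k U g, simplified])
  then have "Ck k U (pd i (\<lambda>y. f y * g y))" for i
    by (rule Ck_cong[OF assms(1), rotated]) (use Suc.prems in \<open>auto simp: pd_mult\<close>)
  then show ?case using Suc.prems by (auto intro: continuous_intros pd_mult)
qed (auto intro: continuous_intros)

lemma Ck_sum:
  assumes "open U" "\<And>a. a \<in> A \<Longrightarrow> Ck k U (f a)"
  shows "Ck k U (\<lambda>y. \<Sum>a\<in>A. f a y)"
  using assms(2)
proof (induction A rule: infinite_finite_induct)
  case (insert a A)
  then show ?case by (simp add: Ck_add[OF assms(1)])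
qed (auto intro: Ck_const)

section \<open>Total derivative, symmetry of second derivatives, chain rule\<close>

text \<open>
  The classical telescoping argument: the increment is broken into increments along the coordinate
  axes, and each of these is estimated by the mean value inequality for the function minus its linear part.
\<close>

lemma has_derivative_of_continuous_pd:
  fixes f :: "'k::real_normed_field ^ 'n::finite \<Rightarrow> 'k"
  assumes U: "open U" "x \<in> U"
    and f: "\<And>y i. y \<in> U \<Longrightarrow> differentiable_along f i y" "\<And>i. continuous_on U (pd i f)"
  shows "(f has_derivative (\<lambda>h. \<Sum>i\<in>UNIV. h $ i * pd i f x)) (at x)"
proof -
  have *: "\<exists>d>0. \<forall>h. norm h < d \<longrightarrow> (\<forall>i. i \<notin> S \<longrightarrow> h $ i = 0) \<longrightarrow>
      norm (f (x + h) - f x - (\<Sum>i\<in>S. h $ i * pd i f x)) \<le> e * (\<Sum>i\<in>S. norm (h $ i))"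
    if "e > 0" for e and S :: "'n set"
    using finite[of S]
  proof (induction S rule: finite_induct)
    case empty
    have "(\<forall>i. h $ i = 0) \<longleftrightarrow> h = 0" for h :: "'k ^ 'n" by (simp add: vec_eq_iff)
    then show ?case by (intro exI[of _ 1]) simp
  next
    case (insert j S)
    then obtain d where d: "d > 0" "\<And>h. norm h < d \<Longrightarrow> (\<And>i. i \<notin> S \<Longrightarrow> h $ i = 0) \<Longrightarrow>
      norm (f (x + h) - f x - (\<Sum>i\<in>S. h $ i * pd i f x)) \<le> e * (\<Sum>i\<in>S. norm (h $ i))"
      by blast
    obtain r where r: "r > 0" "ball x r \<subseteq> U" using U openE by blast
    have "continuous_on U (pd j f)" by (rule f(2))
    then obtain d' where d': "d' > 0" "\<And>y. y \<in> U \<Longrightarrow> dist y x < d' \<Longrightarrow> dist (pd j f y) (pd j f x) < e"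
      using U(2) \<open>e > 0\<close> unfolding continuous_on_iff by metis
    let ?d = "min d (min r d') / 2"
    have "norm (f (x + h) - f x - (\<Sum>i\<in>insert j S. h $ i * pd i f x)) \<le> e * (\<Sum>i\<in>insert j S. norm (h $ i))"
      if h: "norm h < ?d" "\<And>i. i \<notin> insert j S \<Longrightarrow> h $ i = 0" for h
    proof -
      define h' where "h' = h - axis j (h $ j)"
      have hj: "h' $ i = (if i = j then 0 else h $ i)" for i by (simp add: h'_def axis_def)
      have nh': "norm (h' + axis j s) \<le> norm h + norm s" if "norm s \<le> norm (h $ j)" for s
      proof -
        have "norm h' \<le> norm h"
          unfolding norm_vec_def by (rule L2_set_mono) (auto simp: hj)
        then show ?thesis using norm_triangle_ineq[of h' "axis j s"] by (simp add: norm_axis_eq)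
      qed
      have hjn: "norm (h $ j) \<le> norm h" by (rule Finite_Cartesian_Product.norm_nth_le)
      have small: "norm (h' + axis j s) < min d (min r d')" if "norm s \<le> norm (h $ j)" for s
        using nh'[OF that] hjn h(1) that by linarith
      have "norm (f (x + h') - f x - (\<Sum>i\<in>S. h' $ i * pd i f x)) \<le> e * (\<Sum>i\<in>S. norm (h' $ i))"
      proof (rule d(2))
        have "norm (h' + axis j 0) < d" using small[of 0] by simp
        moreover have "axis j 0 = (0 :: 'k ^ 'n)" by (simp add: axis_eq_0_iff)
        ultimately show "norm h' < d" by (simp only: add_0_right)
      qed (use h(2) in \<open>auto simp: hj\<close>)
      moreover have "(\<Sum>i\<in>S. h' $ i * pd i f x) = (\<Sum>i\<in>S. h $ i * pd i f x)"
        "(\<Sum>i\<in>S. norm (h' $ i)) = (\<Sum>i\<in>S. norm (h $ i))"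
        using insert.hyps by (auto intro!: sum.cong simp: hj)
      moreover have "norm (f (x + h) - f (x + h') - h $ j * pd j f x) \<le> e * norm (h $ j)"
      proof -
        let ?g = "\<lambda>s. f ((x + h') + s *s axis j 1) - s * pd j f x"
        let ?B = "cball (0::'k) (norm (h $ j))"
        have inU: "x + h' + s *s axis j 1 \<in> U" "dist (x + h' + s *s axis j 1) x < d'" if "s \<in> ?B" for s
        proof -
          have "norm (h' + axis j s) < min d (min r d')" by (rule small) (use that in simp)
          then have "dist (x + h' + s *s axis j 1) x < min r d'"
            by (simp add: smult_axis dist_norm add.assoc)
          then show "x + h' + s *s axis j 1 \<in> U" "dist (x + h' + s *s axis j 1) x < d'"
            using r(2) by (auto simp: dist_commute)
        qed
        have "norm (?g (h $ j) - ?g 0) \<le> e * norm (h $ j - 0)"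
        proof (rule field_differentiable_bound[of ?B ?g "\<lambda>s. pd j f (x + h' + s *s axis j 1) - pd j f x"])
          fix s assume s: "s \<in> ?B"
          have "((\<lambda>s. f (x + h' + s *s axis j 1)) has_field_derivative pd j f (x + h' + s *s axis j 1)) (at s)"
            by (intro has_pd_at f(1) inU(1)[OF s])
          then have "(?g has_field_derivative pd j f (x + h' + s *s axis j 1) - 1 * pd j f x) (at s)"
            by (intro DERIV_diff DERIV_cmult_right) auto
          then show "(?g has_field_derivative pd j f (x + h' + s *s axis j 1) - pd j f x) (at s within ?B)"
            by (auto intro: has_field_derivative_at_within)
          show "norm (pd j f (x + h' + s *s axis j 1) - pd j f x) \<le> e"
            using d'(2)[OF inU[OF s]] by (simp add: dist_norm)
        qed auto
        moreover have "x + h' + (h $ j) *s axis j 1 = x + h"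
          by (simp add: smult_axis h'_def)
        ultimately have "norm ((f (x + h) - h $ j * pd j f x) - ?g 0) \<le> e * norm (h $ j - 0)"
          by (simp only:)
        then show ?thesis by (simp add: algebra_simps)
      qed
      moreover have "f (x + h) - f x - (\<Sum>i\<in>insert j S. h $ i * pd i f x) =
         (f (x + h) - f (x + h') - h $ j * pd j f x) + (f (x + h') - f x - (\<Sum>i\<in>S. h $ i * pd i f x))"
        using insert.hyps by (simp add: algebra_simps)
      ultimately have "norm (f (x + h) - f x - (\<Sum>i\<in>insert j S. h $ i * pd i f x))
          \<le> e * norm (h $ j) + e * (\<Sum>i\<in>S. norm (h $ i))"
        by (simp only: norm_triangle_le add_mono)
      then show ?thesis
        using insert.hyps by (simp add: distrib_left)
    qed
    then show ?case using d(1) d'(1) r(1) by (intro exI[of _ ?d]) auto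
  qed
  have bl: "bounded_linear (\<lambda>h. \<Sum>i\<in>UNIV. h $ i * pd i f x)"
    by (intro bounded_linear_sum bounded_linear_mult_const bounded_linear_vec_nth)
  show ?thesis
    unfolding has_derivative_at_alt
  proof (intro conjI allI impI bl)
    fix e :: real assume "e > 0"
    then have e': "e / of_nat CARD('n) > 0" by simp
    obtain d where d: "d > 0" "\<And>h. norm h < d \<Longrightarrow>
      norm (f (x + h) - f x - (\<Sum>i\<in>UNIV. h $ i * pd i f x)) \<le> e / of_nat CARD('n) * (\<Sum>i\<in>UNIV. norm (h $ i))"
      using *[OF e', of UNIV] by auto
    have "norm (f y - f x - (\<Sum>i\<in>UNIV. (y - x) $ i * pd i f x)) \<le> e * norm (y - x)" if "norm (y - x) < d" for y
    proof -
      have "(\<Sum>i\<in>UNIV. norm ((y - x) $ i)) \<le> of_nat CARD('n) * norm (y - x)"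
        by (rule sum_bounded_above[of UNIV "\<lambda>i. norm ((y - x) $ i)" "norm (y - x)"])
          (rule Finite_Cartesian_Product.norm_nth_le)
      then have "e / of_nat CARD('n) * (\<Sum>i\<in>UNIV. norm ((y - x) $ i)) \<le> e / of_nat CARD('n) * (of_nat CARD('n) * norm (y - x))"
        using e' by (intro mult_left_mono) auto
      then show ?thesis using d(2)[OF that] by simp
    qed
    then show "\<exists>d>0. \<forall>y. norm (y - x) < d \<longrightarrow> norm (f y - f x - (\<Sum>i\<in>UNIV. (y - x) $ i * pd i f x)) \<le> e * norm (y - x)"
      using d(1) by auto
  qed
qed

corollary C1_has_derivative:
  fixes f :: "'k::real_normed_field ^ 'n::finite \<Rightarrow> 'k"
  assumes U: "open U" "x \<in> U" and f: "Ck 1 U f"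
  shows "(f has_derivative (\<lambda>h. \<Sum>i\<in>UNIV. h $ i * pd i f x)) (at x)"
  by (rule has_derivative_of_continuous_pd[OF U]) (use f in auto)

text \<open>
  The mixed second difference of step \<open>h\<close> is approximated by \<open>h\<^sup>2\<close> times a mixed derivative: the mean value
  inequality is applied first in direction \<open>i\<close> and then, to the derivative, in direction \<open>j\<close>.
\<close>

lemma second_difference_bound:
  fixes f :: "'k::real_normed_field ^ 'n::finite \<Rightarrow> 'k"
  assumes U: "open U" "x \<in> U" and f: "Ck 2 U f" and e: "e > 0"
  shows "\<exists>d>0. \<forall>h. norm h < d \<longrightarrow>
     norm (f (x + h *s axis i 1 + h *s axis j 1) - f (x + h *s axis i 1) - f (x + h *s axis j 1) + f x
        - h * (h * pd j (pd i f) x)) \<le> e * norm h * norm h"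
proof -
  define P where "P = pd j (pd i f) x"
  have C2: "continuous_on U (pd j (pd i f))" "\<And>y l. y \<in> U \<Longrightarrow> differentiable_along f l y"
    "\<And>y l l'. y \<in> U \<Longrightarrow> differentiable_along (pd l f) l' y"
    using f by (auto simp: numeral_2_eq_2)
  obtain r where r: "r > 0" "ball x r \<subseteq> U" using U openE by blast
  obtain d where d: "d > 0" "\<And>y. y \<in> U \<Longrightarrow> dist y x < d \<Longrightarrow> dist (pd j (pd i f) y) P < e"
    using C2(1) U(2) e unfolding continuous_on_iff P_def by metis
  let ?d = "min r d / 2"
  have "norm (f (x + h *s axis i 1 + h *s axis j 1) - f (x + h *s axis i 1) - f (x + h *s axis j 1) + f x
        - h * (h * P)) \<le> e * norm h * norm h" if h: "norm h < ?d" for h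
  proof -
    let ?B = "cball (0::'k) (norm h)"
    have near: "x + s *s axis i 1 + t *s axis j 1 \<in> U" "dist (x + s *s axis i 1 + t *s axis j 1) x < d"
      if "s \<in> ?B" "t \<in> ?B" for s t
    proof -
      have "norm (s *s axis i 1 + t *s axis j 1 :: 'k ^ 'n) \<le> norm s + norm t"
        using norm_triangle_ineq[of "axis i s :: 'k ^ 'n" "axis j t"] by (simp add: smult_axis norm_axis_eq)
      then have "dist (x + s *s axis i 1 + t *s axis j 1) x < min r d"
        using that h by (simp add: dist_norm add.assoc)
      then show "x + s *s axis i 1 + t *s axis j 1 \<in> U" "dist (x + s *s axis i 1 + t *s axis j 1) x < d"
        using r(2) by (auto simp: dist_commute)
    qed
    have inner: "norm (pd i f (x + s *s axis i 1 + h *s axis j 1) - pd i f (x + s *s axis i 1) - h * P) \<le> e * norm h"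
      if s: "s \<in> ?B" for s
    proof -
      let ?g = "\<lambda>t. pd i f ((x + s *s axis i 1) + t *s axis j 1) - t * P"
      have "norm (?g h - ?g 0) \<le> e * norm (h - 0)"
      proof (rule field_differentiable_bound[of ?B ?g "\<lambda>t. pd j (pd i f) (x + s *s axis i 1 + t *s axis j 1) - P"])
        fix t assume t: "t \<in> ?B"
        have "((\<lambda>t. pd i f ((x + s *s axis i 1) + t *s axis j 1)) has_field_derivative
           pd j (pd i f) (x + s *s axis i 1 + t *s axis j 1)) (at t)"
          by (rule has_pd_at) (rule C2(3)[OF near(1)[OF s t]])
        then have "(?g has_field_derivative pd j (pd i f) (x + s *s axis i 1 + t *s axis j 1) - 1 * P) (at t)"
          by (intro DERIV_diff DERIV_cmult_right) auto
        then show "(?g has_field_derivative pd j (pd i f) (x + s *s axis i 1 + t *s axis j 1) - P) (at t within ?B)"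
          by (auto intro: has_field_derivative_at_within)
        show "norm (pd j (pd i f) (x + s *s axis i 1 + t *s axis j 1) - P) \<le> e"
          using d(2)[OF near[OF s t]] by (simp add: dist_norm)
      qed auto
      then show ?thesis by (simp add: algebra_simps)
    qed
    let ?G = "\<lambda>s. f ((x + h *s axis j 1) + s *s axis i 1) - f (x + s *s axis i 1) - s * (h * P)"
    have "norm (?G h - ?G 0) \<le> (e * norm h) * norm (h - 0)"
    proof (rule field_differentiable_bound[of ?B ?G
          "\<lambda>s. pd i f (x + h *s axis j 1 + s *s axis i 1) - pd i f (x + s *s axis i 1) - h * P"])
      fix s assume s: "s \<in> ?B"
      have "x + h *s axis j 1 + s *s axis i 1 \<in> U"
        using near(1)[OF s, of h] by (simp add: algebra_simps)
      then have 1: "((\<lambda>s. f ((x + h *s axis j 1) + s *s axis i 1)) has_field_derivative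
           pd i f (x + h *s axis j 1 + s *s axis i 1)) (at s)"
        by (intro has_pd_at C2(2))
      have "x + s *s axis i 1 \<in> U" using near(1)[OF s, of 0] by simp
      then have 2: "((\<lambda>s. f (x + s *s axis i 1)) has_field_derivative pd i f (x + s *s axis i 1)) (at s)"
        by (intro has_pd_at C2(2))
      have "(?G has_field_derivative pd i f (x + h *s axis j 1 + s *s axis i 1) - pd i f (x + s *s axis i 1) - 1 * (h * P)) (at s)"
        by (intro DERIV_diff DERIV_cmult_right 1 2) auto
      then show "(?G has_field_derivative pd i f (x + h *s axis j 1 + s *s axis i 1) - pd i f (x + s *s axis i 1) - h * P) (at s within ?B)"
        by (auto intro: has_field_derivative_at_within)
      show "norm (pd i f (x + h *s axis j 1 + s *s axis i 1) - pd i f (x + s *s axis i 1) - h * P) \<le> e * norm h"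
        using inner[OF s] by (simp add: algebra_simps)
    qed auto
    then show ?thesis by (simp add: algebra_simps)
  qed
  then show ?thesis using r(1) d(1) unfolding P_def by (intro exI[of _ ?d]) auto
qed

text \<open>
  The second difference does not depend on the order of the directions, so both mixed derivatives
  approximate it.
\<close>

lemma pd_commute:
  fixes f :: "'k::real_normed_field ^ 'n::finite \<Rightarrow> 'k"
  assumes U: "open U" "x \<in> U" and f: "Ck 2 U f"
  shows "pd i (pd j f) x = pd j (pd i f) x"
proof (rule ccontr)
  assume ne: "pd i (pd j f) x \<noteq> pd j (pd i f) x"
  define e where "e = norm (pd i (pd j f) x - pd j (pd i f) x) / 4"
  have e: "e > 0" using ne by (simp add: e_def)
  obtain d1 where d1: "d1 > 0" "\<And>h. norm h < d1 \<Longrightarrow>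
     norm (f (x + h *s axis i 1 + h *s axis j 1) - f (x + h *s axis i 1) - f (x + h *s axis j 1) + f x
        - h * (h * pd j (pd i f) x)) \<le> e * norm h * norm h"
    using second_difference_bound[OF U f e] by blast
  obtain d2 where d2: "d2 > 0" "\<And>h. norm h < d2 \<Longrightarrow>
     norm (f (x + h *s axis j 1 + h *s axis i 1) - f (x + h *s axis j 1) - f (x + h *s axis i 1) + f x
        - h * (h * pd i (pd j f) x)) \<le> e * norm h * norm h"
    using second_difference_bound[OF U f e] by blast
  define h :: 'k where "h = of_real (min d1 d2 / 2)"
  have h: "norm h < d1" "norm h < d2" "norm h > 0" using d1(1) d2(1) by (auto simp: h_def)
  let ?D = "f (x + h *s axis i 1 + h *s axis j 1) - f (x + h *s axis i 1) - f (x + h *s axis j 1) + f x"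
  have 1: "norm (?D - h * (h * pd j (pd i f) x)) \<le> e * norm h * norm h" by (rule d1(2)[OF h(1)])
  have 2: "norm (?D - h * (h * pd i (pd j f) x)) \<le> e * norm h * norm h"
    using d2(2)[OF h(2)] by (simp add: algebra_simps)
  have "h * h * (pd i (pd j f) x - pd j (pd i f) x) =
     (?D - h * (h * pd j (pd i f) x)) - (?D - h * (h * pd i (pd j f) x))"
    by (simp add: algebra_simps)
  then have "norm (h * h * (pd i (pd j f) x - pd j (pd i f) x)) \<le> 2 * e * norm h * norm h"
    using norm_triangle_ineq4[of "?D - h * (h * pd j (pd i f) x)" "?D - h * (h * pd i (pd j f) x)"] 1 2 by simp
  moreover have "norm (h * h * (pd i (pd j f) x - pd j (pd i f) x)) = (4 * e) * (norm h * norm h)"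
    by (simp only: norm_mult e_def) simp
  ultimately have "(4 * e) * (norm h * norm h) \<le> (2 * e) * (norm h * norm h)" by simp
  moreover have "norm h * norm h > 0" using h(3) by simp
  ultimately show False using e by simp
qed

lemma bounded_linear_axis: "bounded_linear (axis i :: 'a::real_normed_vector \<Rightarrow> 'a ^ 'n::finite)"
  by (rule bounded_linear_intro[of _ 1]) (auto simp: vec_eq_iff axis_def norm_axis_eq[unfolded axis_def])

text \<open>
  A vector is the sum of its components along the axes, which reduces the claim to bounded linear
  images of the derivatives of the components.
\<close>

lemma has_derivative_vec:
  fixes g :: "'a::real_normed_vector \<Rightarrow> 'b::real_normed_vector ^ 'n::finite"
  assumes "\<And>i. ((\<lambda>x. g x $ i) has_derivative (\<lambda>h. g' h $ i)) F"
  shows "(g has_derivative g') F"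
proof -
  have ex: "v = (\<Sum>i\<in>UNIV. axis i (v $ i))" for v :: "'b ^ 'n"
    by (simp add: vec_eq_iff axis_def if_distrib if_distribR cong: if_cong)
  have "((\<lambda>x. \<Sum>i\<in>UNIV. axis i (g x $ i)) has_derivative (\<lambda>h. \<Sum>i\<in>UNIV. axis i (g' h $ i) :: 'b ^ 'n)) F"
    by (intro has_derivative_sum bounded_linear.has_derivative[OF bounded_linear_axis] assms)
  then show ?thesis using ex by simp
qed

lemma pd_compose:
  fixes f :: "'k::real_normed_field ^ 'm::finite \<Rightarrow> 'k" and \<phi> :: "'k ^ 'n::finite \<Rightarrow> 'k ^ 'm"
  assumes U: "open U" "\<phi> x \<in> U" and f: "Ck 1 U f" and \<phi>: "\<And>l. differentiable_along (\<lambda>v. \<phi> v $ l) i x"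
  shows "pd i (\<lambda>v. f (\<phi> v)) x = (\<Sum>l\<in>UNIV. pd i (\<lambda>v. \<phi> v $ l) x * pd l f (\<phi> x))"
    "differentiable_along (\<lambda>v. f (\<phi> v)) i x"
proof -
  let ?D = "\<lambda>s. \<chi> l. s * pd i (\<lambda>v. \<phi> v $ l) x"
  have "((\<lambda>s. \<phi> (x + s *s axis i 1)) has_derivative ?D) (at 0)"
    by (rule has_derivative_vec)
      (use has_pd[OF \<phi>] in \<open>simp add: has_field_derivative_def mult_commute_abs\<close>)
  moreover have "(f has_derivative (\<lambda>h. \<Sum>l\<in>UNIV. h $ l * pd l f (\<phi> x))) (at (\<phi> (x + 0 *s axis i 1)))"
    using C1_has_derivative[OF U f] by simp
  ultimately have "((\<lambda>s. f (\<phi> (x + s *s axis i 1))) has_derivative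
     (\<lambda>s. \<Sum>l\<in>UNIV. ?D s $ l * pd l f (\<phi> x))) (at 0)"
    by (rule has_derivative_compose)
  moreover have "(\<lambda>s. \<Sum>l\<in>UNIV. ?D s $ l * pd l f (\<phi> x)) =
     (*) (\<Sum>l\<in>UNIV. pd i (\<lambda>v. \<phi> v $ l) x * pd l f (\<phi> x))"
    by (simp add: fun_eq_iff sum_distrib_left sum_distrib_right mult.assoc mult.left_commute mult.commute)
  ultimately have "((\<lambda>s. f (\<phi> (x + s *s axis i 1))) has_field_derivative
     (\<Sum>l\<in>UNIV. pd i (\<lambda>v. \<phi> v $ l) x * pd l f (\<phi> x))) (at 0)"
    by (simp only: has_field_derivative_def)
  then show "pd i (\<lambda>v. f (\<phi> v)) x = (\<Sum>l\<in>UNIV. pd i (\<lambda>v. \<phi> v $ l) x * pd l f (\<phi> x))"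
    "differentiable_along (\<lambda>v. f (\<phi> v)) i x"
    by (auto intro: pd_eqI differentiable_alongI)
qed

lemma Ck_compose:
  fixes f :: "'k::real_normed_field ^ 'm::finite \<Rightarrow> 'k" and \<phi> :: "'k ^ 'n::finite \<Rightarrow> 'k ^ 'm"
  assumes U: "open U" and V: "open V" "\<And>v. v \<in> V \<Longrightarrow> \<phi> v \<in> U"
    and "Ck k U f" and \<phi>: "\<And>l. Ck k V (\<lambda>v. \<phi> v $ l)"
  shows "Ck k V (\<lambda>v. f (\<phi> v))"
  using assms(4,5)
proof (induction k arbitrary: f)
  case 0
  then have "continuous_on V \<phi>" by (intro continuous_on_vec_components) simp
  then show ?case using 0 V by (auto intro: continuous_on_compose2)
next
  case (Suc k)
  have 1: "Ck 1 U f" using Suc.prems(1) by (cases k) auto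
  have d: "differentiable_along (\<lambda>v. \<phi> v $ l) i x" if "x \<in> V" for l i x
    using Suc.prems(2) that by simp
  have "Ck 0 V (\<lambda>v. \<phi> v $ l)" for l using Suc.prems(2)[of l] by simp
  then have "continuous_on V \<phi>" by (intro continuous_on_vec_components) simp
  then have "continuous_on V (\<lambda>v. f (\<phi> v))"
    using Suc.prems(1) V by (auto intro: continuous_on_compose2)
  moreover have "Ck k V (\<lambda>v. \<Sum>l\<in>UNIV. pd i (\<lambda>v. \<phi> v $ l) v * pd l f (\<phi> v))" for i
  proof (rule Ck_sum[OF V(1)])
    fix l
    have "Ck k V (pd i (\<lambda>v. \<phi> v $ l))" using Suc.prems(2)[of l] by simp
    moreover have "Ck k U (pd l f)" using Suc.prems(1) by simp
    then have "Ck k V (\<lambda>v. pd l f (\<phi> v))" using Suc.IH Ck_Suc[OF Suc.prems(2)] by metis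
    ultimately show "Ck k V (\<lambda>v. pd i (\<lambda>v. \<phi> v $ l) v * pd l f (\<phi> v))"
      by (rule Ck_mult[OF V(1)])
  qed
  then have "Ck k V (pd i (\<lambda>v. f (\<phi> v)))" for i
    by (rule Ck_cong[OF V(1), rotated]) (simp add: pd_compose[OF U V(2) 1 d])
  ultimately show ?case using pd_compose(2)[OF U V(2) 1 d] by simp
qed

section \<open>Closed forms and functions with vanishing derivatives\<close>

text \<open>
  The potential is the integral of the form along the segments from a base point \<open>x\<^sub>0\<close>.  Closedness turns
  the integrand of its derivative in direction \<open>j\<close> into the derivative of
  \<open>t \<mapsto> t \<omega>\<^sub>j(x\<^sub>0 + t (x - x\<^sub>0))\<close>, so that the fundamental theorem of calculus applies.
\<close>

lemma poincare:
  fixes \<omega> :: "'n::finite \<Rightarrow> 'k::{real_normed_field,euclidean_space} ^ 'n \<Rightarrow> 'k"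
  assumes V: "open V" "convex V" and \<omega>: "\<And>i. Ck 1 V (\<omega> i)"
    and closed: "\<And>x i j. x \<in> V \<Longrightarrow> pd i (\<omega> j) x = pd j (\<omega> i) x"
  shows "\<exists>f. \<forall>x\<in>V. \<forall>i. differentiable_along f i x \<and> pd i f x = \<omega> i x"
proof (cases "V = {}")
  case False
  then obtain x0 where x0: "x0 \<in> V" by blast
  define f where "f x = integral (cbox (0::real) 1) (\<lambda>t. \<Sum>i\<in>UNIV. (x - x0) $ i * \<omega> i (x0 + t *\<^sub>R (x - x0)))" for x
  have seg: "x0 + t *\<^sub>R (x - x0) \<in> V" if "x \<in> V" "t \<in> cbox 0 1" for x t
  proof -
    have "(1 - t) *\<^sub>R x0 + t *\<^sub>R x \<in> V" using V(2) x0 that by (intro convexD) auto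
    then show ?thesis by (simp add: algebra_simps)
  qed
  have \<omega>c: "continuous_on V (\<omega> i)" "continuous_on V (pd j (\<omega> i))" for i j using \<omega>[of i] by auto
  have \<omega>d: "differentiable_along (\<omega> i) j x" if "x \<in> V" for i j x using \<omega>[of i] that by auto
  have main: "((\<lambda>s. f (x + s *s axis j 1)) has_field_derivative \<omega> j x) (at 0)" if x: "x \<in> V" for x j
  proof -
    obtain r where r: "r > 0" "ball x r \<subseteq> V" using V(1) x openE by blast
    define p where "p s t = x0 + t *\<^sub>R (x + s *s axis j 1 - x0)" for s :: 'k and t :: real
    define G where "G s t = (\<Sum>i\<in>UNIV. (x + s *s axis j 1 - x0) $ i * \<omega> i (p s t))" for s :: 'k and t :: real
    define G' where "G' s t = (\<Sum>i\<in>UNIV. (if i = j then 1 else 0) * \<omega> i (p s t)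
        + (x + s *s axis j 1 - x0) $ i * (of_real t * pd j (\<omega> i) (p s t)))" for s :: 'k and t :: real
    let ?B = "ball (0::'k) r"
    have line: "x + s *s axis j 1 \<in> V" if "s \<in> ?B" for s
      using that r(2) by (auto simp: smult_axis dist_norm norm_axis_eq)
    have pV: "p s t \<in> V" if "s \<in> ?B" "t \<in> cbox 0 1" for s t
      unfolding p_def using seg line that by blast
    have pc: "continuous_on S (\<lambda>z. p (fst z) (snd z))" for S
      unfolding p_def by (intro continuous_on_vec_components) (auto intro!: continuous_intros)
    have pc': "continuous_on S (p s)" for S s
      unfolding p_def by (intro continuous_on_vec_components) (auto intro!: continuous_intros)
    \<comment> \<open>Differentiation under the integral sign.\<close>
    have "((\<lambda>s. integral (cbox 0 1) (G s)) has_field_derivative integral (cbox 0 1) (G' 0)) (at 0 within ?B)"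
    proof (rule leibniz_rule_field_derivative)
      fix s t assume st: "s \<in> ?B" "t \<in> cbox 0 (1::real)"
      have D1: "((\<lambda>s. \<omega> i (p s t)) has_field_derivative of_real t * pd j (\<omega> i) (p s t)) (at s)" for i
      proof -
        have p: "p s t = (x0 + t *\<^sub>R (x - x0)) + (of_real t * s) *s axis j 1" for s
          unfolding p_def vec_eq_iff vector_add_component vector_minus_component
            vector_scaleR_component vector_smult_component
          by (simp add: algebra_simps scaleR_conv_of_real)
        have "((\<lambda>s. \<omega> i ((x0 + t *\<^sub>R (x - x0)) + s *s axis j 1)) has_field_derivative pd j (\<omega> i) (p s t)) (at (of_real t * s))"
          unfolding p by (rule has_pd_at) (use \<omega>d pV[OF st] p in auto)
        moreover have "((\<lambda>s. of_real t * s) has_field_derivative of_real t) (at s)"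
          using DERIV_cmult_Id by blast
        ultimately have "((\<lambda>s. \<omega> i ((x0 + t *\<^sub>R (x - x0)) + (of_real t * s) *s axis j 1)) has_field_derivative
            pd j (\<omega> i) (p s t) * of_real t) (at s)"
          by (rule DERIV_chain2)
        then show ?thesis by (simp add: p mult.commute)
      qed
      have D2: "((\<lambda>s. (x + s *s axis j 1 - x0) $ i) has_field_derivative (if i = j then 1 else 0)) (at s)" for i
        by (auto simp: axis_def intro!: derivative_eq_intros)
      have "((\<lambda>s. (x + s *s axis j 1 - x0) $ i * \<omega> i (p s t)) has_field_derivative
          (if i = j then 1 else 0) * \<omega> i (p s t) + (x + s *s axis j 1 - x0) $ i * (of_real t * pd j (\<omega> i) (p s t))) (at s)" for i
        using DERIV_mult[OF D2 D1, of i i]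
        by (simp only: mult.commute[of "of_real t * pd j (\<omega> i) (p s t)"])
      then have "((\<lambda>s. G s t) has_field_derivative G' s t) (at s)"
        unfolding G_def G'_def by (intro DERIV_sum)
      then show "((\<lambda>s. G s t) has_field_derivative G' s t) (at s within ?B)"
        by (rule has_field_derivative_at_within)
    next
      fix s assume s: "s \<in> ?B"
      have "continuous_on (cbox 0 1) (G s)"
        unfolding G_def
        by (intro continuous_intros continuous_on_compose2[OF \<omega>c(1) pc']) (use pV[OF s] in auto)
      then show "G s integrable_on cbox 0 1" by (rule integrable_continuous)
    next
      show "continuous_on (?B \<times> cbox 0 1) (\<lambda>(s, t). G' s t)"
        unfolding G'_def split_beta vector_add_component vector_minus_component vector_smult_component
        by (intro continuous_intros continuous_on_compose2[OF \<omega>c(1) pc] continuous_on_compose2[OF \<omega>c(2) pc])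
          (use pV in \<open>auto intro!: continuous_intros\<close>)
    qed (use r(1) in auto)
    then have D: "((\<lambda>s. f (x + s *s axis j 1)) has_field_derivative integral (cbox 0 1) (G' 0)) (at 0)"
      using r(1) by (simp add: at_within_open[of 0 ?B] f_def G_def[abs_def] p_def)
    have "(G' 0 has_integral 1 *\<^sub>R \<omega> j (p 0 1) - 0 *\<^sub>R \<omega> j (p 0 0)) {0..1}"
    proof (rule fundamental_theorem_of_calculus)
      fix t :: real assume t: "t \<in> {0..1}"
      have pt: "p 0 t \<in> V" using pV[of 0 t] t r(1) by simp
      have "(p 0 has_derivative (\<lambda>h. h *\<^sub>R (x - x0))) (at t)"
        unfolding p_def by (auto intro!: derivative_eq_intros)
      from has_derivative_compose[OF this C1_has_derivative[OF V(1) pt \<omega>]]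
      have "((\<lambda>t. \<omega> j (p 0 t)) has_derivative (\<lambda>h. \<Sum>i\<in>UNIV. (h *\<^sub>R (x - x0)) $ i * pd i (\<omega> j) (p 0 t))) (at t)" .
      then have "((\<lambda>t. \<omega> j (p 0 t)) has_vector_derivative (\<Sum>i\<in>UNIV. (x - x0) $ i * pd i (\<omega> j) (p 0 t))) (at t)"
        by (simp add: has_vector_derivative_def scaleR_sum_right)
      from has_vector_derivative_scaleR[OF DERIV_ident this]
      have "((\<lambda>t. t *\<^sub>R \<omega> j (p 0 t)) has_vector_derivative
         t *\<^sub>R (\<Sum>i\<in>UNIV. (x - x0) $ i * pd i (\<omega> j) (p 0 t)) + 1 *\<^sub>R \<omega> j (p 0 t)) (at t)" .
      moreover have "t *\<^sub>R (\<Sum>i\<in>UNIV. (x - x0) $ i * pd i (\<omega> j) (p 0 t)) + 1 *\<^sub>R \<omega> j (p 0 t) = G' 0 t"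
      proof -
        have p0: "x + 0 *s axis j 1 - x0 = x - x0" by simp
        have c: "pd j (\<omega> i) (p 0 t) = pd i (\<omega> j) (p 0 t)" for i by (rule closed[OF pt])
        have "G' 0 t = (\<Sum>i\<in>UNIV. if i = j then \<omega> i (p 0 t) else 0)
            + (\<Sum>i\<in>UNIV. (x - x0) $ i * (of_real t * pd i (\<omega> j) (p 0 t)))"
          unfolding G'_def sum.distrib
          by (rule arg_cong2[where f=plus]; rule sum.cong[OF refl])
            (simp_all only: c mult_if_delta p0)
        also have "(\<Sum>i\<in>UNIV. if i = j then \<omega> i (p 0 t) else 0) = \<omega> j (p 0 t)" by simp
        also have "(\<Sum>i\<in>UNIV. (x - x0) $ i * (of_real t * pd i (\<omega> j) (p 0 t))) =
            t *\<^sub>R (\<Sum>i\<in>UNIV. (x - x0) $ i * pd i (\<omega> j) (p 0 t))"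
          by (simp only: scaleR_conv_of_real sum_distrib_left mult.left_commute)
        finally show ?thesis by (simp only: scaleR_one add.commute)
      qed
      ultimately show "((\<lambda>t. t *\<^sub>R \<omega> j (p 0 t)) has_vector_derivative G' 0 t) (at t within {0..1})"
        by (simp add: has_vector_derivative_at_within)
    qed simp
    then have "integral (cbox 0 1) (G' 0) = \<omega> j x"
      by (simp add: integral_unique p_def)
    then show ?thesis using D by simp
  qed
  then have "\<forall>x\<in>V. \<forall>i. differentiable_along f i x \<and> pd i f x = \<omega> i x"
    using pd_eqI[OF main] differentiable_alongI[OF main] by simp
  then show ?thesis by blast
qed simp

lemma const_of_pd_zero:
  fixes f :: "'k::real_normed_field ^ 'n::finite \<Rightarrow> 'k"
  assumes V: "open V" "convex V" and f: "Ck 1 V f" "\<And>x i. x \<in> V \<Longrightarrow> pd i f x = 0"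
  shows "\<exists>c. \<forall>x\<in>V. f x = c"
proof (rule has_derivative_zero_constant[OF V(2)])
  fix x assume x: "x \<in> V"
  show "(f has_derivative (\<lambda>h. 0)) (at x within V)"
    using C1_has_derivative[OF V(1) x f(1)] f(2)[OF x] by (simp add: has_derivative_at_withinI)
qed

lemma pd_linear_form:
  "pd i (\<lambda>y. \<Sum>k\<in>UNIV. B k * y $ k) x = B i" "differentiable_along (\<lambda>y. \<Sum>k\<in>UNIV. B k * y $ k) i x"
proof -
  have d: "differentiable_along (\<lambda>y. B k * y $ k) i x" for k by (intro pd_mult pd_const pd_coord)
  show "pd i (\<lambda>y. \<Sum>k\<in>UNIV. B k * y $ k) x = B i"
    by (subst pd_sum(1)[OF d])
      (simp add: pd_mult pd_const pd_coord if_distrib cong: if_cong)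
  show "differentiable_along (\<lambda>y. \<Sum>k\<in>UNIV. B k * y $ k) i x" by (rule pd_sum(2)[OF d])
qed

lemma affine_of_pd_const:
  fixes f :: "'k::real_normed_field ^ 'n::finite \<Rightarrow> 'k"
  assumes V: "open V" "convex V" and f: "Ck 1 V f" "\<And>x i. x \<in> V \<Longrightarrow> pd i f x = B i"
  shows "\<exists>C. \<forall>x\<in>V. f x = (\<Sum>i\<in>UNIV. B i * x $ i) + C"
proof -
  let ?g = "\<lambda>x. f x + (\<Sum>i\<in>UNIV. - B i * x $ i)"
  have "Ck 1 V ?g"
    by (intro Ck_add Ck_sum Ck_mult Ck_const Ck_coord V(1) f(1))
  moreover have "pd i ?g x = 0" if "x \<in> V" for x i
  proof -
    have "pd i ?g x = pd i f x + pd i (\<lambda>x. \<Sum>i\<in>UNIV. - B i * x $ i) x"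
      by (rule pd_add(1)) (use f(1) that pd_linear_form(2)[of "\<lambda>i. - B i"] in auto)
    then show ?thesis using f(2)[OF that] pd_linear_form(1)[of i "\<lambda>i. - B i" x] by (simp only: add.right_inverse)
  qed
  ultimately obtain c where "\<forall>x\<in>V. ?g x = c" using const_of_pd_zero[OF V] by blast
  then have "\<forall>x\<in>V. f x = (\<Sum>i\<in>UNIV. B i * x $ i) + c"
    by (auto simp: sum_negf algebra_simps)
  then show ?thesis by blast
qed

lemma affine_of_second_pd_zero:
  fixes f :: "'k::real_normed_field ^ 'n::finite \<Rightarrow> 'k"
  assumes V: "open V" "convex V" and f: "Ck 2 V f" "\<And>x i j. x \<in> V \<Longrightarrow> pd i (pd j f) x = 0"
  shows "\<exists>B C. \<forall>x\<in>V. f x = (\<Sum>i\<in>UNIV. B i * x $ i) + C"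
proof -
  have "\<exists>c. \<forall>x\<in>V. pd i f x = c" for i
    by (rule const_of_pd_zero[OF V]) (use f in \<open>auto simp: numeral_2_eq_2\<close>)
  then obtain B where "\<And>x i. x \<in> V \<Longrightarrow> pd i f x = B i" by metis
  then show ?thesis using affine_of_pd_const[OF V, of f B] f(1) by (auto simp: numeral_2_eq_2)
qed

lemma quadratic_of_third_pd_zero:
  fixes f :: "'k::real_normed_field ^ 'n::finite \<Rightarrow> 'k"
  assumes V: "open V" "convex V" and f: "Ck 3 V f" "\<And>x i j k. x \<in> V \<Longrightarrow> pd i (pd j (pd k f)) x = 0"
  shows "\<exists>A B C. \<forall>x\<in>V. f x = (\<Sum>i\<in>UNIV. \<Sum>j\<in>UNIV. A i j * x $ i * x $ j) + (\<Sum>i\<in>UNIV. B i * x $ i) + C"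
proof (cases "V = {}")
  case False
  have f3: "Ck (Suc (Suc (Suc 0))) V f" using f(1) by (simp add: numeral_3_eq_3)
  have f2: "Ck 2 V f" using Ck_Suc[OF f3] by (simp add: numeral_2_eq_2)
  have "\<exists>B C. \<forall>x\<in>V. pd k f x = (\<Sum>i\<in>UNIV. B i * x $ i) + C" for k
    by (rule affine_of_second_pd_zero[OF V]) (use f f3 in \<open>auto simp: numeral_2_eq_2\<close>)
  then obtain A B where AB: "\<And>x k. x \<in> V \<Longrightarrow> pd k f x = (\<Sum>i\<in>UNIV. A k i * x $ i) + B k" by metis
  have "pd j (pd k f) x = A k j" if "x \<in> V" for x j k
  proof -
    have "pd j (pd k f) x = pd j (\<lambda>x. (\<Sum>i\<in>UNIV. A k i * x $ i) + B k) x"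
      by (rule pd_cong[OF V(1) that]) (rule AB)
    then show ?thesis by (simp add: pd_add pd_linear_form pd_const)
  qed
  then have sym: "A j k = A k j" for j k
    using False pd_commute[OF V(1) _ f2] by (metis ex_in_conv)
  \<comment> \<open>The factor 1/2 compensates that each mixed term occurs twice by the symmetry of \<open>A\<close>.\<close>
  let ?q = "\<lambda>x. \<Sum>i\<in>UNIV. x $ i * (\<Sum>j\<in>UNIV. (A i j / 2) * x $ j)"
  have d: "differentiable_along (\<lambda>x. x $ i * (\<Sum>j\<in>UNIV. (A i j / 2) * x $ j)) k x" for i k x
    by (intro pd_mult pd_coord pd_linear_form)
  have pq: "pd k ?q x = (\<Sum>i\<in>UNIV. A k i * x $ i)" for k x
  proof -
    have "pd k ?q x = (\<Sum>i\<in>UNIV. (if k = i then 1 else 0) * (\<Sum>j\<in>UNIV. (A i j / 2) * x $ j) + x $ i * (A i k / 2))"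
      by (subst pd_sum(1)[OF d])
        (simp only: pd_mult(1)[OF pd_coord(2) pd_linear_form(2)] pd_coord(1) pd_linear_form(1))
    also have "\<dots> = (\<Sum>j\<in>UNIV. A k j / 2 * x $ j) + (\<Sum>j\<in>UNIV. A k j / 2 * x $ j)"
      by (simp add: sum.distrib mult_if_delta sym[of _ k] mult.commute)
    also have "\<dots> = (\<Sum>i\<in>UNIV. A k i * x $ i)"
      by (simp add: sum.distrib[symmetric] field_simps)
    finally show ?thesis .
  qed
  have Cq: "Ck 1 V (\<lambda>x. (- 1) * ?q x)"
    by (intro Ck_sum Ck_mult Ck_const Ck_coord V(1))
  have "Ck 1 V (\<lambda>x. f x + (- 1) * ?q x)"
    using f2 by (intro Ck_add[OF V(1) _ Cq]) (simp add: numeral_2_eq_2)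
  moreover have "pd k (\<lambda>x. f x + (- 1) * ?q x) x = B k" if x: "x \<in> V" for x k
  proof -
    have "pd k (\<lambda>x. f x + (- 1) * ?q x) x = pd k f x + (0 * ?q x + (- 1) * pd k ?q x)"
      using f3 x Cq by (subst pd_add(1)) (simp_all only: pd_mult(1)[OF pd_const(2) pd_sum(2)[OF d]] pd_const, auto)
    then show ?thesis by (simp only: pq AB[OF x]) simp
  qed
  ultimately obtain C where "\<forall>x\<in>V. f x + (- 1) * ?q x = (\<Sum>i\<in>UNIV. B i * x $ i) + C"
    using affine_of_pd_const[OF V, of "\<lambda>x. f x + (- 1) * ?q x" B] by blast
  then have C: "f x = ?q x + (\<Sum>i\<in>UNIV. B i * x $ i) + C" if "x \<in> V" for x
    using that by (simp add: algebra_simps)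
  have "?q x = (\<Sum>i\<in>UNIV. \<Sum>j\<in>UNIV. (A i j / 2) * x $ i * x $ j)" for x
    by (simp add: sum_distrib_left algebra_simps)
  then have "\<forall>x\<in>V. f x = (\<Sum>i\<in>UNIV. \<Sum>j\<in>UNIV. (A i j / 2) * x $ i * x $ j) + (\<Sum>i\<in>UNIV. B i * x $ i) + C"
    using C by simp
  then show ?thesis by (intro exI)
qed simp

section \<open>Calculus of smooth functions\<close>

lemma smooth_onD:
  assumes "smooth_on U f"
  shows "smooth_on U (pd i f)" "x \<in> U \<Longrightarrow> differentiable_along f i x" "Ck k U f" "continuous_on U f"
  using assms smooth_on_rec[of U f] smooth_on_imp_Ck by auto

lemma smooth_on_const: "smooth_on U (\<lambda>y. c)"
  and smooth_on_coord: "smooth_on U (\<lambda>y. y $ j)"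
  by (simp_all add: smooth_on_iff_Ck Ck_const Ck_coord)

lemma smooth_on_add: "open U \<Longrightarrow> smooth_on U f \<Longrightarrow> smooth_on U g \<Longrightarrow> smooth_on U (\<lambda>y. f y + g y)"
  and smooth_on_mult: "open U \<Longrightarrow> smooth_on U f \<Longrightarrow> smooth_on U g \<Longrightarrow> smooth_on U (\<lambda>y. f y * g y)"
  and smooth_on_sum: "open U \<Longrightarrow> (\<And>a. a \<in> A \<Longrightarrow> smooth_on U (h a)) \<Longrightarrow> smooth_on U (\<lambda>y. \<Sum>a\<in>A. h a y)"
  by (simp_all add: smooth_on_iff_Ck Ck_add Ck_mult Ck_sum)

lemma smooth_on_compose:
  fixes f :: "'k::real_normed_field ^ 'm::finite \<Rightarrow> 'k" and \<phi> :: "'k ^ 'n::finite \<Rightarrow> 'k ^ 'm"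
  assumes "open U" "open V" "\<And>v. v \<in> V \<Longrightarrow> \<phi> v \<in> U" "smooth_on U f" "\<And>l. smooth_on V (\<lambda>v. \<phi> v $ l)"
  shows "smooth_on V (\<lambda>v. f (\<phi> v))"
  unfolding smooth_on_iff_Ck
  by (rule allI, rule Ck_compose[OF assms(1-3) smooth_onD(3)[OF assms(4)] smooth_onD(3)[OF assms(5)]])

lemma smooth_on_pd_commute:
  assumes "open U" "x \<in> U" "smooth_on U f"
  shows "pd i (pd j f) x = pd j (pd i f) x"
  by (rule pd_commute[OF assms(1,2) smooth_onD(3)[OF assms(3)]])

lemma third_commute:
  assumes "open U" "x \<in> U" "smooth_on U f"
  shows "third f i j k x = third f j i k x" "third f i j k x = third f i k j x"
  unfolding third_def
  by (rule smooth_on_pd_commute[OF assms(1,2) smooth_onD(1)[OF assms(3)]])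
    (rule pd_cong[OF assms(1,2)], rule smooth_on_pd_commute[OF assms(1) _ assms(3)])

lemma smooth_on_of_pd:
  fixes f :: "'k::real_normed_field ^ 'n::finite \<Rightarrow> 'k"
  assumes V: "open V" and f: "\<And>x i. x \<in> V \<Longrightarrow> differentiable_along f i x \<and> pd i f x = \<omega> i x"
    and \<omega>: "\<And>i. smooth_on V (\<omega> i)"
  shows "smooth_on V f"
proof -
  have s: "smooth_on V (pd i f)" for i
    by (rule smooth_on_cong[OF V _ \<omega>[of i]]) (simp add: f)
  have "continuous_on V f"
  proof (rule has_derivative_continuous_on)
    fix x assume x: "x \<in> V"
    have "(f has_derivative (\<lambda>h. \<Sum>i\<in>UNIV. h $ i * pd i f x)) (at x)"
      by (rule has_derivative_of_continuous_pd[OF V x]) (use f in blast, rule smooth_onD(4)[OF s])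
    then show "(f has_derivative (\<lambda>h. \<Sum>i\<in>UNIV. h $ i * pd i f x)) (at x within V)"
      by (rule has_derivative_at_withinI)
  qed
  then show ?thesis using s f smooth_on_rec[of V f] by blast
qed

text \<open>
  Integrate the first index, then the second, then the third.  The closedness needed for the second step
  comes from the symmetry of \<open>c\<close> in its first two indices; for the third step the potentials \<open>h\<^sub>j\<^sub>k\<close> must be symmetric,
  which is achieved by symmetrizing them: the symmetrized functions have the same derivatives because
  \<open>c\<close> is symmetric in its last two indices.
\<close>

lemma third_potential:
  fixes c :: "'n::finite \<Rightarrow> 'n \<Rightarrow> 'n \<Rightarrow> 'k::{real_normed_field,euclidean_space} ^ 'n \<Rightarrow> 'k"
  assumes V: "open V" "convex V" and smooth: "\<And>i j k. smooth_on V (c i j k)"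
    and sym: "\<And>x i j k. x \<in> V \<Longrightarrow> c i j k x = c j i k x" "\<And>x i j k. x \<in> V \<Longrightarrow> c i j k x = c i k j x"
    and closed: "\<And>x l i j k. x \<in> V \<Longrightarrow> pd l (c i j k) x = pd i (c l j k) x"
  shows "\<exists>f. smooth_on V f \<and> (\<forall>x\<in>V. \<forall>i j k. third f i j k x = c i j k x)"
proof -
  have "\<exists>f. \<forall>x\<in>V. \<forall>i. differentiable_along f i x \<and> pd i f x = c i j k x" for j k
    by (rule poincare[OF V], rule smooth_onD(3)[OF smooth], rule closed)
  then obtain h0 where h0: "\<And>j k x i. x \<in> V \<Longrightarrow> differentiable_along (h0 j k) i x \<and> pd i (h0 j k) x = c i j k x"
    by metis
  define h where "h j k x = (1/2) * (h0 j k x + h0 k j x)" for j k x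
  have h: "differentiable_along (h j k) i x \<and> pd i (h j k) x = c i j k x" if x: "x \<in> V" for i j k x
  proof -
    have d: "differentiable_along (\<lambda>x. h0 j k x + h0 k j x) i x"
      by (rule pd_add(2)) (simp_all add: h0[OF x])
    have "pd i (\<lambda>x. h0 j k x + h0 k j x) x = c i j k x + c i k j x"
      by (subst pd_add(1)) (simp_all add: h0[OF x])
    then show ?thesis
      unfolding h_def using pd_mult[OF pd_const(2)[of "1/2"] d] sym(2)[OF x, of i k j]
      by (simp add: pd_const)
  qed
  have hs: "smooth_on V (h j k)" for j k by (rule smooth_on_of_pd[OF V(1) h smooth])
  have "\<exists>f. \<forall>x\<in>V. \<forall>j. differentiable_along f j x \<and> pd j f x = h j k x" for k
    by (rule poincare[OF V], rule smooth_onD(3)[OF hs]) (simp add: h sym(1))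
  then obtain p where p: "\<And>k x j. x \<in> V \<Longrightarrow> differentiable_along (p k) j x \<and> pd j (p k) x = h j k x"
    by metis
  have ps: "smooth_on V (p k)" for k by (rule smooth_on_of_pd[OF V(1) p hs])
  have "\<exists>f. \<forall>x\<in>V. \<forall>k. differentiable_along f k x \<and> pd k f x = p k x"
    by (rule poincare[OF V], rule smooth_onD(3)[OF ps]) (simp add: p h_def add.commute)
  then obtain f where f: "\<And>x k. x \<in> V \<Longrightarrow> differentiable_along f k x \<and> pd k f x = p k x"
    by metis
  have "third f i j k x = c i j k x" if x: "x \<in> V" for i j k x
  proof -
    have "pd j (pd k f) y = h j k y" if "y \<in> V" for y
      using pd_cong[OF V(1) that, of "pd k f" "p k" j] f p that by simp
    then show ?thesis
      unfolding third_def using pd_cong[OF V(1) x, of "pd j (pd k f)" "h j k" i] h x by simp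
  qed
  moreover have "smooth_on V f" by (rule smooth_on_of_pd[OF V(1) f ps])
  ultimately show ?thesis by blast
qed

section \<open>Lie derivative along affine vector fields\<close>

definition affine_lie :: "'k::real_normed_field ^ 'n::finite ^ 'n \<Rightarrow> 'k ^ 'n \<Rightarrow> ('k ^ 'n \<Rightarrow> 'k) \<Rightarrow> 'k ^ 'n \<Rightarrow> 'k" where
  "affine_lie Q r f x = (\<Sum>l\<in>UNIV. (Q *v x + r) $ l * pd l f x)"

lemma affine_component: "(Q *v x + r) $ l = (\<Sum>i\<in>UNIV. Q $ l $ i * x $ i) + r $ l"
  by (simp add: matrix_vector_mult_def)

lemma pd_affine:
  "pd k (\<lambda>x. (Q *v x + r) $ l) x = Q $ l $ k" "differentiable_along (\<lambda>x. (Q *v x + r) $ l) k x"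
  unfolding affine_component
  using pd_add[OF pd_linear_form(2)[of "\<lambda>i. Q $ l $ i" k x] pd_const(2)[of "r $ l"]]
  by (simp_all add: pd_linear_form pd_const)

lemma smooth_on_affine: "open U \<Longrightarrow> smooth_on U (\<lambda>x. (Q *v x + r) $ l)"
  unfolding affine_component
  by (intro smooth_on_add smooth_on_sum smooth_on_mult smooth_on_const smooth_on_coord)

lemma smooth_on_affine_lie: "open U \<Longrightarrow> smooth_on U f \<Longrightarrow> smooth_on U (affine_lie Q r f)"
  unfolding affine_lie_def[abs_def]
  by (intro smooth_on_sum smooth_on_mult smooth_on_affine smooth_onD(1))

text \<open>
  The commutator \<open>[\<partial>\<^sub>k, L]\<close> has constant coefficients because the vector field is affine.
\<close>

lemma pd_affine_lie:
  assumes U: "open U" "x \<in> U" and f: "smooth_on U f"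
  shows "pd k (affine_lie Q r f) x = affine_lie Q r (pd k f) x + (\<Sum>l\<in>UNIV. Q $ l $ k * pd l f x)"
proof -
  have d: "differentiable_along (pd l f) k x" for l
    by (rule smooth_onD(2)[OF smooth_onD(1)[OF f] U(2)])
  have "pd k (affine_lie Q r f) x = (\<Sum>l\<in>UNIV. pd k (\<lambda>x. (Q *v x + r) $ l * pd l f x) x)"
    unfolding affine_lie_def[abs_def] by (rule pd_sum(1)) (intro pd_mult(2) pd_affine d)
  also have "\<dots> = (\<Sum>l\<in>UNIV. Q $ l $ k * pd l f x + (Q *v x + r) $ l * pd k (pd l f) x)"
    by (simp only: pd_mult(1)[OF pd_affine(2) d] pd_affine(1))
  also have "\<dots> = affine_lie Q r (pd k f) x + (\<Sum>l\<in>UNIV. Q $ l $ k * pd l f x)"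
    unfolding affine_lie_def smooth_on_pd_commute[OF U f, of k] by (simp add: sum.distrib)
  finally show ?thesis .
qed

lemma pd_linear_combination:
  assumes "\<And>l. differentiable_along (f l) k x"
  shows "pd k (\<lambda>x. \<Sum>l\<in>UNIV. c l * f l x) x = (\<Sum>l\<in>UNIV. c l * pd k (f l) x)"
    "differentiable_along (\<lambda>x. \<Sum>l\<in>UNIV. c l * f l x) k x"
proof -
  have d: "differentiable_along (\<lambda>x. c l * f l x) k x" for l by (intro pd_mult pd_const assms)
  show "pd k (\<lambda>x. \<Sum>l\<in>UNIV. c l * f l x) x = (\<Sum>l\<in>UNIV. c l * pd k (f l) x)"
    by (subst pd_sum(1)[OF d]) (simp add: pd_mult(1)[OF pd_const(2) assms] pd_const)
  show "differentiable_along (\<lambda>x. \<Sum>l\<in>UNIV. c l * f l x) k x" by (rule pd_sum(2)[OF d])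
qed

text \<open>
  Three applications of the commutator formula: the third derivatives of \<open>L f\<close> form the Lie derivative of the
  covariant tensor of third derivatives of \<open>f\<close>.
\<close>

lemma third_affine_lie:
  assumes U: "open U" "x \<in> U" and f: "smooth_on U f"
  shows "third (affine_lie Q r f) i j k x = affine_lie Q r (third f i j k) x
    + (\<Sum>l\<in>UNIV. Q $ l $ i * third f l j k x) + (\<Sum>l\<in>UNIV. Q $ l $ j * third f i l k x)
    + (\<Sum>l\<in>UNIV. Q $ l $ k * third f i j l x)"
proof -
  have fs: "smooth_on U (pd i f)" "smooth_on U (pd i (pd j f))" for i j
    by (intro smooth_onD(1) f)+
  have s: "smooth_on U (affine_lie Q r g)" if "smooth_on U g" for g by (rule smooth_on_affine_lie[OF U(1) that])
  have d: "differentiable_along (pd l f) i y" "differentiable_along (pd l (pd m f)) i y"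
    "differentiable_along (affine_lie Q r (pd l f)) i y" "differentiable_along (affine_lie Q r (pd l (pd m f))) i y"
    if "y \<in> U" for l m i y
    by (intro smooth_onD(2)[OF _ that] fs s)+
  have 2: "pd j (pd k (affine_lie Q r f)) y = affine_lie Q r (pd j (pd k f)) y
     + (\<Sum>l\<in>UNIV. Q $ l $ j * pd l (pd k f) y) + (\<Sum>l\<in>UNIV. Q $ l $ k * pd j (pd l f) y)" if y: "y \<in> U" for y
  proof -
    have "pd j (pd k (affine_lie Q r f)) y = pd j (\<lambda>z. affine_lie Q r (pd k f) z + (\<Sum>l\<in>UNIV. Q $ l $ k * pd l f z)) y"
      by (rule pd_cong[OF U(1) y]) (rule pd_affine_lie[OF U(1) _ f])
    also have "\<dots> = pd j (affine_lie Q r (pd k f)) y + (\<Sum>l\<in>UNIV. Q $ l $ k * pd j (pd l f) y)"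
      by (subst pd_add(1)) (intro d pd_linear_combination y, simp_all add: pd_linear_combination d y)
    finally show ?thesis by (simp add: pd_affine_lie[OF U(1) y fs(1)])
  qed
  have "third (affine_lie Q r f) i j k x = pd i (\<lambda>y. affine_lie Q r (pd j (pd k f)) y
     + (\<Sum>l\<in>UNIV. Q $ l $ j * pd l (pd k f) y) + (\<Sum>l\<in>UNIV. Q $ l $ k * pd j (pd l f) y)) x"
    unfolding third_def by (rule pd_cong[OF U]) (rule 2)
  also have "\<dots> = pd i (affine_lie Q r (pd j (pd k f))) x + (\<Sum>l\<in>UNIV. Q $ l $ j * pd i (pd l (pd k f)) x)
     + (\<Sum>l\<in>UNIV. Q $ l $ k * pd i (pd j (pd l f)) x)"
    by (simp add: pd_add pd_linear_combination d U(2))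
  finally show ?thesis by (simp add: pd_affine_lie[OF U fs(2)] third_def[abs_def])
qed

section \<open>Vector fields along a map and multilinear forms\<close>

text \<open>
  For a parametrization \<open>\<phi>\<close>, the vectors \<open>vector_pd i \<phi> u\<close> form the coordinate frame, and
  \<open>vector_pd j (vector_pd i \<phi>)\<close> are the second derivatives of \<open>\<phi>\<close>.
\<close>

definition vector_pd :: "'n::finite \<Rightarrow> ('k::real_normed_field ^ 'n \<Rightarrow> 'k ^ 'm::finite) \<Rightarrow> 'k ^ 'n \<Rightarrow> 'k ^ 'm" where
  "vector_pd i X u = (\<chi> l. pd i (\<lambda>v. X v $ l) u)"

definition trilinear :: "('m::finite \<Rightarrow> 'm \<Rightarrow> 'm \<Rightarrow> 'k::real_normed_field) \<Rightarrow> 'k ^ 'm \<Rightarrow> 'k ^ 'm \<Rightarrow> 'k ^ 'm \<Rightarrow> 'k" where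
  "trilinear c a b d = (\<Sum>i\<in>UNIV. \<Sum>j\<in>UNIV. \<Sum>k\<in>UNIV. c i j k * a $ i * b $ j * d $ k)"

lemma pd_inner_eta:
  assumes X: "\<And>l. differentiable_along (\<lambda>v. X v $ l) i u" and Y: "\<And>l. differentiable_along (\<lambda>v. Y v $ l) i u"
  shows "pd i (\<lambda>v. inner_eta \<eta> (X v) (Y v)) u = inner_eta \<eta> (vector_pd i X u) (Y u) + inner_eta \<eta> (X u) (vector_pd i Y u)"
proof -
  have d1: "differentiable_along (\<lambda>v. \<eta> $ k $ l * X v $ k) i u" for k l
    by (intro pd_mult(2) pd_const X)
  have d2: "differentiable_along (\<lambda>v. \<eta> $ k $ l * X v $ k * Y v $ l) i u" for k l
    by (intro pd_mult(2) d1 Y)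
  have "pd i (\<lambda>v. \<eta> $ k $ l * X v $ k * Y v $ l) u =
     \<eta> $ k $ l * vector_pd i X u $ k * Y u $ l + \<eta> $ k $ l * X u $ k * vector_pd i Y u $ l" for k l
    by (simp add: pd_mult(1)[OF d1 Y] pd_mult(1)[OF pd_const(2) X] pd_const vector_pd_def)
  then show ?thesis
    unfolding inner_eta_def by (simp add: pd_sum pd_sum(2)[OF d2] d2 sum.distrib)
qed

lemma pd_trilinear:
  assumes c: "\<And>j k l. differentiable_along (\<lambda>v. c v j k l) i u"
    and X: "\<And>l. differentiable_along (\<lambda>v. X v $ l) i u" and Y: "\<And>l. differentiable_along (\<lambda>v. Y v $ l) i u"
    and Z: "\<And>l. differentiable_along (\<lambda>v. Z v $ l) i u"
  shows "pd i (\<lambda>v. trilinear (c v) (X v) (Y v) (Z v)) u =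
     trilinear (\<lambda>j k l. pd i (\<lambda>v. c v j k l) u) (X u) (Y u) (Z u)
     + trilinear (c u) (vector_pd i X u) (Y u) (Z u) + trilinear (c u) (X u) (vector_pd i Y u) (Z u) + trilinear (c u) (X u) (Y u) (vector_pd i Z u)"
proof -
  have d1: "differentiable_along (\<lambda>v. c v j k l * X v $ j) i u" for j k l by (intro pd_mult(2) c X)
  have d2: "differentiable_along (\<lambda>v. c v j k l * X v $ j * Y v $ k) i u" for j k l by (intro pd_mult(2) d1 Y)
  have d3: "differentiable_along (\<lambda>v. c v j k l * X v $ j * Y v $ k * Z v $ l) i u" for j k l by (intro pd_mult(2) d2 Z)
  have d4: "differentiable_along (\<lambda>v. \<Sum>l\<in>UNIV. c v j k l * X v $ j * Y v $ k * Z v $ l) i u" for j k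
    by (rule pd_sum(2)[OF d3])
  have d5: "differentiable_along (\<lambda>v. \<Sum>k\<in>UNIV. \<Sum>l\<in>UNIV. c v j k l * X v $ j * Y v $ k * Z v $ l) i u" for j
    by (rule pd_sum(2)[OF d4])
  have "pd i (\<lambda>v. c v j k l * X v $ j * Y v $ k * Z v $ l) u =
     pd i (\<lambda>v. c v j k l) u * X u $ j * Y u $ k * Z u $ l + c u j k l * vector_pd i X u $ j * Y u $ k * Z u $ l
     + c u j k l * X u $ j * vector_pd i Y u $ k * Z u $ l + c u j k l * X u $ j * Y u $ k * vector_pd i Z u $ l" for j k l
    by (simp only: pd_mult(1)[OF d2 Z] pd_mult(1)[OF d1 Y] pd_mult(1)[OF c X] vector_pd_def vec_lambda_beta)
      (simp add: algebra_simps)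
  then show ?thesis
    unfolding trilinear_def pd_sum(1)[OF d5] pd_sum(1)[OF d4] pd_sum(1)[OF d3] by (simp add: sum.distrib)
qed

lemma trilinear_add1: "trilinear c (a + a') b d = trilinear c a b d + trilinear c a' b d"
  and trilinear_diff1: "trilinear c (a - a') b d = trilinear c a b d - trilinear c a' b d"
  and trilinear_smult1: "trilinear c (s *s a) b d = s * trilinear c a b d"
  and trilinear_smult2: "trilinear c a (s *s b) d = s * trilinear c a b d"
  and trilinear_smult3: "trilinear c a b (s *s d) = s * trilinear c a b d"
  and trilinear_add2: "trilinear c a (b + b') d = trilinear c a b d + trilinear c a b' d"
  and trilinear_add3: "trilinear c a b (d + d') = trilinear c a b d + trilinear c a b d'"
  and trilinear_zero: "trilinear c 0 b d = 0" "trilinear c a 0 d = 0" "trilinear c a b 0 = 0"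
  by (simp_all add: trilinear_def sum.distrib sum_subtractf sum_distrib_left algebra_simps)

lemma trilinear_sum1: "trilinear c (\<Sum>x\<in>A. f x) b d = (\<Sum>x\<in>A. trilinear c (f x) b d)"
  and trilinear_sum2: "trilinear c b (\<Sum>x\<in>A. f x) d = (\<Sum>x\<in>A. trilinear c b (f x) d)"
  and trilinear_sum3: "trilinear c b d (\<Sum>x\<in>A. f x) = (\<Sum>x\<in>A. trilinear c b d (f x))"
  by (induction A rule: infinite_finite_induct)
    (simp_all add: trilinear_add1 trilinear_add2 trilinear_add3 trilinear_zero)

lemma trilinear_pullback:
  "trilinear c (\<Sum>\<alpha>\<in>UNIV. a $ \<alpha> *s e \<alpha>) (\<Sum>\<alpha>\<in>UNIV. b $ \<alpha> *s e \<alpha>) (\<Sum>\<alpha>\<in>UNIV. d $ \<alpha> *s e \<alpha>)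
   = trilinear (\<lambda>\<alpha> \<beta> \<gamma>. trilinear c (e \<alpha>) (e \<beta>) (e \<gamma>)) a b d"
  unfolding trilinear_sum1 trilinear_smult1
  unfolding trilinear_sum2 trilinear_smult2
  unfolding trilinear_sum3 trilinear_smult3
  by (simp add: trilinear_def[of "\<lambda>\<alpha> \<beta> \<gamma>. trilinear c (e \<alpha>) (e \<beta>) (e \<gamma>)"] sum_distrib_left mult.commute mult.left_commute)

lemma trilinear_swap12:
  assumes "\<And>i j k. c i j k = c j i k"
  shows "trilinear c a b d = trilinear c b a d"
  unfolding trilinear_def by (subst sum.swap) (simp add: assms mult.commute mult.left_commute)

lemma trilinear_swap23:
  assumes "\<And>i j k. c i j k = c i k j"
  shows "trilinear c a b d = trilinear c a d b"
  unfolding trilinear_def by (rule sum.cong[OF refl], subst sum.swap) (simp add: assms mult.commute mult.left_commute)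

lemma trilinear_sum_coeff: "trilinear (\<lambda>i j k. \<Sum>l\<in>A. f l i j k) a b d = (\<Sum>l\<in>A. trilinear (f l) a b d)"
  by (induction A rule: infinite_finite_induct)
    (simp_all add: trilinear_def sum.distrib algebra_simps)

lemma trilinear_cmult_coeff: "trilinear (\<lambda>i j k. s * f i j k) a b d = s * trilinear f a b d"
  by (simp add: trilinear_def sum_distrib_left mult.assoc)

lemma trilinear_add_coeff: "trilinear (\<lambda>i j k. f i j k + h i j k) a b d = trilinear f a b d + trilinear h a b d"
  by (simp add: trilinear_def sum.distrib algebra_simps)

lemma trilinear_eq_sum1: "trilinear c a b d = (\<Sum>i\<in>UNIV. a $ i * (\<Sum>j\<in>UNIV. \<Sum>k\<in>UNIV. c i j k * b $ j * d $ k))"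
  by (simp add: trilinear_def sum_distrib_left mult.commute mult.left_commute)

lemma trilinear_perm12: "trilinear c a b d = trilinear (\<lambda>i j k. c j i k) b a d"
  unfolding trilinear_def by (subst sum.swap) (simp add: mult.commute mult.left_commute)

lemma trilinear_perm23: "trilinear c a b d = trilinear (\<lambda>i j k. c i k j) a d b"
  unfolding trilinear_def by (rule sum.cong[OF refl], subst sum.swap) (simp add: mult.commute mult.left_commute)

text \<open>
  A linear map acting on an argument can be moved to the coefficients; this matches the terms of
  \<open>third_affine_lie\<close> with the linear part of the Euler field acting on tangent vectors.
\<close>

lemma trilinear_matrix1: "trilinear c (Q *v a) b d = trilinear (\<lambda>i j k. \<Sum>l\<in>UNIV. Q $ l $ i * c l j k) a b d"
proof -
  let ?R = "\<lambda>l. \<Sum>j\<in>UNIV. \<Sum>k\<in>UNIV. c l j k * b $ j * d $ k"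
  have "(\<Sum>j\<in>UNIV. \<Sum>k\<in>UNIV. (\<Sum>l\<in>UNIV. Q $ l $ i * c l j k) * b $ j * d $ k) = (\<Sum>l\<in>UNIV. Q $ l $ i * ?R l)" for i
  proof -
    have "(\<Sum>j\<in>UNIV. \<Sum>k\<in>UNIV. (\<Sum>l\<in>UNIV. Q $ l $ i * c l j k) * b $ j * d $ k) =
       (\<Sum>j\<in>UNIV. \<Sum>k\<in>UNIV. \<Sum>l\<in>UNIV. Q $ l $ i * (c l j k * b $ j * d $ k))"
      by (simp add: sum_distrib_right mult.assoc)
    also have "\<dots> = (\<Sum>j\<in>UNIV. \<Sum>l\<in>UNIV. \<Sum>k\<in>UNIV. Q $ l $ i * (c l j k * b $ j * d $ k))"
      by (rule sum.cong[OF refl]) (rule sum.swap)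
    also have "\<dots> = (\<Sum>l\<in>UNIV. \<Sum>j\<in>UNIV. \<Sum>k\<in>UNIV. Q $ l $ i * (c l j k * b $ j * d $ k))"
      by (rule sum.swap)
    finally show ?thesis by (simp add: sum_distrib_left)
  qed
  then have "trilinear (\<lambda>i j k. \<Sum>l\<in>UNIV. Q $ l $ i * c l j k) a b d = (\<Sum>i\<in>UNIV. \<Sum>l\<in>UNIV. a $ i * (Q $ l $ i * ?R l))"
    unfolding trilinear_eq_sum1 by (simp add: sum_distrib_left)
  also have "\<dots> = (\<Sum>l\<in>UNIV. \<Sum>i\<in>UNIV. a $ i * (Q $ l $ i * ?R l))" by (rule sum.swap)
  also have "\<dots> = trilinear c (Q *v a) b d"
    unfolding trilinear_eq_sum1 by (simp add: matrix_vector_mult_def sum_distrib_right mult.assoc mult.left_commute)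
  finally show ?thesis by simp
qed

lemma trilinear_matrix2: "trilinear c a (Q *v b) d = trilinear (\<lambda>i j k. \<Sum>l\<in>UNIV. Q $ l $ j * c i l k) a b d"
  by (subst (1 2) trilinear_perm12) (rule trilinear_matrix1)

lemma trilinear_matrix3: "trilinear c a b (Q *v d) = trilinear (\<lambda>i j k. \<Sum>l\<in>UNIV. Q $ l $ k * c i j l) a b d"
  by (subst (1 2) trilinear_perm23) (rule trilinear_matrix2)

section \<open>Tangent spaces and orthogonal projections\<close>

lemma pushforward_eq: "pushforward \<phi> u w = (\<Sum>\<alpha>\<in>UNIV. w $ \<alpha> *s vector_pd \<alpha> \<phi> u)"
  by (simp add: vec_eq_iff pushforward_def vector_pd_def)

lemma pushforward_diff: "pushforward \<phi> u (a - b) = pushforward \<phi> u a - pushforward \<phi> u b"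
  and pushforward_zero: "pushforward \<phi> u 0 = 0"
  by (simp_all add: vec_eq_iff pushforward_def sum.distrib sum_subtractf sum_distrib_left algebra_simps)

lemma pushforward_axis: "pushforward \<phi> u (axis \<alpha> 1) = vector_pd \<alpha> \<phi> u"
  by (simp add: vec_eq_iff pushforward_def vector_pd_def axis_def mult_if_delta)

lemma linear_pushforward: "linear (pushforward \<phi> u)"
  by (rule linearI) (simp_all add: vec_eq_iff pushforward_def sum.distrib scaleR_sum_right algebra_simps)

lemma range_pushforward_diff:
  "a \<in> range (pushforward \<phi> u) \<Longrightarrow> b \<in> range (pushforward \<phi> u) \<Longrightarrow> a - b \<in> range (pushforward \<phi> u)"
  by (auto simp: pushforward_diff[symmetric])

lemma inner_eta_add_left: "inner_eta \<eta> (a + b) c = inner_eta \<eta> a c + inner_eta \<eta> b c"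
  and inner_eta_add_right: "inner_eta \<eta> c (a + b) = inner_eta \<eta> c a + inner_eta \<eta> c b"
  and inner_eta_diff_left: "inner_eta \<eta> (a - b) c = inner_eta \<eta> a c - inner_eta \<eta> b c"
  and inner_eta_smult_left: "inner_eta \<eta> (s *s a) c = s * inner_eta \<eta> a c"
  and inner_eta_smult_right: "inner_eta \<eta> c (s *s a) = s * inner_eta \<eta> c a"
  and inner_eta_zero_left: "inner_eta \<eta> 0 c = 0"
  and inner_eta_zero_right: "inner_eta \<eta> c 0 = 0"
  by (simp_all add: inner_eta_def sum.distrib sum_subtractf sum_distrib_left algebra_simps)

lemma inner_eta_sum_left: "inner_eta \<eta> (\<Sum>x\<in>A. f x) c = (\<Sum>x\<in>A. inner_eta \<eta> (f x) c)"
  and inner_eta_sum_right: "inner_eta \<eta> c (\<Sum>x\<in>A. f x) = (\<Sum>x\<in>A. inner_eta \<eta> c (f x))"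
  by (induction A rule: infinite_finite_induct)
    (simp_all add: inner_eta_add_left inner_eta_add_right inner_eta_zero_left inner_eta_zero_right)

lemma inner_eta_commute:
  assumes "\<And>i j. \<eta> $ i $ j = \<eta> $ j $ i"
  shows "inner_eta \<eta> a b = inner_eta \<eta> b a"
  unfolding inner_eta_def
  by (subst sum.swap) (simp add: assms[of _ _] mult.commute mult.left_commute)

lemma inner_eta_axis: "inner_eta \<eta> (axis i 1) (axis j 1) = \<eta> $ i $ j"
  by (simp add: inner_eta_def axis_def mult_delta_left mult_delta_right)

lemma inner_eta_axis_right: "inner_eta \<eta> a (axis j 1) = (transpose \<eta> *v a) $ j"
  by (simp add: inner_eta_def axis_def vector_matrix_mult_def mult_delta_right) (simp add: mult.commute)

lemma invertible_transpose: "invertible (A :: 'a::field ^ 'n ^ 'n) \<Longrightarrow> invertible (transpose A)"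
  unfolding invertible_def by (metis matrix_transpose_mul transpose_mat)

lemma inner_eta_nondegenerate:
  assumes "invertible \<eta>" "\<And>b. inner_eta \<eta> a b = 0"
  shows "a = 0"
proof -
  have "transpose \<eta> *v a = 0"
    unfolding vec_eq_iff inner_eta_axis_right[symmetric] by (simp add: assms(2))
  moreover have "invertible (transpose \<eta>)" using assms(1) by (rule invertible_transpose)
  ultimately show ?thesis
    using matrix_left_invertible_ker invertible_left_inverse by metis
qed

lemma invertible_of_nondegenerate:
  fixes g :: "'k::real_normed_field ^ 'n::finite ^ 'n"
  assumes "\<And>a. (\<And>b. inner_eta g a b = 0) \<Longrightarrow> a = 0"
  shows "invertible g"
proof -
  have "a = 0" if a: "transpose g *v a = 0" for a
  proof (rule assms)
    fix b
    have "inner_eta g a (\<Sum>i\<in>UNIV. b $ i *s axis i 1) = 0"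
      unfolding inner_eta_sum_right inner_eta_smult_right inner_eta_axis_right a by simp
    then show "inner_eta g a b = 0" by (simp add: basis_expansion)
  qed
  then have "invertible (transpose g)"
    using matrix_left_invertible_ker invertible_left_inverse by metis
  then show ?thesis using invertible_transpose transpose_transpose by metis
qed

lemma orth_proj_eqI:
  assumes diff: "\<And>a b. a \<in> T \<Longrightarrow> b \<in> T \<Longrightarrow> a - b \<in> T"
    and nondeg: "\<And>v. v \<in> T \<Longrightarrow> (\<And>w. w \<in> T \<Longrightarrow> inner_eta \<eta> v w = 0) \<Longrightarrow> v = 0"
    and w: "w \<in> T" "\<And>z. z \<in> T \<Longrightarrow> inner_eta \<eta> (v - w) z = 0"
  shows "orth_proj \<eta> T v = w"
  unfolding orth_proj_def
proof (rule the_equality)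
  fix w' assume w': "w' \<in> T \<and> (\<forall>z\<in>T. inner_eta \<eta> (v - w') z = 0)"
  have "w' - w = 0"
  proof (rule nondeg)
    show "w' - w \<in> T" using w(1) w' diff by blast
    fix z assume z: "z \<in> T"
    have "w' - w = (v - w) - (v - w')" by simp
    then have "inner_eta \<eta> (w' - w) z = inner_eta \<eta> (v - w) z - inner_eta \<eta> (v - w') z"
      by (simp only: inner_eta_diff_left)
    then show "inner_eta \<eta> (w' - w) z = 0" using w(2)[OF z] w' z by simp
  qed
  then show "w' = w" by simp
qed (use w in blast)

text \<open>
  The projection exists because the Gram matrix of the frame is invertible, and nondegeneracy of the
  metric on the range forces the projection to be unique.  Without existence the definite description
  in the definition would be an arbitrary vector.
\<close>

lemma orth_proj_in_range:
  fixes \<phi> :: "'k::real_normed_field ^ 'n::finite \<Rightarrow> 'k ^ 'm::finite"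
  assumes inj: "inj (pushforward \<phi> u)"
    and nondeg: "\<And>v. v \<in> range (pushforward \<phi> u) \<Longrightarrow>
      (\<And>w. w \<in> range (pushforward \<phi> u) \<Longrightarrow> inner_eta \<eta> v w = 0) \<Longrightarrow> v = 0"
  shows "orth_proj \<eta> (range (pushforward \<phi> u)) v \<in> range (pushforward \<phi> u)"
proof -
  let ?P = "pushforward \<phi> u"
  let ?g = "\<chi> \<alpha> \<beta>. inner_eta \<eta> (vector_pd \<alpha> \<phi> u) (vector_pd \<beta> \<phi> u)"
  have g: "inner_eta \<eta> (?P a) (?P b) = inner_eta ?g a b" for a b
    unfolding pushforward_eq inner_eta_def[of ?g] inner_eta_sum_left
    by (simp add: inner_eta_sum_right inner_eta_smult_left inner_eta_smult_right
        sum_distrib_left mult.commute mult.left_commute)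
  have "invertible ?g"
  proof (rule invertible_of_nondegenerate)
    fix a assume "\<And>b. inner_eta ?g a b = 0"
    then have "?P a = 0" by (intro nondeg) (auto simp: g)
    then show "a = 0" using injD[OF inj, of a 0] by (simp add: pushforward_zero)
  qed
  then have "invertible (transpose ?g)" by (rule invertible_transpose)
  then obtain B where B: "transpose ?g ** B = mat 1" unfolding invertible_def by blast
  define a where "a = B *v (\<chi> \<beta>. inner_eta \<eta> v (vector_pd \<beta> \<phi> u))"
  have a: "transpose ?g *v a = (\<chi> \<beta>. inner_eta \<eta> v (vector_pd \<beta> \<phi> u))"
    unfolding a_def matrix_vector_mul_assoc B by simp
  have "inner_eta \<eta> (v - ?P a) (vector_pd \<beta> \<phi> u) = 0" for \<beta>
  proof -
    have "inner_eta \<eta> (?P a) (vector_pd \<beta> \<phi> u) = inner_eta \<eta> (?P a) (?P (axis \<beta> 1))"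
      by (simp only: pushforward_axis)
    also have "\<dots> = (transpose ?g *v a) $ \<beta>" by (simp only: g inner_eta_axis_right)
    also have "\<dots> = inner_eta \<eta> v (vector_pd \<beta> \<phi> u)" by (simp only: a vec_lambda_beta)
    finally show ?thesis by (simp add: inner_eta_diff_left)
  qed
  then have "inner_eta \<eta> (v - ?P a) (?P b) = 0" for b
    unfolding pushforward_eq[of _ _ b] by (simp add: inner_eta_sum_right inner_eta_smult_right)
  then have "orth_proj \<eta> (range ?P) v = ?P a"
    by (intro orth_proj_eqI nondeg range_pushforward_diff) auto
  then show ?thesis by simp
qed

lemma pushforward_has_derivative:
  fixes \<phi> :: "'k::real_normed_field ^ 'n::finite \<Rightarrow> 'k ^ 'm::finite"
  assumes "open U" "u \<in> U" "\<And>i. smooth_on U (\<lambda>v. \<phi> v $ i)"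
  shows "(\<phi> has_derivative pushforward \<phi> u) (at u)"
  by (rule has_derivative_vec)
    (use C1_has_derivative[OF assms(1,2) smooth_onD(3)[OF assms(3)]] in \<open>simp add: pushforward_def\<close>)

text \<open>
  A curve \<open>s \<mapsto> \<phi>\<^sub>1(u\<^sub>1 + s w)\<close> in \<open>N\<close> can be written as \<open>\<phi>\<^sub>2(y(s))\<close> with a continuous \<open>y\<close>.  Since the
  differential \<open>D\<^sub>2\<close> of \<open>\<phi>\<^sub>2\<close> is injective, and hence bounded below, \<open>y(s) - u\<^sub>2\<close> is of order \<open>s\<close>, and the difference
  quotients of the curve are approximated by \<open>D\<^sub>2((y(s) - u\<^sub>2) / s)\<close>.  So the velocity of the curve lies in the closure
  of the range of \<open>D\<^sub>2\<close>, which is a closed subspace.  Only the continuity of \<open>\<phi>\<^sub>2\<^sup>-\<^sup>1\<close> enters, which is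
  what being a homeomorphism onto the image provides.
\<close>

lemma range_pushforward_le:
  fixes \<phi>1 \<phi>2 :: "'k::{real_normed_field,euclidean_space} ^ 'n::finite \<Rightarrow> 'k ^ 'm::finite"
  assumes 1: "local_param N U1 \<phi>1" "u1 \<in> U1" and 2: "local_param N U2 \<phi>2" "u2 \<in> U2"
    and p: "\<phi>1 u1 = \<phi>2 u2"
  shows "range (pushforward \<phi>1 u1) \<subseteq> range (pushforward \<phi>2 u2)"
proof
  fix v assume "v \<in> range (pushforward \<phi>1 u1)"
  then obtain w where v: "v = pushforward \<phi>1 u1 w" by blast
  let ?D1 = "pushforward \<phi>1 u1" and ?D2 = "pushforward \<phi>2 u2"
  have D1: "(\<phi>1 has_derivative ?D1) (at u1)"
    by (rule pushforward_has_derivative) (use 1 in \<open>auto simp: local_param_def\<close>)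
  have D2: "(\<phi>2 has_derivative ?D2) (at u2)"
    by (rule pushforward_has_derivative) (use 2 in \<open>auto simp: local_param_def\<close>)
  have "inj ?D2" using 2 by (auto simp: local_param_def)
  then obtain B where B: "B > 0" "\<And>x. B * norm x \<le> norm (?D2 x)"
    using linear_inj_bounded_below_pos[OF linear_pushforward] by blast
  obtain \<psi> where \<psi>: "homeomorphism U2 (\<phi>2 ` U2) \<phi>2 \<psi>" using 2 by (auto simp: local_param_def)
  define x where "x s = u1 + s *\<^sub>R w" for s :: real
  define q where "q s = (\<phi>1 (x s) - \<phi>1 u1) /\<^sub>R s" for s
  define y where "y s = \<psi> (\<phi>1 (x s))" for s
  have x0: "x 0 = u1" by (simp add: x_def)
  have Dx: "((\<lambda>s. \<phi>1 (x s)) has_derivative (\<lambda>s. ?D1 (s *\<^sub>R w))) (at 0)"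
  proof (rule has_derivative_compose[of x])
    show "(x has_derivative (\<lambda>s. s *\<^sub>R w)) (at 0)" unfolding x_def by (auto intro!: derivative_eq_intros)
    show "(\<phi>1 has_derivative ?D1) (at (x 0))" using D1 x0 by simp
  qed
  then have "((\<lambda>s. norm (\<phi>1 (x s) - \<phi>1 u1 - ?D1 (s *\<^sub>R w)) / norm s) \<longlongrightarrow> 0) (at 0)"
    unfolding has_derivative_at by (simp add: x0)
  moreover have "norm (\<phi>1 (x s) - \<phi>1 u1 - ?D1 (s *\<^sub>R w)) / norm s = norm (q s - v)" if "s \<noteq> 0" for s
  proof -
    have "\<phi>1 (x s) - \<phi>1 u1 - ?D1 (s *\<^sub>R w) = s *\<^sub>R (q s - v)"
      using that by (simp add: q_def v linear_cmul[OF linear_pushforward] scaleR_diff_right)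
    then show ?thesis using that by simp
  qed
  ultimately have "((\<lambda>s. norm (q s - v)) \<longlongrightarrow> 0) (at 0)"
    by (auto simp: eventually_at_filter elim: Lim_transform_eventually)
  then have q: "(q \<longlongrightarrow> v) (at 0)"
    by (rule LIM_zero_cancel[OF tendsto_norm_zero_cancel])
  have c: "((\<lambda>s. \<phi>1 (x s)) \<longlongrightarrow> \<phi>1 u1) (at 0)"
    using has_derivative_continuous[OF Dx] by (simp add: isCont_def x0)
  have "(x \<longlongrightarrow> u1) (at 0)"
    unfolding x_def by (auto intro!: tendsto_eq_intros)
  then have evU: "\<forall>\<^sub>F s in at 0. x s \<in> U1"
    using 1 by (auto simp: local_param_def intro: topological_tendstoD)
  obtain T where T: "open T" "\<phi>2 ` U2 = N \<inter> T"
    using 2 by (auto simp: local_param_def openin_open)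
  have "\<phi>1 u1 \<in> T" using T(2) p 2 by auto
  then have evT: "\<forall>\<^sub>F s in at 0. \<phi>1 (x s) \<in> T" using c T(1) by (auto intro: topological_tendstoD)
  have "openin (top_of_set N) (\<phi>1 ` U1)" using 1 by (simp add: local_param_def)
  then have sub: "\<phi>1 ` U1 \<subseteq> N" by (rule openin_imp_subset)
  have ev: "\<forall>\<^sub>F s in at 0. \<phi>1 (x s) \<in> \<phi>2 ` U2"
    using evU evT by eventually_elim (use T(2) sub in auto)
  have "(y \<longlongrightarrow> \<psi> (\<phi>1 u1)) (at 0)"
    unfolding y_def
    by (rule continuous_on_tendsto_compose[of "\<phi>2 ` U2" \<psi>])
      (use \<psi> c ev 2 p in \<open>auto simp: homeomorphism_def\<close>)
  then have y: "(y \<longlongrightarrow> u2) (at 0)" using \<psi> p 2 by (auto simp: homeomorphism_def)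
  have y2: "\<forall>\<^sub>F s in at 0. \<phi>2 (y s) = \<phi>1 (x s)"
    using ev by eventually_elim (use \<psi> in \<open>auto simp: y_def homeomorphism_def\<close>)
  have "v \<in> closure (range ?D2)"
    unfolding closure_approachable
  proof (intro allI impI)
    fix e :: real assume e: "e > 0"
    define M where "M = 2 / B * (norm v + 1)"
    define e' where "e' = min (B / 2) (e / 2 / M)"
    have M: "M > 0" unfolding M_def using B(1) by (simp add: add_nonneg_pos)
    have e': "e' > 0" "e' \<le> B / 2" "e' * M \<le> e / 2"
      using e M B(1) by (auto simp: e'_def min_def field_simps)
    obtain d where d: "d > 0" "\<And>z. norm (z - u2) < d \<Longrightarrow> norm (\<phi>2 z - \<phi>2 u2 - ?D2 (z - u2)) \<le> e' * norm (z - u2)"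
      using D2 e'(1) unfolding has_derivative_at_alt by blast
    have "\<forall>\<^sub>F s in at 0. dist (y s) u2 < d" using y d(1) by (rule tendstoD)
    moreover have "\<forall>\<^sub>F s in at 0. dist (q s) v < min 1 (e / 2)" using q e by (intro tendstoD) auto
    moreover have "\<forall>\<^sub>F s in at 0. s \<noteq> (0::real)" by (simp add: eventually_at_filter)
    ultimately have "\<forall>\<^sub>F s in at 0. dist (?D2 ((y s - u2) /\<^sub>R s)) v < e"
      using y2
    proof eventually_elim
      case (elim s)
      let ?h = "(y s - u2) /\<^sub>R s"
      have "norm (\<phi>2 (y s) - \<phi>2 u2 - ?D2 (y s - u2)) \<le> e' * norm (y s - u2)"
        by (rule d(2)) (use elim(1) in \<open>simp add: dist_norm\<close>)
      then have "norm ((\<phi>2 (y s) - \<phi>2 u2 - ?D2 (y s - u2)) /\<^sub>R s) \<le> e' * norm ?h"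
        using elim(3) by (simp add: divide_simps mult.commute)
      moreover have "(\<phi>2 (y s) - \<phi>2 u2 - ?D2 (y s - u2)) /\<^sub>R s = q s - ?D2 ?h"
        unfolding linear_cmul[OF linear_pushforward] using elim(4) p
        by (simp add: q_def scaleR_diff_right)
      ultimately have le: "norm (q s - ?D2 ?h) \<le> e' * norm ?h" by simp
      \<comment> \<open>The lower bound of \<open>?D2\<close> outweighs the error of the linear approximation, so the quotient \<open>?h\<close> stays bounded.\<close>
      have "B * norm ?h \<le> norm (?D2 ?h)" by (rule B(2))
      also have "\<dots> \<le> norm (q s) + norm (q s - ?D2 ?h)"
        using norm_triangle_ineq4[of "q s" "q s - ?D2 ?h"] by simp
      also have "\<dots> \<le> norm (q s) + B / 2 * norm ?h"
        using le mult_right_mono[OF e'(2), of "norm ?h"] by simp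
      finally have "norm ?h \<le> 2 / B * norm (q s)" using B(1) by (simp add: field_simps)
      moreover have "norm (q s) \<le> norm v + 1"
        using elim(2) norm_triangle_ineq[of "q s - v" v] by (simp add: dist_norm)
      ultimately have "norm ?h \<le> M"
        unfolding M_def using B(1) by (meson divide_nonneg_nonneg less_imp_le mult_left_mono order_trans zero_le_numeral)
      then have "norm (q s - ?D2 ?h) \<le> e / 2"
        using le e'(3) mult_left_mono[of "norm ?h" M e'] e'(1) by linarith
      moreover have "norm (q s - v) < e / 2" using elim(2) by (simp add: dist_norm)
      ultimately show ?case
        using norm_triangle_ineq4[of "q s - v" "q s - ?D2 ?h"] by (simp add: dist_norm)
    qed
    then obtain s where "dist (?D2 ((y s - u2) /\<^sub>R s)) v < e"
      using eventually_happens[of _ "at (0::real)"] by (auto simp: trivial_limit_at)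
    then show "\<exists>z\<in>range ?D2. dist z v < e" by blast
  qed
  moreover have "closed (range ?D2)"
    by (intro closed_subspace linear_subspace_image linear_pushforward subspace_UNIV)
  ultimately show "v \<in> range ?D2" by simp
qed

lemma tangent_space_eq_range:
  fixes \<phi> :: "'k::{real_normed_field,euclidean_space} ^ 'n::finite \<Rightarrow> 'k ^ 'm::finite"
  assumes "local_param N U \<phi>" "u \<in> U"
  shows "tangent_space TYPE('n) N (\<phi> u) = range (pushforward \<phi> u)"
proof
  show "tangent_space TYPE('n) N (\<phi> u) \<subseteq> range (pushforward \<phi> u)"
  proof
    fix v assume "v \<in> tangent_space TYPE('n) N (\<phi> u)"
    then obtain U' u' w and \<phi>' :: "'k ^ 'n \<Rightarrow> 'k ^ 'm" where
      "local_param N U' \<phi>'" "u' \<in> U'" "\<phi>' u' = \<phi> u" "v = pushforward \<phi>' u' w"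
      unfolding tangent_space_def by blast
    then show "v \<in> range (pushforward \<phi> u)"
      using range_pushforward_le[of N U' \<phi>' u' U \<phi> u] assms by blast
  qed
  show "range (pushforward \<phi> u) \<subseteq> tangent_space TYPE('n) N (\<phi> u)"
    unfolding tangent_space_def using assms by blast
qed

lemma pushforward_compose_linear:
  fixes \<phi> :: "'k::real_normed_field ^ 'n::finite \<Rightarrow> 'k ^ 'm::finite" and A :: "'k ^ 'n ^ 'n"
  assumes U: "open U" "A *v v \<in> U" and \<phi>: "\<And>i. smooth_on U (\<lambda>v. \<phi> v $ i)"
  shows "pushforward (\<lambda>v. \<phi> (A *v v)) v w = pushforward \<phi> (A *v v) (A *v w)"
proof -
  have d: "pd \<alpha> (\<lambda>v. (A *v v) $ l) v = A $ l $ \<alpha>" "differentiable_along (\<lambda>v. (A *v v) $ l) \<alpha> v" for \<alpha> l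
    unfolding matrix_vector_mult_def by (simp_all add: pd_linear_form)
  have "pd \<alpha> (\<lambda>v. \<phi> (A *v v) $ i) v = (\<Sum>l\<in>UNIV. A $ l $ \<alpha> * pd l (\<lambda>v. \<phi> v $ i) (A *v v))" for \<alpha> i
    using pd_compose(1)[OF U(1) _ smooth_onD(3)[OF \<phi>[of i]], of "\<lambda>v. A *v v" v \<alpha>, OF U(2) d(2)] by (simp add: d(1))
  then have "pushforward (\<lambda>v. \<phi> (A *v v)) v w $ i = pushforward \<phi> (A *v v) (A *v w) $ i" for i
    unfolding pushforward_def
    by (simp add: matrix_vector_mult_def sum_distrib_left sum_distrib_right mult.assoc mult.left_commute)
      (subst sum.swap, simp add: mult.assoc mult.left_commute)
  then show ?thesis by (simp add: vec_eq_iff)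
qed

lemma local_param_compose_linear:
  fixes \<phi> :: "'k::real_normed_field ^ 'n::finite \<Rightarrow> 'k ^ 'm::finite" and A :: "'k ^ 'n ^ 'n"
  assumes \<phi>: "local_param N U \<phi>" and A: "invertible A" and V: "open V" "\<And>v. v \<in> V \<Longrightarrow> A *v v \<in> U"
  shows "local_param N V (\<lambda>v. \<phi> (A *v v))"
proof -
  have U: "open U" and s: "\<And>i. smooth_on U (\<lambda>u. \<phi> u $ i)" and inj: "\<And>u. u \<in> U \<Longrightarrow> inj (pushforward \<phi> u)"
    and op: "openin (top_of_set N) (\<phi> ` U)" using \<phi> by (auto simp: local_param_def)
  obtain \<psi> where \<psi>: "homeomorphism U (\<phi> ` U) \<phi> \<psi>" using \<phi> by (auto simp: local_param_def)
  obtain B where B: "A ** B = mat 1" "B ** A = mat 1" using A by (auto simp: invertible_def)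
  have AB: "A *v (B *v x) = x" "B *v (A *v x) = x" for x
    by (simp_all add: matrix_vector_mul_assoc B)
  have cont: "continuous_on S ((*v) (C :: 'k ^ 'n ^ 'n))" for S C
    by (rule continuous_on_vec_components) (auto simp: matrix_vector_mult_def intro!: continuous_intros)
  let ?W = "(*v) A ` V"
  have W: "?W = (*v) B -` V" using AB by (auto simp: image_iff) metis
  have "open ?W" unfolding W by (rule open_vimage[OF V(1) cont])
  have homW: "homeomorphism V ?W ((*v) A) ((*v) B)"
    by (rule homeomorphismI) (use cont AB in auto)
  have WU: "?W \<subseteq> U" using V(2) by auto
  have "homeomorphism ?W (\<phi> ` ?W) \<phi> \<psi>"
    by (rule homeomorphism_of_subsets[OF \<psi> WU]) (use WU in auto)
  from homeomorphism_compose[OF homW this]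
  have "homeomorphism V ((\<lambda>v. \<phi> (A *v v)) ` V) (\<lambda>v. \<phi> (A *v v)) ((*v) B \<circ> \<psi>)"
    by (simp add: o_def image_image)
  moreover have "openin (top_of_set (\<phi> ` U)) (\<phi> ` ?W)"
    by (rule homeomorphism_imp_open_map[OF \<psi>]) (use \<open>open ?W\<close> WU in \<open>auto intro: open_subset\<close>)
  then have "openin (top_of_set N) ((\<lambda>v. \<phi> (A *v v)) ` V)"
    using op openin_trans by (fastforce simp: image_image)
  moreover have "smooth_on V (\<lambda>v. \<phi> (A *v v) $ i)" for i
    using smooth_on_compose[OF U V(1) V(2) s[of i]] smooth_on_affine[OF V(1), of A 0] by simp
  moreover have "inj (pushforward (\<lambda>v. \<phi> (A *v v)) v)" if v: "v \<in> V" for v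
  proof (rule injI)
    fix a b assume "pushforward (\<lambda>v. \<phi> (A *v v)) v a = pushforward (\<lambda>v. \<phi> (A *v v)) v b"
    then have "A *v a = A *v b"
      using inj[OF V(2)[OF v]] by (simp add: pushforward_compose_linear[OF U V(2)[OF v] s] inj_eq)
    then show "a = b" using AB(2) by metis
  qed
  ultimately show ?thesis using V(1) unfolding local_param_def by blast
qed

text \<open>
  A rank-one perturbation of the identity suffices: \<open>w \<mapsto> w + L(w) (e - a)\<close> maps the axis \<open>a\<close> to \<open>e\<close> if
  \<open>L(a) = 1\<close>, and it is injective if \<open>L(e) \<noteq> 0\<close>.
\<close>

lemma exists_invertible_axis_image:
  fixes e :: "'k::real_normed_field ^ 'n::finite"
  assumes e: "e \<noteq> 0"
  shows "\<exists>A :: 'k ^ 'n ^ 'n. invertible A \<and> A *v axis a 1 = e"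
proof -
  obtain i0 where i0: "e $ i0 \<noteq> 0" using e by (auto simp: vec_eq_iff)
  define i where "i = (if e $ a = 0 then i0 else a)"
  \<comment> \<open>A functional with \<open>L a = 1\<close>; the extra coordinate is added only if \<open>e\<close> has no component along \<open>a\<close>.\<close>
  define L where "L w = w $ a + (if i = a then 0 else w $ i)" for w :: "'k ^ 'n"
  have La: "L (axis a 1) = 1" by (simp add: L_def axis_def)
  have Le: "L e \<noteq> 0" using i0 by (auto simp: L_def i_def)
  define A :: "'k ^ 'n ^ 'n" where "A = matrix (\<lambda>w. w + L w *s (e - axis a 1))"
  have lin: "Vector_Spaces.linear (*s) (*s) (\<lambda>w. w + L w *s (e - axis a 1))"
    by (unfold_locales) (simp_all add: vec_eq_iff L_def algebra_simps)
  have A: "A *v w = w + L w *s (e - axis a 1)" for w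
    unfolding A_def by (rule matrix_works[OF lin])
  have "w = 0" if w: "A *v w = 0" for w
  proof -
    have "L (A *v w) = L w * L e"
      unfolding A by (simp add: L_def algebra_simps axis_def i_def)
    moreover have "L 0 = 0" by (simp add: L_def)
    ultimately have "L w = 0" using Le w by simp
    then show "w = 0" using w A by simp
  qed
  then have "invertible A" using matrix_left_invertible_ker invertible_left_inverse by metis
  moreover have "A *v axis a 1 = e" by (simp add: A La)
  ultimately show ?thesis by blast
qed

section \<open>Charts with constant metric\<close>

lemma smooth_on_inner_eta:
  assumes "open U" "\<And>l. smooth_on U (\<lambda>v. X v $ l)" "\<And>l. smooth_on U (\<lambda>v. Y v $ l)"
  shows "smooth_on U (\<lambda>v. inner_eta \<eta> (X v) (Y v))"
  unfolding inner_eta_def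
  by (intro smooth_on_sum smooth_on_mult smooth_on_const assms)

lemma smooth_on_trilinear:
  assumes "open U" "\<And>i j k. smooth_on U (\<lambda>v. c v i j k)" "\<And>l. smooth_on U (\<lambda>v. X v $ l)"
    "\<And>l. smooth_on U (\<lambda>v. Y v $ l)" "\<And>l. smooth_on U (\<lambda>v. Z v $ l)"
  shows "smooth_on U (\<lambda>v. trilinear (c v) (X v) (Y v) (Z v))"
  unfolding trilinear_def
  by (intro smooth_on_sum smooth_on_mult assms)

text \<open>
  The braid argument behind the uniqueness of the Levi-Civita connection.  It is used twice: for the
  tangential part of the second derivatives of a chart and for the second derivatives of a Killing covector.
\<close>

lemma zero_of_sym_antisym:
  fixes T :: "'a \<Rightarrow> 'a \<Rightarrow> 'a \<Rightarrow> 'k::real_normed_field"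
  assumes sym: "\<And>a b c. T a b c = T b a c" and anti: "\<And>a b c. T a b c = - T a c b"
  shows "T a b c = 0"
proof -
  have "T a b c = - T a c b" by (rule anti)
  also have "\<dots> = - T c a b" by (simp only: sym[of a c b])
  also have "\<dots> = T c b a" using anti[of c a b] by simp
  also have "\<dots> = T b c a" by (rule sym)
  also have "\<dots> = - T b a c" by (rule anti)
  also have "\<dots> = - T a b c" by (simp only: sym[of b a c])
  finally have "T a b c + T a b c = 0" by simp
  then have "2 * T a b c = 0" by (simp only: mult_2)
  then show ?thesis by simp
qed

lemma inner_eta_gram:
  "inner_eta \<eta> (\<Sum>\<alpha>\<in>UNIV. a $ \<alpha> *s e \<alpha>) (\<Sum>\<beta>\<in>UNIV. b $ \<beta> *s e \<beta>)
   = inner_eta (\<chi> \<alpha> \<beta>. inner_eta \<eta> (e \<alpha>) (e \<beta>)) a b"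
  unfolding inner_eta_sum_left
  by (simp add: inner_eta_sum_right inner_eta_smult_left inner_eta_smult_right
      inner_eta_def[of "\<chi> \<alpha> \<beta>. inner_eta \<eta> (e \<alpha>) (e \<beta>)"] sum_distrib_left mult.commute mult.left_commute)

lemma inner_eta_eq_sum: "inner_eta \<eta> a b = (\<Sum>j\<in>UNIV. (transpose \<eta> *v a) $ j * b $ j)"
  unfolding inner_eta_def
  by (subst sum.swap) (simp add: vector_matrix_mult_def sum_distrib_left mult.commute mult.left_commute)

lemma matrix_inv_cancel:
  assumes "invertible (A :: 'a::field ^ 'n ^ 'n)"
  shows "A *v (matrix_inv A *v x) = x" "matrix_inv A *v (A *v x) = x"
proof -
  have "A ** matrix_inv A = mat 1 \<and> matrix_inv A ** A = mat 1"
    unfolding matrix_inv_def by (rule someI_ex) (use assms in \<open>simp add: invertible_def\<close>)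
  then show "A *v (matrix_inv A *v x) = x" "matrix_inv A *v (A *v x) = x"
    by (simp_all add: matrix_vector_mul_assoc)
qed

text \<open>
  Nondegeneracy of the induced metric is expressed by invertibility of its constant matrix; injectivity
  of the differential is a consequence.
\<close>

locale flat_chart =
  fixes \<eta> :: "'k::{real_normed_field,euclidean_space} ^ 'm::finite ^ 'm" and V :: "('k ^ 'n::finite) set"
    and \<phi> :: "'k ^ 'n \<Rightarrow> 'k ^ 'm" and g :: "'k ^ 'n ^ 'n"
  assumes eta_sym: "\<And>i j. \<eta> $ i $ j = \<eta> $ j $ i"
    and V: "open V" "convex V" "V \<noteq> {}"
    and smooth: "\<And>l. smooth_on V (\<lambda>u. \<phi> u $ l)"
    and gram: "\<And>u a b. u \<in> V \<Longrightarrow> inner_eta \<eta> (pushforward \<phi> u a) (pushforward \<phi> u b) = inner_eta g a b"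
    and g_inv: "invertible g"
begin

lemma inner_commute: "inner_eta \<eta> a b = inner_eta \<eta> b a"
  by (rule inner_eta_commute[OF eta_sym])

lemma smooth_frame: "smooth_on V (\<lambda>u. vector_pd \<alpha> \<phi> u $ l)"
  using smooth_onD(1)[OF smooth] by (simp add: vector_pd_def)

lemma inner_frame: "u \<in> V \<Longrightarrow> inner_eta \<eta> (vector_pd \<alpha> \<phi> u) (vector_pd \<beta> \<phi> u) = g $ \<alpha> $ \<beta>"
  using gram[of u "axis \<alpha> 1" "axis \<beta> 1"] by (simp add: pushforward_axis inner_eta_axis)

lemma g_sym: "g $ \<alpha> $ \<beta> = g $ \<beta> $ \<alpha>"
proof -
  obtain u where "u \<in> V" using V(3) by blast
  then show ?thesis
    using inner_frame[of u \<alpha> \<beta>] inner_frame[of u \<beta> \<alpha>] inner_commute[of "vector_pd \<alpha> \<phi> u"] by simp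
qed

lemma transpose_g: "transpose g = g"
  by (simp add: vec_eq_iff transpose_def g_sym[symmetric])

lemma inner_pushforward_frame:
  assumes "u \<in> V"
  shows "inner_eta \<eta> (pushforward \<phi> u a) (vector_pd \<beta> \<phi> u) = (g *v a) $ \<beta>"
proof -
  have "inner_eta \<eta> (pushforward \<phi> u a) (vector_pd \<beta> \<phi> u) = inner_eta g a (axis \<beta> 1)"
    using gram[OF assms, of a "axis \<beta> 1"] by (simp only: pushforward_axis)
  then show ?thesis by (simp only: inner_eta_axis_right transpose_g)
qed

lemma pushforward_cancel:
  assumes "u \<in> V" "\<And>b. inner_eta \<eta> (pushforward \<phi> u a) (pushforward \<phi> u b) = inner_eta \<eta> (pushforward \<phi> u a') (pushforward \<phi> u b)"
  shows "a = a'"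
proof -
  have "inner_eta g (a - a') b = 0" for b
    using assms by (simp add: gram inner_eta_diff_left)
  then have "a - a' = 0" by (rule inner_eta_nondegenerate[OF g_inv])
  then show ?thesis by simp
qed

lemma inj_pushforward: "u \<in> V \<Longrightarrow> inj (pushforward \<phi> u)"
  by (rule injI) (auto intro: pushforward_cancel)

lemma normal_of_frame:
  assumes "\<And>\<beta>. inner_eta \<eta> X (vector_pd \<beta> \<phi> u) = 0"
  shows "inner_eta \<eta> X (pushforward \<phi> u b) = 0"
  unfolding pushforward_eq by (simp add: inner_eta_sum_right inner_eta_smult_right assms)

text \<open>
  The Christoffel symbols \<open>\<langle>\<phi>\<^sub>\<delta>\<^sub>\<alpha>, \<phi>\<^sub>\<beta>\<rangle>\<close> of a constant metric vanish: they are symmetric in \<open>\<delta>, \<alpha>\<close>, and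
  antisymmetric in \<open>\<alpha>, \<beta>\<close> because \<open>\<langle>\<phi>\<^sub>\<alpha>, \<phi>\<^sub>\<beta>\<rangle>\<close> is constant.
\<close>

lemma second_fundamental_form_normal:
  assumes u: "u \<in> V"
  shows "inner_eta \<eta> (vector_pd \<delta> (vector_pd \<alpha> \<phi>) u) (pushforward \<phi> u b) = 0"
proof (rule normal_of_frame)
  fix \<beta>
  define \<Gamma> where "\<Gamma> \<delta> \<alpha> \<beta> = inner_eta \<eta> (vector_pd \<delta> (vector_pd \<alpha> \<phi>) u) (vector_pd \<beta> \<phi> u)" for \<delta> \<alpha> \<beta>
  have "vector_pd \<delta> (vector_pd \<alpha> \<phi>) u = vector_pd \<alpha> (vector_pd \<delta> \<phi>) u" for \<delta> \<alpha>
    unfolding vector_pd_def by (simp add: vec_eq_iff smooth_on_pd_commute[OF V(1) u smooth, of \<delta> \<alpha>])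
  then have sym: "\<Gamma> \<delta> \<alpha> \<beta> = \<Gamma> \<alpha> \<delta> \<beta>" for \<delta> \<alpha> \<beta> unfolding \<Gamma>_def by (rule arg_cong)
  have anti: "\<Gamma> \<delta> \<alpha> \<beta> = - \<Gamma> \<delta> \<beta> \<alpha>" for \<delta> \<alpha> \<beta>
  proof -
    have "pd \<delta> (\<lambda>v. inner_eta \<eta> (vector_pd \<alpha> \<phi> v) (vector_pd \<beta> \<phi> v)) u = pd \<delta> (\<lambda>v. g $ \<alpha> $ \<beta>) u"
      by (rule pd_cong[OF V(1) u]) (rule inner_frame)
    then have "\<Gamma> \<delta> \<alpha> \<beta> + \<Gamma> \<delta> \<beta> \<alpha> = 0"
      using inner_commute[of "vector_pd \<alpha> \<phi> u"]
      by (simp add: pd_inner_eta smooth_onD(2)[OF smooth_frame u] pd_const \<Gamma>_def)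
    then show ?thesis by (simp add: eq_neg_iff_add_eq_0)
  qed
  show "inner_eta \<eta> (vector_pd \<delta> (vector_pd \<alpha> \<phi>) u) (vector_pd \<beta> \<phi> u) = 0"
    using zero_of_sym_antisym[of \<Gamma>, OF sym anti] by (simp add: \<Gamma>_def)
qed

lemma pd_tangent_coefficient:
  assumes u: "u \<in> V" and X: "\<And>l. smooth_on V (\<lambda>v. X v $ l)" and tangent: "X u \<in> range (pushforward \<phi> u)"
  shows "pd \<delta> (\<lambda>v. inner_eta \<eta> (X v) (vector_pd \<beta> \<phi> v)) u = inner_eta \<eta> (vector_pd \<delta> X u) (vector_pd \<beta> \<phi> u)"
proof -
  obtain a where "X u = pushforward \<phi> u a" using tangent by blast
  then have "inner_eta \<eta> (X u) (vector_pd \<delta> (vector_pd \<beta> \<phi>) u) = 0"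
    using second_fundamental_form_normal[OF u, of \<delta> \<beta> a] inner_commute[of "X u"] by simp
  then show ?thesis
    by (simp add: pd_inner_eta smooth_onD(2)[OF X u] smooth_onD(2)[OF smooth_frame u])
qed

lemma pushforward_coefficients:
  assumes u: "u \<in> V" and tangent: "X \<in> range (pushforward \<phi> u)"
  shows "pushforward \<phi> u (matrix_inv g *v (\<chi> \<beta>. inner_eta \<eta> X (vector_pd \<beta> \<phi> u))) = X"
proof -
  obtain a where a: "X = pushforward \<phi> u a" using tangent by blast
  have "(\<chi> \<beta>. inner_eta \<eta> X (vector_pd \<beta> \<phi> u)) = g *v a"
    by (simp only: vec_eq_iff a inner_pushforward_frame[OF u] vec_lambda_beta) simp
  then show ?thesis by (simp add: a matrix_inv_cancel[OF g_inv])
qed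

text \<open>
  The covariant components \<open>\<langle>c, \<phi>\<^sub>\<beta>\<rangle>\<close> are constant since \<open>c\<close> is tangent and the derivatives of \<open>\<phi>\<^sub>\<beta>\<close> are normal.
\<close>

lemma constant_tangent_field:
  assumes "\<And>u. u \<in> V \<Longrightarrow> c \<in> range (pushforward \<phi> u)"
  shows "\<exists>e. \<forall>u\<in>V. pushforward \<phi> u e = c"
proof -
  have s: "smooth_on V (\<lambda>v. c $ l)" for l by (rule smooth_on_const)
  have "vector_pd \<delta> (\<lambda>v. c) u = 0" for \<delta> and u :: "'k ^ 'n" by (simp add: vector_pd_def vec_eq_iff pd_const)
  then have z: "pd \<delta> (\<lambda>v. inner_eta \<eta> c (vector_pd \<beta> \<phi> v)) u = 0" if "u \<in> V" for \<beta> \<delta> u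
    using pd_tangent_coefficient[OF that s assms[OF that], of \<delta> \<beta>] by (simp add: inner_eta_zero_left)
  have "\<exists>k. \<forall>u\<in>V. inner_eta \<eta> c (vector_pd \<beta> \<phi> u) = k" for \<beta>
    by (rule const_of_pd_zero[OF V(1,2) smooth_onD(3)[OF smooth_on_inner_eta[OF V(1) s smooth_frame]] z])
  then obtain k where k: "\<And>u \<beta>. u \<in> V \<Longrightarrow> inner_eta \<eta> c (vector_pd \<beta> \<phi> u) = k \<beta>" by metis
  have "pushforward \<phi> u (matrix_inv g *v (\<chi> \<beta>. k \<beta>)) = c" if "u \<in> V" for u
    using pushforward_coefficients[OF that assms[OF that]] by (simp add: k[OF that])
  then show ?thesis by blast
qed

text \<open>
  Restricted to the flat chart, the field is a conformal Killing field with constant factor, hence affine.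
  The second part of the conclusion says that the linear part \<open>q\<close> represents the tangential part of \<open>Q\<close>; it is
  what relates the two Euler fields in the homogeneity condition.
\<close>

lemma affine_tangent_field:
  assumes tangent: "\<And>u. u \<in> V \<Longrightarrow> Q *v \<phi> u + r \<in> range (pushforward \<phi> u)"
    and conformal: "\<And>a b. inner_eta \<eta> (Q *v a) b + inner_eta \<eta> a (Q *v b) = \<mu> * inner_eta \<eta> a b"
  shows "\<exists>q s. \<forall>u\<in>V. pushforward \<phi> u (q *v u + s) = Q *v \<phi> u + r \<and>
    (\<forall>\<alpha> b. inner_eta \<eta> (pushforward \<phi> u (q *v axis \<alpha> 1)) (pushforward \<phi> u b)
       = inner_eta \<eta> (Q *v vector_pd \<alpha> \<phi> u) (pushforward \<phi> u b))"
proof -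
  let ?X = "\<lambda>u. Q *v \<phi> u + r"
  have X: "?X u $ l = (\<Sum>i\<in>UNIV. Q $ l $ i * \<phi> u $ i) + r $ l" for u l
    by (simp add: matrix_vector_mult_def)
  have Xs: "smooth_on V (\<lambda>v. ?X v $ l)" for l
    unfolding X by (intro smooth_on_add smooth_on_sum smooth_on_mult smooth_on_const smooth V(1))
  have dX: "vector_pd \<delta> ?X u = Q *v vector_pd \<delta> \<phi> u" if u: "u \<in> V" for \<delta> u
  proof -
    have "pd \<delta> (\<lambda>v. ?X v $ l) u = (\<Sum>i\<in>UNIV. Q $ l $ i * pd \<delta> (\<lambda>v. \<phi> v $ i) u)" for l
      unfolding X using smooth_onD(2)[OF smooth u]
      by (simp add: pd_add pd_linear_combination pd_const)
    then show ?thesis by (simp add: vector_pd_def vec_eq_iff matrix_vector_mult_def)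
  qed
  define G where "G \<beta> u = inner_eta \<eta> (?X u) (vector_pd \<beta> \<phi> u)" for \<beta> u
  have Gs: "smooth_on V (G \<beta>)" for \<beta>
    unfolding G_def[abs_def] by (rule smooth_on_inner_eta[OF V(1) Xs smooth_frame])
  have dG: "pd \<delta> (G \<beta>) u = inner_eta \<eta> (Q *v vector_pd \<delta> \<phi> u) (vector_pd \<beta> \<phi> u)" if u: "u \<in> V" for \<beta> \<delta> u
    unfolding G_def[abs_def] pd_tangent_coefficient[OF u Xs tangent[OF u]] dX[OF u] ..
  \<comment> \<open>The Killing equation of the induced Euler field, up to a constant multiple of the metric.\<close>
  have killing: "pd \<delta> (G \<beta>) u + pd \<beta> (G \<delta>) u = \<mu> * g $ \<delta> $ \<beta>" if u: "u \<in> V" for \<beta> \<delta> u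
    using conformal[of "vector_pd \<delta> \<phi> u" "vector_pd \<beta> \<phi> u"] inner_commute[of "vector_pd \<delta> \<phi> u" "Q *v vector_pd \<beta> \<phi> u"]
    by (simp add: dG[OF u] inner_frame[OF u])
  have zero: "pd \<gamma> (pd \<delta> (G \<beta>)) u = 0" if u: "u \<in> V" for \<beta> \<delta> \<gamma> u
  proof (rule zero_of_sym_antisym[of "\<lambda>\<gamma> \<delta> \<beta>. pd \<gamma> (pd \<delta> (G \<beta>)) u"])
    show "pd a (pd b (G c)) u = pd b (pd a (G c)) u" for a b c
      by (rule smooth_on_pd_commute[OF V(1) u Gs])
    have "pd a (\<lambda>v. pd b (G c) v + pd c (G b) v) u = pd a (\<lambda>v. \<mu> * g $ b $ c) u" for a b c
      by (rule pd_cong[OF V(1) u]) (rule killing)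
    then show "pd a (pd b (G c)) u = - pd a (pd c (G b)) u" for a b c
      by (simp add: pd_add smooth_onD(2)[OF smooth_onD(1)[OF Gs] u] pd_const eq_neg_iff_add_eq_0)
  qed
  have "\<exists>B C. \<forall>u\<in>V. G \<beta> u = (\<Sum>i\<in>UNIV. B i * u $ i) + C" for \<beta>
    by (rule affine_of_second_pd_zero[OF V(1,2) smooth_onD(3)[OF Gs] zero])
  then obtain B C where BC: "\<And>u \<beta>. u \<in> V \<Longrightarrow> G \<beta> u = (\<Sum>i\<in>UNIV. B \<beta> i * u $ i) + C \<beta>" by metis
  define b :: "'k ^ 'n ^ 'n" where "b = (\<chi> \<beta> i. B \<beta> i)"
  define q where "q = matrix_inv g ** b"
  define s where "s = matrix_inv g *v (\<chi> \<beta>. C \<beta>)"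
  have "pushforward \<phi> u (q *v u + s) = ?X u" if u: "u \<in> V" for u
  proof -
    have "(\<chi> \<beta>. inner_eta \<eta> (?X u) (vector_pd \<beta> \<phi> u)) = b *v u + (\<chi> \<beta>. C \<beta>)"
      using BC[OF u] by (simp add: vec_eq_iff G_def b_def matrix_vector_mult_def)
    then show ?thesis
      using pushforward_coefficients[OF u tangent[OF u]]
      by (simp add: q_def s_def matrix_vector_right_distrib matrix_vector_mul_assoc)
  qed
  moreover have "inner_eta \<eta> (pushforward \<phi> u (q *v axis \<alpha> 1)) (pushforward \<phi> u c)
       = inner_eta \<eta> (Q *v vector_pd \<alpha> \<phi> u) (pushforward \<phi> u c)" if u: "u \<in> V" for u \<alpha> c
  proof -
    have "inner_eta \<eta> (pushforward \<phi> u (q *v axis \<alpha> 1) - Q *v vector_pd \<alpha> \<phi> u) (vector_pd \<beta> \<phi> u) = 0" for \<beta>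
    proof -
      have "pd \<alpha> (G \<beta>) u = pd \<alpha> (\<lambda>u. (\<Sum>i\<in>UNIV. B \<beta> i * u $ i) + C \<beta>) u"
        by (rule pd_cong[OF V(1) u]) (rule BC)
      then have 1: "inner_eta \<eta> (Q *v vector_pd \<alpha> \<phi> u) (vector_pd \<beta> \<phi> u) = B \<beta> \<alpha>"
        by (simp add: dG[OF u] pd_add pd_linear_form pd_const)
      have "inner_eta \<eta> (pushforward \<phi> u (q *v axis \<alpha> 1)) (vector_pd \<beta> \<phi> u) = (g *v (q *v axis \<alpha> 1)) $ \<beta>"
        by (rule inner_pushforward_frame[OF u])
      also have "g *v (q *v axis \<alpha> 1) = b *v axis \<alpha> 1"
        unfolding q_def matrix_vector_mul_assoc[symmetric] by (rule matrix_inv_cancel(1)[OF g_inv])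
      also have "(b *v axis \<alpha> 1) $ \<beta> = B \<beta> \<alpha>"
        by (simp add: b_def matrix_vector_mult_def axis_def mult_delta_right)
      finally show ?thesis using 1 by (simp add: inner_eta_diff_left)
    qed
    then have "inner_eta \<eta> (pushforward \<phi> u (q *v axis \<alpha> 1) - Q *v vector_pd \<alpha> \<phi> u) (pushforward \<phi> u c) = 0"
      by (rule normal_of_frame)
    then show ?thesis by (simp add: inner_eta_diff_left)
  qed
  ultimately show ?thesis by blast
qed

end

section \<open>The ambient Frobenius manifold\<close>

lemma frob_mult_eq:
  "frob_mult F \<eta> t a b = matrix_inv \<eta> *v (\<chi> l. \<Sum>i\<in>UNIV. \<Sum>j\<in>UNIV. a $ i * b $ j * third F i j l t)"
proof -
  have "(\<Sum>i\<in>UNIV. \<Sum>j\<in>UNIV. a $ i * b $ j * (\<Sum>l\<in>UNIV. matrix_inv \<eta> $ k $ l * third F i j l t)) =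
     (\<Sum>l\<in>UNIV. matrix_inv \<eta> $ k $ l * (\<Sum>i\<in>UNIV. \<Sum>j\<in>UNIV. a $ i * b $ j * third F i j l t))" for k
  proof -
    have "(\<Sum>l\<in>UNIV. matrix_inv \<eta> $ k $ l * (\<Sum>i\<in>UNIV. \<Sum>j\<in>UNIV. a $ i * b $ j * third F i j l t)) =
      (\<Sum>l\<in>UNIV. \<Sum>i\<in>UNIV. \<Sum>j\<in>UNIV. a $ i * b $ j * (matrix_inv \<eta> $ k $ l * third F i j l t))"
      by (simp add: sum_distrib_left mult.left_commute)
    also have "\<dots> = (\<Sum>i\<in>UNIV. \<Sum>l\<in>UNIV. \<Sum>j\<in>UNIV. a $ i * b $ j * (matrix_inv \<eta> $ k $ l * third F i j l t))"
      by (rule sum.swap)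
    also have "\<dots> = (\<Sum>i\<in>UNIV. \<Sum>j\<in>UNIV. \<Sum>l\<in>UNIV. a $ i * b $ j * (matrix_inv \<eta> $ k $ l * third F i j l t))"
      by (rule sum.cong[OF refl]) (rule sum.swap)
    finally show ?thesis by (simp add: sum_distrib_left)
  qed
  then show ?thesis by (simp add: vec_eq_iff frob_mult_def matrix_vector_mult_def)
qed

text \<open>
  The metric and the third derivatives determine the product and conversely.  The formula is used for
  the ambient prepotential as well as for the one on the submanifold.
\<close>

lemma inner_frob_mult:
  fixes \<eta> :: "'k::real_normed_field ^ 'n::finite ^ 'n"
  assumes sym: "\<And>i j. \<eta> $ i $ j = \<eta> $ j $ i" and inv: "invertible \<eta>"
  shows "inner_eta \<eta> (frob_mult F \<eta> t a b) d = trilinear (\<lambda>i j k. third F i j k t) a b d"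
proof -
  have T: "transpose \<eta> = \<eta>" by (simp add: vec_eq_iff transpose_def) (rule allI, rule allI, rule sym)
  have "inner_eta \<eta> (frob_mult F \<eta> t a b) d = (\<Sum>l\<in>UNIV. (\<Sum>i\<in>UNIV. \<Sum>j\<in>UNIV. a $ i * b $ j * third F i j l t) * d $ l)"
    unfolding inner_eta_eq_sum T frob_mult_eq matrix_inv_cancel[OF inv] by simp
  also have "\<dots> = (\<Sum>l\<in>UNIV. \<Sum>i\<in>UNIV. \<Sum>j\<in>UNIV. third F i j l t * a $ i * b $ j * d $ l)"
    by (simp add: sum_distrib_left mult.commute mult.left_commute)
  also have "\<dots> = (\<Sum>i\<in>UNIV. \<Sum>l\<in>UNIV. \<Sum>j\<in>UNIV. third F i j l t * a $ i * b $ j * d $ l)"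
    by (rule sum.swap)
  also have "\<dots> = trilinear (\<lambda>i j k. third F i j k t) a b d"
    unfolding trilinear_def by (rule sum.cong[OF refl]) (rule sum.swap)
  finally show ?thesis .
qed

lemma third_cong:
  assumes U: "open U" "x \<in> U" and eq: "\<And>y. y \<in> U \<Longrightarrow> f y = h y"
  shows "third f i j k x = third h i j k x"
  unfolding third_def
  by (intro pd_cong[OF U(1)] U(2) eq; assumption)

lemma third_add_cmult:
  assumes U: "open U" "x \<in> U" and f: "smooth_on U f" and h: "smooth_on U h"
  shows "third (\<lambda>y. f y + c * h y) i j k x = third f i j k x + c * third h i j k x"
proof -
  have step: "pd i (\<lambda>y. f y + c * h y) y = pd i f y + c * pd i h y" if "smooth_on U f" "smooth_on U h" "y \<in> U" for f h i y
    using smooth_onD(2)[OF that(1,3)] smooth_onD(2)[OF that(2,3)]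
    by (simp add: pd_add pd_mult pd_const)
  have "third (\<lambda>y. f y + c * h y) i j k x = pd i (pd j (\<lambda>y. pd k f y + c * pd k h y)) x"
    unfolding third_def by (intro pd_cong[OF U(1)] U(2) step f h; assumption)
  also have "\<dots> = pd i (\<lambda>y. pd j (pd k f) y + c * pd j (pd k h) y) x"
    by (intro pd_cong[OF U(1)] U(2) step smooth_onD(1) f h; assumption)
  also have "\<dots> = third f i j k x + c * third h i j k x"
    unfolding third_def by (intro step smooth_onD(1) f h U(2))
  finally show ?thesis .
qed

lemma third_quadratic:
  "third (\<lambda>x. (\<Sum>i\<in>UNIV. \<Sum>j\<in>UNIV. A i j * x $ i * x $ j) + (\<Sum>i\<in>UNIV. B i * x $ i) + C) i j k
    (x :: 'k::real_normed_field ^ 'n::finite) = 0"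
proof -
  let ?q = "\<lambda>x :: 'k ^ 'n. (\<Sum>i\<in>UNIV. \<Sum>j\<in>UNIV. A i j * x $ i * x $ j) + (\<Sum>i\<in>UNIV. B i * x $ i) + C"
  have d1: "differentiable_along (\<lambda>x. A i j * x $ i) k (x :: 'k ^ 'n)" for i j k x by (intro pd_mult(2) pd_const pd_coord)
  have d2: "differentiable_along (\<lambda>x. A i j * x $ i * x $ j) k (x :: 'k ^ 'n)" for i j k x by (intro pd_mult(2) d1 pd_coord)
  have d3: "differentiable_along (\<lambda>x. \<Sum>j\<in>UNIV. A i j * x $ i * x $ j) k (x :: 'k ^ 'n)" for i k x by (rule pd_sum(2)[OF d2])
  have d4: "differentiable_along (\<lambda>x. \<Sum>i\<in>UNIV. \<Sum>j\<in>UNIV. A i j * x $ i * x $ j) k (x :: 'k ^ 'n)" for k x by (rule pd_sum(2)[OF d3])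
  have "pd k (\<lambda>x. A i j * x $ i * x $ j) x = (if k = i then A i j * x $ j else 0) + (if k = j then A i j * x $ i else 0)"
    for i j k and x :: "'k ^ 'n"
    by (simp add: pd_mult(1)[OF d1 pd_coord(2)] pd_mult(1)[OF pd_const(2) pd_coord(2)] pd_const pd_coord)
  then have "pd k (\<lambda>x. \<Sum>i\<in>UNIV. \<Sum>j\<in>UNIV. A i j * x $ i * x $ j) x = (\<Sum>i\<in>UNIV. \<Sum>j\<in>UNIV.
      (if k = i then A i j * x $ j else 0) + (if k = j then A i j * x $ i else 0))" for k and x :: "'k ^ 'n"
    unfolding pd_sum(1)[OF d3] pd_sum(1)[OF d2] by simp
  also have "\<dots> k x = (\<Sum>j\<in>UNIV. (A k j + A j k) * x $ j)" for k and x :: "'k ^ 'n"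
  proof -
    have "(\<Sum>i\<in>UNIV. \<Sum>j\<in>UNIV. if k = i then A i j * x $ j else 0) = (\<Sum>j\<in>UNIV. A k j * x $ j)"
      by (subst sum.swap) simp
    then show ?thesis by (simp add: sum.distrib distrib_right)
  qed
  finally have "pd k ?q x = (\<Sum>j\<in>UNIV. (A k j + A j k) * x $ j) + B k" for k x
    using d4[of k x] pd_linear_form(2)[of B k x]
    by (simp add: pd_add pd_const pd_linear_form)
  then have "pd k ?q = (\<lambda>x. (\<Sum>j\<in>UNIV. (A k j + A j k) * x $ j) + B k)" by (simp add: fun_eq_iff)
  moreover have "pd j (\<lambda>x. (\<Sum>j\<in>UNIV. (A k j + A j k) * x $ j) + B k) = (\<lambda>x :: 'k ^ 'n. A k j + A j k)"
    using pd_linear_form[where B = "\<lambda>j. A k j + A j k"]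
    by (simp add: fun_eq_iff pd_add pd_const)
  ultimately show ?thesis unfolding third_def by (simp add: pd_const)
qed

lemma standard_form_symmetric: "standard_form M \<eta> E dF \<Longrightarrow> \<eta> $ i $ j = \<eta> $ j $ i"
  unfolding standard_form_def by (simp add: add.commute)

text \<open>
  In the normal form the linear part of the Euler field is diagonal with entries \<open>d\<^sub>i\<close>, and the metric pairs
  only indices with \<open>d\<^sub>i + d\<^sub>j = 2 - d = d\<^sub>F - 1\<close>.
\<close>

lemma standard_form_euler:
  fixes M :: "(('k::real_normed_field, 'm::{finite,linorder}) vec) set"
  assumes "standard_form M \<eta> E dF"
  obtains Q r where "\<And>t. t \<in> M \<Longrightarrow> E t = Q *v t + r"
    "\<And>a b. inner_eta \<eta> (Q *v a) b + inner_eta \<eta> a (Q *v b) = (dF - 1) * inner_eta \<eta> a b"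
proof -
  obtain q s where \<eta>: "\<And>i j. \<eta> $ i $ j = (if pos i + pos j = CARD('m) + 1 then 1 else 0)"
    and q: "\<And>i j. pos i + pos j = CARD('m) + 1 \<Longrightarrow> q i + q j = 3 - dF"
    and E: "\<And>t. t \<in> M \<Longrightarrow> E t = (\<chi> i. (1 - q i) * t $ i + (if 1 - q i = 0 then s i else 0))"
    using assms unfolding standard_form_def by blast
  define Q :: "(('k, 'm) vec, 'm) vec" where "Q = (\<chi> i j. if i = j then 1 - q i else 0)"
  define r :: "('k, 'm) vec" where "r = (\<chi> i. if 1 - q i = 0 then s i else 0)"
  have Q: "(Q *v a) $ i = (1 - q i) * a $ i" for a i
    by (simp add: Q_def matrix_vector_mult_def mult_delta_left)
  have "E t = Q *v t + r" if "t \<in> M" for t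
    using E[OF that] by (simp add: vec_eq_iff Q r_def)
  moreover have "inner_eta \<eta> (Q *v a) b + inner_eta \<eta> a (Q *v b) = (dF - 1) * inner_eta \<eta> a b" for a b
  proof -
    have *: "\<eta> $ i $ j * ((1 - q i) * a $ i) * b $ j + \<eta> $ i $ j * a $ i * ((1 - q j) * b $ j) =
       (dF - 1) * (\<eta> $ i $ j * a $ i * b $ j)" for i j
    proof (cases "pos i + pos j = CARD('m) + 1")
      case True
      have "(1 - q i) + (1 - q j) = dF - 1" using q[OF True] by (simp add: algebra_simps)
      then have "((1 - q i) + (1 - q j)) * (a $ i * b $ j) = (dF - 1) * (a $ i * b $ j)" by simp
      then show ?thesis using True by (simp add: \<eta> algebra_simps)
    qed (simp add: \<eta>)
    show ?thesis
      unfolding inner_eta_def Q by (simp only: sum.distrib[symmetric] * sum_distrib_left)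
  qed
  ultimately show ?thesis using that by blast
qed

text \<open>
  The quadratic ambiguity in the homogeneity condition disappears after three differentiations.
\<close>

lemma euler_third:
  assumes frob: "frobenius_manifold M F \<eta> E dF" and E: "\<And>t. t \<in> M \<Longrightarrow> E t = Q *v t + r" and t: "t \<in> M"
  shows "third (affine_lie Q r F) i j k t = dF * third F i j k t"
proof -
  have M: "open M" and F: "smooth_on M F" using frob by (auto simp: frobenius_manifold_def)
  obtain A B C where hom: "\<And>t. t \<in> M \<Longrightarrow> (\<Sum>i\<in>UNIV. E t $ i * pd i F t) =
        dF * F t + ((\<Sum>i\<in>UNIV. \<Sum>j\<in>UNIV. A i j * t $ i * t $ j) + (\<Sum>i\<in>UNIV. B i * t $ i) + C)"
    using frob unfolding frobenius_manifold_def by blast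
  let ?q = "\<lambda>t. (\<Sum>i\<in>UNIV. \<Sum>j\<in>UNIV. A i j * t $ i * t $ j) + (\<Sum>i\<in>UNIV. B i * t $ i) + C"
  have "affine_lie Q r F y = ?q y + dF * F y" if "y \<in> M" for y
    using hom[OF that] E[OF that] by (simp add: affine_lie_def)
  then have "third (affine_lie Q r F) i j k t = third (\<lambda>y. ?q y + dF * F y) i j k t"
    by (rule third_cong[OF M t])
  also have "\<dots> = third ?q i j k t + dF * third F i j k t"
    by (rule third_add_cmult[OF M t _ F])
      (intro smooth_on_add smooth_on_sum smooth_on_mult smooth_on_const smooth_on_coord M)
  finally show ?thesis by (simp only: third_quadratic add_0_left)
qed

section \<open>The Frobenius structure on a flat chart\<close>

text \<open>
  The situation in which all parts of the Frobenius structure can be pulled back from the ambient manifold: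
  a flat chart of the submanifold whose first coordinate field is the unity.
\<close>

locale frobenius_chart = flat_chart \<eta> V \<phi> g
  for \<eta> :: "(('k::{real_normed_field,euclidean_space}, 'm::{finite,linorder}) vec, 'm) vec"
    and V :: "(('k, 'n::{finite,linorder}) vec) set" and \<phi> :: "('k, 'n) vec \<Rightarrow> ('k, 'm) vec" and g :: "(('k, 'n) vec, 'n) vec" +
  fixes M :: "(('k, 'm) vec) set" and F :: "('k, 'm) vec \<Rightarrow> 'k" and E :: "('k, 'm) vec \<Rightarrow> ('k, 'm) vec" and dF :: 'k
  assumes frob: "frobenius_manifold M F \<eta> E dF" and std: "standard_form M \<eta> E dF"
    and in_M: "\<And>u. u \<in> V \<Longrightarrow> \<phi> u \<in> M"
    and unit: "\<And>u. u \<in> V \<Longrightarrow> pushforward \<phi> u unity = unity"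
    and mult_tangent: "\<And>u a b. u \<in> V \<Longrightarrow>
      frob_mult F \<eta> (\<phi> u) (pushforward \<phi> u a) (pushforward \<phi> u b) \<in> range (pushforward \<phi> u)"
    and euler_tangent: "\<And>u. u \<in> V \<Longrightarrow> E (\<phi> u) \<in> range (pushforward \<phi> u)"
begin

lemma M: "open M" and F: "smooth_on M F" and eta_inv: "invertible \<eta>"
  using frob by (auto simp: frobenius_manifold_def)

definition ambient_tensor :: "('k, 'n) vec \<Rightarrow> 'm \<Rightarrow> 'm \<Rightarrow> 'm \<Rightarrow> 'k" where
  "ambient_tensor u i j k = third F i j k (\<phi> u)"

definition induced_tensor :: "'n \<Rightarrow> 'n \<Rightarrow> 'n \<Rightarrow> ('k, 'n) vec \<Rightarrow> 'k" where
  "induced_tensor \<alpha> \<beta> \<gamma> u = trilinear (ambient_tensor u) (vector_pd \<alpha> \<phi> u) (vector_pd \<beta> \<phi> u) (vector_pd \<gamma> \<phi> u)"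

lemma smooth_third: "smooth_on M (third F i j k)"
  unfolding third_def[abs_def] by (intro smooth_onD(1) F)

lemma smooth_ambient_tensor: "smooth_on V (\<lambda>u. ambient_tensor u i j k)"
  unfolding ambient_tensor_def by (rule smooth_on_compose[OF M V(1) in_M smooth_third smooth])

lemma smooth_induced_tensor: "smooth_on V (induced_tensor \<alpha> \<beta> \<gamma>)"
  unfolding induced_tensor_def[abs_def] by (rule smooth_on_trilinear[OF V(1) smooth_ambient_tensor smooth_frame smooth_frame smooth_frame])

lemma ambient_tensor_commute:
  assumes "u \<in> V"
  shows "trilinear (ambient_tensor u) a b d = trilinear (ambient_tensor u) b a d" "trilinear (ambient_tensor u) a b d = trilinear (ambient_tensor u) a d b"
  using third_commute[OF M in_M[OF assms] F]
  by (simp_all add: ambient_tensor_def trilinear_swap12 trilinear_swap23)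

lemma ambient_tensor_eq_inner: "trilinear (ambient_tensor u) a b d = inner_eta \<eta> (frob_mult F \<eta> (\<phi> u) a b) d"
  using inner_frob_mult[OF eta_sym eta_inv, of F "\<phi> u" a b d] by (simp add: ambient_tensor_def[abs_def])

text \<open>
  By the symmetry of the tensor the value is \<open>\<langle>X, a \<circ> b\<rangle>\<close>, and \<open>a \<circ> b\<close> is tangent.  This is where the closedness of
  the tangent spaces under the product enters.
\<close>

lemma ambient_tensor_normal:
  assumes u: "u \<in> V" and X: "\<And>b. inner_eta \<eta> X (pushforward \<phi> u b) = 0"
  shows "trilinear (ambient_tensor u) X (pushforward \<phi> u a) (pushforward \<phi> u b) = 0"
proof -
  obtain z where z: "frob_mult F \<eta> (\<phi> u) (pushforward \<phi> u a) (pushforward \<phi> u b) = pushforward \<phi> u z"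
    using mult_tangent[OF u] by blast
  have "trilinear (ambient_tensor u) X (pushforward \<phi> u a) (pushforward \<phi> u b) = trilinear (ambient_tensor u) (pushforward \<phi> u a) X (pushforward \<phi> u b)"
    by (rule ambient_tensor_commute(1)[OF u])
  also have "\<dots> = trilinear (ambient_tensor u) (pushforward \<phi> u a) (pushforward \<phi> u b) X"
    by (rule ambient_tensor_commute(2)[OF u])
  also have "\<dots> = inner_eta \<eta> X (pushforward \<phi> u z)"
    unfolding ambient_tensor_eq_inner z by (rule inner_commute)
  finally show ?thesis by (simp add: X)
qed

text \<open>
  The three Leibniz terms that differentiate the frame vanish, because second derivatives of \<open>\<phi>\<close> are
  normal and the tensor annihilates normal vectors paired with two tangent ones.
\<close>

lemma pd_induced_tensor:
  assumes u: "u \<in> V"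
  shows "pd \<delta> (induced_tensor \<alpha> \<beta> \<gamma>) u = (\<Sum>l\<in>UNIV. vector_pd \<delta> \<phi> u $ l *
    trilinear (\<lambda>i j k. pd l (third F i j k) (\<phi> u)) (vector_pd \<alpha> \<phi> u) (vector_pd \<beta> \<phi> u) (vector_pd \<gamma> \<phi> u))"
proof -
  have fr: "vector_pd \<alpha> \<phi> u = pushforward \<phi> u (axis \<alpha> 1)" for \<alpha> by (rule pushforward_axis[symmetric])
  have 1: "trilinear (ambient_tensor u) (vector_pd \<delta> (vector_pd \<alpha> \<phi>) u) (vector_pd \<beta> \<phi> u) (vector_pd \<gamma> \<phi> u) = 0" for \<alpha> \<beta> \<gamma>
    unfolding fr by (rule ambient_tensor_normal[OF u second_fundamental_form_normal[OF u]])
  have 2: "trilinear (ambient_tensor u) (vector_pd \<beta> \<phi> u) (vector_pd \<delta> (vector_pd \<alpha> \<phi>) u) (vector_pd \<gamma> \<phi> u) = 0" for \<alpha> \<beta> \<gamma>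
    using 1[of \<alpha> \<beta> \<gamma>] ambient_tensor_commute(1)[OF u] by metis
  have 3: "trilinear (ambient_tensor u) (vector_pd \<beta> \<phi> u) (vector_pd \<gamma> \<phi> u) (vector_pd \<delta> (vector_pd \<alpha> \<phi>) u) = 0" for \<alpha> \<beta> \<gamma>
    using 2[of \<beta> \<alpha> \<gamma>] ambient_tensor_commute(2)[OF u] by metis
  have dC: "pd \<delta> (\<lambda>v. ambient_tensor v i j k) u = (\<Sum>l\<in>UNIV. vector_pd \<delta> \<phi> u $ l * pd l (third F i j k) (\<phi> u))" for i j k
    unfolding ambient_tensor_def vector_pd_def
    by (simp add: pd_compose(1)[OF M in_M[OF u] smooth_onD(3)[OF smooth_third] smooth_onD(2)[OF smooth u]])
  have "pd \<delta> (induced_tensor \<alpha> \<beta> \<gamma>) u = trilinear (\<lambda>i j k. pd \<delta> (\<lambda>v. ambient_tensor v i j k) u) (vector_pd \<alpha> \<phi> u) (vector_pd \<beta> \<phi> u) (vector_pd \<gamma> \<phi> u)"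
    unfolding induced_tensor_def[abs_def]
    using pd_trilinear[where c = ambient_tensor and X = "vector_pd \<alpha> \<phi>" and Y = "vector_pd \<beta> \<phi>" and Z = "vector_pd \<gamma> \<phi>" and i = \<delta>,
        OF smooth_onD(2)[OF smooth_ambient_tensor u] smooth_onD(2)[OF smooth_frame u]
        smooth_onD(2)[OF smooth_frame u] smooth_onD(2)[OF smooth_frame u]]
    by (simp only: 1 2 3 add_0_right)
  then show ?thesis by (simp only: dC trilinear_sum_coeff trilinear_cmult_coeff)
qed

text \<open>
  What is left of the derivative is a fourth derivative of the ambient prepotential.
\<close>

lemma induced_tensor_closed:
  assumes u: "u \<in> V"
  shows "pd \<delta> (induced_tensor \<alpha> \<beta> \<gamma>) u = pd \<alpha> (induced_tensor \<delta> \<beta> \<gamma>) u"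
proof -
  let ?D = "\<lambda>l i j k. pd l (third F i j k) (\<phi> u)"
  have sym: "?D l i j k = ?D i l j k" for l i j k
    unfolding third_def by (rule smooth_on_pd_commute[OF M in_M[OF u] smooth_onD(1)[OF smooth_onD(1)[OF F]]])
  let ?R = "\<lambda>l i. \<Sum>j\<in>UNIV. \<Sum>k\<in>UNIV. ?D l i j k * vector_pd \<beta> \<phi> u $ j * vector_pd \<gamma> \<phi> u $ k"
  have "?R l i = ?R i l" for l i by (intro sum.cong refl) (simp only: sym[of l i])
  then have "(\<Sum>l\<in>UNIV. \<Sum>i\<in>UNIV. vector_pd \<delta> \<phi> u $ l * (vector_pd \<alpha> \<phi> u $ i * ?R l i)) =
     (\<Sum>i\<in>UNIV. \<Sum>l\<in>UNIV. vector_pd \<alpha> \<phi> u $ i * (vector_pd \<delta> \<phi> u $ l * ?R i l))"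
    by (subst sum.swap) (simp only: mult.left_commute)
  then show ?thesis unfolding pd_induced_tensor[OF u] trilinear_eq_sum1 sum_distrib_left[symmetric] .
qed

lemma potential:
  obtains FN where "smooth_on V FN" "\<And>u \<alpha> \<beta> \<gamma>. u \<in> V \<Longrightarrow> third FN \<alpha> \<beta> \<gamma> u = induced_tensor \<alpha> \<beta> \<gamma> u"
proof -
  have "induced_tensor \<alpha> \<beta> \<gamma> u = induced_tensor \<beta> \<alpha> \<gamma> u" "induced_tensor \<alpha> \<beta> \<gamma> u = induced_tensor \<alpha> \<gamma> \<beta> u" if "u \<in> V" for \<alpha> \<beta> \<gamma> u
    unfolding induced_tensor_def by (rule ambient_tensor_commute[OF that])+
  then show ?thesis using third_potential[where c = induced_tensor, OF V(1,2) smooth_induced_tensor _ _ induced_tensor_closed] that by blast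
qed

lemma pushforward_mult:
  assumes FN: "\<And>\<alpha> \<beta> \<gamma>. third FN \<alpha> \<beta> \<gamma> u = induced_tensor \<alpha> \<beta> \<gamma> u" and u: "u \<in> V"
  shows "pushforward \<phi> u (frob_mult FN g u a b) = frob_mult F \<eta> (\<phi> u) (pushforward \<phi> u a) (pushforward \<phi> u b)"
proof -
  obtain z where z: "frob_mult F \<eta> (\<phi> u) (pushforward \<phi> u a) (pushforward \<phi> u b) = pushforward \<phi> u z"
    using mult_tangent[OF u] by blast
  have "frob_mult FN g u a b = z"
  proof (rule pushforward_cancel[OF u])
    fix d
    have "inner_eta \<eta> (pushforward \<phi> u (frob_mult FN g u a b)) (pushforward \<phi> u d) = trilinear (\<lambda>\<alpha> \<beta> \<gamma>. induced_tensor \<alpha> \<beta> \<gamma> u) a b d"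
      unfolding gram[OF u] inner_frob_mult[OF g_sym g_inv] FN ..
    also have "\<dots> = trilinear (ambient_tensor u) (pushforward \<phi> u a) (pushforward \<phi> u b) (pushforward \<phi> u d)"
      unfolding pushforward_eq trilinear_pullback induced_tensor_def ..
    also have "\<dots> = inner_eta \<eta> (pushforward \<phi> u z) (pushforward \<phi> u d)"
      unfolding ambient_tensor_eq_inner z ..
    finally show "inner_eta \<eta> (pushforward \<phi> u (frob_mult FN g u a b)) (pushforward \<phi> u d)
        = inner_eta \<eta> (pushforward \<phi> u z) (pushforward \<phi> u d)" .
  qed
  then show ?thesis using z by simp
qed

text \<open>
  The Lie derivative of the induced tensor along the induced Euler field is the restriction of the ambient
  one.  The derivative along the field is matched by \<open>\<phi>\<close> carrying one Euler field to the other; in the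
  algebraic terms \<open>q\<close> may be replaced by \<open>Q\<close>, since they differ by normal vectors, which the tensor annihilates.
\<close>

lemma homogeneity:
  assumes FN: "smooth_on V FN" "\<And>u \<alpha> \<beta> \<gamma>. u \<in> V \<Longrightarrow> third FN \<alpha> \<beta> \<gamma> u = induced_tensor \<alpha> \<beta> \<gamma> u"
    and E: "\<And>t. t \<in> M \<Longrightarrow> E t = Q *v t + r"
    and q: "\<And>u. u \<in> V \<Longrightarrow> pushforward \<phi> u (q *v u + s) = Q *v \<phi> u + r"
    and Dq: "\<And>u \<alpha> b. u \<in> V \<Longrightarrow> inner_eta \<eta> (pushforward \<phi> u (q *v axis \<alpha> 1)) (pushforward \<phi> u b)
       = inner_eta \<eta> (Q *v vector_pd \<alpha> \<phi> u) (pushforward \<phi> u b)"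
    and u: "u \<in> V"
  shows "third (affine_lie q s FN) \<alpha> \<beta> \<gamma> u = dF * induced_tensor \<alpha> \<beta> \<gamma> u"
proof -
  let ?f = "\<lambda>\<alpha>. vector_pd \<alpha> \<phi> u"
  have fr: "?f \<alpha> = pushforward \<phi> u (axis \<alpha> 1)" for \<alpha> by (rule pushforward_axis[symmetric])
  have T1: "affine_lie q s (third FN \<alpha> \<beta> \<gamma>) u = trilinear (\<lambda>i j k. affine_lie Q r (third F i j k) (\<phi> u)) (?f \<alpha>) (?f \<beta>) (?f \<gamma>)"
  proof -
    let ?D = "\<lambda>l. trilinear (\<lambda>i j k. pd l (third F i j k) (\<phi> u)) (?f \<alpha>) (?f \<beta>) (?f \<gamma>)"
    have "pd \<delta> (third FN \<alpha> \<beta> \<gamma>) u = pd \<delta> (induced_tensor \<alpha> \<beta> \<gamma>) u" for \<delta>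
      by (rule pd_cong[OF V(1) u]) (rule FN(2))
    then have "affine_lie q s (third FN \<alpha> \<beta> \<gamma>) u = (\<Sum>\<delta>\<in>UNIV. \<Sum>l\<in>UNIV. (q *v u + s) $ \<delta> * (?f \<delta> $ l * ?D l))"
      by (simp only: affine_lie_def pd_induced_tensor[OF u] sum_distrib_left)
    also have "\<dots> = (\<Sum>l\<in>UNIV. \<Sum>\<delta>\<in>UNIV. (q *v u + s) $ \<delta> * (?f \<delta> $ l * ?D l))"
      by (rule sum.swap)
    also have "\<dots> = (\<Sum>l\<in>UNIV. pushforward \<phi> u (q *v u + s) $ l * ?D l)"
      by (simp only: pushforward_eq sum_component vector_smult_component sum_distrib_right mult.assoc)
    also have "\<dots> = trilinear (\<lambda>i j k. affine_lie Q r (third F i j k) (\<phi> u)) (?f \<alpha>) (?f \<beta>) (?f \<gamma>)"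
      unfolding q[OF u] affine_lie_def trilinear_sum_coeff trilinear_cmult_coeff ..
    finally show ?thesis .
  qed
  have col: "(\<Sum>\<delta>\<in>UNIV. q $ \<delta> $ \<alpha> *s ?f \<delta>) = pushforward \<phi> u (q *v axis \<alpha> 1)" for \<alpha>
    unfolding pushforward_eq by (simp add: matrix_vector_mult_def axis_def mult_delta_right)
  have T2: "(\<Sum>\<delta>\<in>UNIV. q $ \<delta> $ \<alpha> * third FN \<delta> \<beta> \<gamma> u) = trilinear (ambient_tensor u) (Q *v ?f \<alpha>) (?f \<beta>) (?f \<gamma>)" for \<alpha> \<beta> \<gamma>
  proof -
    have "(\<Sum>\<delta>\<in>UNIV. q $ \<delta> $ \<alpha> * third FN \<delta> \<beta> \<gamma> u) = trilinear (ambient_tensor u) (pushforward \<phi> u (q *v axis \<alpha> 1)) (?f \<beta>) (?f \<gamma>)"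
      unfolding FN(2)[OF u] induced_tensor_def col[symmetric] trilinear_sum1 trilinear_smult1 ..
    moreover have "trilinear (ambient_tensor u) (pushforward \<phi> u (q *v axis \<alpha> 1) - Q *v ?f \<alpha>) (?f \<beta>) (?f \<gamma>) = 0"
      unfolding fr[of \<beta>] fr[of \<gamma>] by (rule ambient_tensor_normal[OF u]) (simp add: inner_eta_diff_left Dq[OF u])
    ultimately show ?thesis by (simp add: trilinear_diff1)
  qed
  have T3: "(\<Sum>\<delta>\<in>UNIV. q $ \<delta> $ \<beta> * third FN \<alpha> \<delta> \<gamma> u) = trilinear (ambient_tensor u) (?f \<alpha>) (Q *v ?f \<beta>) (?f \<gamma>)"
    using T2[of \<beta> \<alpha> \<gamma>] third_commute(1)[OF V(1) u FN(1), of \<alpha> _ \<gamma>] ambient_tensor_commute(1)[OF u, of "?f \<alpha>" "Q *v ?f \<beta>"]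
    by simp
  have T4: "(\<Sum>\<delta>\<in>UNIV. q $ \<delta> $ \<gamma> * third FN \<alpha> \<beta> \<delta> u) = trilinear (ambient_tensor u) (?f \<alpha>) (?f \<beta>) (Q *v ?f \<gamma>)"
  proof -
    have "third FN \<alpha> \<beta> \<delta> u = third FN \<delta> \<alpha> \<beta> u" for \<delta>
      using third_commute[OF V(1) u FN(1)] by metis
    moreover have "trilinear (ambient_tensor u) (?f \<alpha>) (?f \<beta>) (Q *v ?f \<gamma>) = trilinear (ambient_tensor u) (Q *v ?f \<gamma>) (?f \<alpha>) (?f \<beta>)"
      using ambient_tensor_commute[OF u] by metis
    ultimately show ?thesis using T2[of \<gamma> \<alpha> \<beta>] by simp
  qed
  have eu: "third (affine_lie Q r F) i j k (\<phi> u) = dF * third F i j k (\<phi> u)" for i j k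
    by (rule euler_third[OF frob _ in_M[OF u]]) (rule E)
  have "third (affine_lie q s FN) \<alpha> \<beta> \<gamma> u = trilinear (\<lambda>i j k. affine_lie Q r (third F i j k) (\<phi> u)) (?f \<alpha>) (?f \<beta>) (?f \<gamma>)
     + trilinear (ambient_tensor u) (Q *v ?f \<alpha>) (?f \<beta>) (?f \<gamma>) + trilinear (ambient_tensor u) (?f \<alpha>) (Q *v ?f \<beta>) (?f \<gamma>) + trilinear (ambient_tensor u) (?f \<alpha>) (?f \<beta>) (Q *v ?f \<gamma>)"
    unfolding third_affine_lie[OF V(1) u FN(1)] T1 T2 T3 T4 ..
  also have "\<dots> = trilinear (\<lambda>i j k. third (affine_lie Q r F) i j k (\<phi> u)) (?f \<alpha>) (?f \<beta>) (?f \<gamma>)"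
    unfolding third_affine_lie[OF M in_M[OF u] F] trilinear_add_coeff trilinear_matrix1 trilinear_matrix2 trilinear_matrix3 ambient_tensor_def ..
  also have "\<dots> = dF * induced_tensor \<alpha> \<beta> \<gamma> u"
    unfolding eu trilinear_cmult_coeff induced_tensor_def ambient_tensor_def[abs_def] ..
  finally show ?thesis .
qed

theorem induced_frobenius_manifold:
  "\<exists>FN EN. frobenius_manifold V FN g EN dF \<and> (\<forall>u\<in>V.
     (\<forall>a b. pushforward \<phi> u (frob_mult FN g u a b) = frob_mult F \<eta> (\<phi> u) (pushforward \<phi> u a) (pushforward \<phi> u b)) \<and>
     pushforward \<phi> u (EN u) = E (\<phi> u))"
proof -
  obtain FN where FN: "smooth_on V FN" "\<And>u \<alpha> \<beta> \<gamma>. u \<in> V \<Longrightarrow> third FN \<alpha> \<beta> \<gamma> u = induced_tensor \<alpha> \<beta> \<gamma> u"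
    using potential by blast
  obtain Q r where E: "\<And>t. t \<in> M \<Longrightarrow> E t = Q *v t + r"
    and conf: "\<And>a b. inner_eta \<eta> (Q *v a) b + inner_eta \<eta> a (Q *v b) = (dF - 1) * inner_eta \<eta> a b"
    using standard_form_euler[OF std] by blast
  have "Q *v \<phi> u + r \<in> range (pushforward \<phi> u)" if "u \<in> V" for u
    using euler_tangent[OF that] E[OF in_M[OF that]] by simp
  from affine_tangent_field[OF this conf] obtain q s where
    q: "\<And>u. u \<in> V \<Longrightarrow> pushforward \<phi> u (q *v u + s) = Q *v \<phi> u + r"
    and Dq: "\<And>u \<alpha> b. u \<in> V \<Longrightarrow> inner_eta \<eta> (pushforward \<phi> u (q *v axis \<alpha> 1)) (pushforward \<phi> u b)
       = inner_eta \<eta> (Q *v vector_pd \<alpha> \<phi> u) (pushforward \<phi> u b)"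
    by blast
  have mult: "pushforward \<phi> u (frob_mult FN g u a b) = frob_mult F \<eta> (\<phi> u) (pushforward \<phi> u a) (pushforward \<phi> u b)"
    if "u \<in> V" for u a b by (rule pushforward_mult[OF FN(2)[OF that] that])
  have ambient: "frob_mult F \<eta> t (frob_mult F \<eta> t a b) c = frob_mult F \<eta> t a (frob_mult F \<eta> t b c)"
    "frob_mult F \<eta> t a b = frob_mult F \<eta> t b a" "frob_mult F \<eta> t unity a = a" if "t \<in> M" for t a b c
    using frob that unfolding frobenius_manifold_def by blast+
  have norm: "third FN first \<alpha> \<beta> u = g $ \<alpha> $ \<beta>" if u: "u \<in> V" for \<alpha> \<beta> u
  proof -
    have "vector_pd first \<phi> u = unity"
      using unit[OF u] unfolding unity_def[where 'n='n] pushforward_axis .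
    then show ?thesis
      by (simp add: FN(2)[OF u] induced_tensor_def ambient_tensor_eq_inner ambient(3)[OF in_M[OF u]] inner_frame[OF u])
  qed
  have H: "smooth_on V (\<lambda>u. affine_lie q s FN u + (- dF) * FN u)"
    by (intro smooth_on_add smooth_on_mult smooth_on_const smooth_on_affine_lie V(1) FN(1))
  have "third (\<lambda>u. affine_lie q s FN u + (- dF) * FN u) i j k u = 0" if u: "u \<in> V" for i j k u
    using homogeneity[OF FN E q Dq u]
    by (subst third_add_cmult[OF V(1) u smooth_on_affine_lie[OF V(1) FN(1)] FN(1)]) (simp add: FN(2)[OF u])
  then obtain A B K where "\<forall>u\<in>V. affine_lie q s FN u + (- dF) * FN u =
      (\<Sum>i\<in>UNIV. \<Sum>j\<in>UNIV. A i j * u $ i * u $ j) + (\<Sum>i\<in>UNIV. B i * u $ i) + K"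
    using quadratic_of_third_pd_zero[OF V(1,2) smooth_onD(3)[OF H]] unfolding third_def by blast
  then have hom: "\<forall>u\<in>V. (\<Sum>i\<in>UNIV. (q *v u + s) $ i * pd i FN u) = dF * FN u +
      ((\<Sum>i\<in>UNIV. \<Sum>j\<in>UNIV. A i j * u $ i * u $ j) + (\<Sum>i\<in>UNIV. B i * u $ i) + K)"
    unfolding affine_lie_def by (simp add: algebra_simps)
  have eq: "a = b" if "u \<in> V" "pushforward \<phi> u a = pushforward \<phi> u b" for u a b
    using inj_pushforward[OF that(1)] that(2) by (simp add: inj_eq)
  have "frobenius_manifold V FN g (\<lambda>u. q *v u + s) dF"
    unfolding frobenius_manifold_def
  proof (intro conjI ballI allI)
    show "open V" "connected V" "V \<noteq> {}" "smooth_on V FN" "invertible g"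
      using V FN(1) g_inv by (auto simp: convex_connected)
    show "third FN first i j u = g $ i $ j" if "u \<in> V" for i j u by (rule norm[OF that])
    show "frob_mult FN g u (frob_mult FN g u a b) c = frob_mult FN g u a (frob_mult FN g u b c)"
      if "u \<in> V" for u a b c
      by (rule eq[OF that]) (simp only: mult[OF that] ambient(1)[OF in_M[OF that]])
    show "frob_mult FN g u a b = frob_mult FN g u b a" if "u \<in> V" for u a b
      by (rule eq[OF that]) (simp only: mult[OF that] ambient(2)[OF in_M[OF that], of "pushforward \<phi> u a"])
    show "frob_mult FN g u unity a = a" if "u \<in> V" for u a
      by (rule eq[OF that]) (simp only: mult[OF that] unit[OF that] ambient(3)[OF in_M[OF that]])
    show "\<exists>q' r. \<forall>t\<in>V. q *v t + s = q' *v t + r" by blast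
    show "\<exists>A B C. \<forall>t\<in>V. (\<Sum>i\<in>UNIV. (q *v t + s) $ i * pd i FN t) =
        dF * FN t + ((\<Sum>i\<in>UNIV. \<Sum>j\<in>UNIV. A i j * t $ i * t $ j) + (\<Sum>i\<in>UNIV. B i * t $ i) + C)"
      using hom by blast
  qed
  then show ?thesis
    using mult q E in_M by (intro exI[of _ FN] exI[of _ "\<lambda>u. q *v u + s"]) simp
qed

end

section \<open>Natural Frobenius submanifolds\<close>

text \<open>
  Two shrinkings occur: to a ball, where the coefficients of the unity are constant because the domain
  is convex, and then, after the linear change of coordinates, to a ball in the new coordinates.
\<close>

lemma unital_flat_chart:
  fixes \<phi> :: "('k::{real_normed_field,euclidean_space}, 'n::{finite,linorder}) vec \<Rightarrow> ('k, 'm::{finite,linorder}) vec"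
  assumes \<phi>: "local_param N U \<phi>" and u0: "u0 \<in> U"
    and eta_sym: "\<And>i j. \<eta> $ i $ j = \<eta> $ j $ i"
    and gram: "\<And>u a b. u \<in> U \<Longrightarrow> inner_eta \<eta> (pushforward \<phi> u a) (pushforward \<phi> u b) = inner_eta g a b"
    and g_inv: "invertible g"
    and unity: "\<And>u. u \<in> U \<Longrightarrow> unity \<in> range (pushforward \<phi> u)"
  shows "\<exists>V (\<phi>' :: ('k, 'n) vec \<Rightarrow> ('k, 'm) vec) g'. local_param N V \<phi>' \<and> \<phi> u0 \<in> \<phi>' ` V \<and> flat_chart \<eta> V \<phi>' g' \<and>
     (\<forall>v\<in>V. pushforward \<phi>' v unity = unity)"
proof -
  have U: "open U" and s: "\<And>i. smooth_on U (\<lambda>u. \<phi> u $ i)" using \<phi> by (auto simp: local_param_def)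
  obtain \<rho> where \<rho>: "\<rho> > 0" "ball u0 \<rho> \<subseteq> U" using U u0 openE by blast
  have ck: "Ck k (ball u0 \<rho>) f" if "Ck k U f" for k f
    using that \<rho>(2) by (induction k arbitrary: f) (auto intro: continuous_on_subset)
  interpret B: flat_chart \<eta> "ball u0 \<rho>" \<phi> g
    by unfold_locales (use eta_sym gram g_inv \<rho> ck smooth_onD(3)[OF s] in \<open>auto simp: smooth_on_iff_Ck\<close>)
  obtain e where e: "\<And>u. u \<in> ball u0 \<rho> \<Longrightarrow> pushforward \<phi> u e = unity"
    using B.constant_tangent_field[of unity] unity \<rho>(2) by blast
  have "e \<noteq> 0"
  proof
    assume "e = 0"
    then have "(unity :: ('k, 'm) vec) = 0" using e[of u0] \<rho>(1) by (simp add: pushforward_zero)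
    then have "(unity :: ('k, 'm) vec) $ first = 0" by simp
    then show False by (simp add: unity_def)
  qed
  then obtain A :: "(('k, 'n) vec, 'n) vec" where A: "invertible A" "A *v axis first 1 = e"
    using exists_invertible_axis_image by blast
  have cont: "continuous_on UNIV ((*v) A)"
    by (rule continuous_on_vec_components) (auto simp: matrix_vector_mult_def intro!: continuous_intros)
  define v0 where "v0 = matrix_inv A *v u0"
  have v0: "A *v v0 = u0" by (simp add: v0_def matrix_inv_cancel[OF A(1)])
  have "open ((*v) A -` ball u0 \<rho>)" by (rule open_vimage[OF open_ball cont])
  moreover have "v0 \<in> (*v) A -` ball u0 \<rho>" using v0 \<rho>(1) by simp
  ultimately obtain \<epsilon> where \<epsilon>: "\<epsilon> > 0" "ball v0 \<epsilon> \<subseteq> (*v) A -` ball u0 \<rho>" using openE by blast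
  let ?V = "ball v0 \<epsilon>" and ?\<phi> = "\<lambda>v. \<phi> (A *v v)"
  let ?g = "\<chi> \<alpha> \<beta>. inner_eta g (column \<alpha> A) (column \<beta> A)"
  have AV: "A *v v \<in> ball u0 \<rho>" "A *v v \<in> U" if "v \<in> ?V" for v using \<epsilon>(2) \<rho>(2) that by auto
  have lp: "local_param N ?V ?\<phi>"
    by (rule local_param_compose_linear[OF \<phi> A(1) open_ball AV(2)])
  have push: "pushforward ?\<phi> v w = pushforward \<phi> (A *v v) (A *v w)" if "v \<in> ?V" for v w
    by (rule pushforward_compose_linear[OF U AV(2)[OF that] s])
  have g': "inner_eta g (A *v a) (A *v b) = inner_eta ?g a b" for a b
    unfolding matrix_mult_sum by (rule inner_eta_gram)
  have "invertible ?g"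
  proof (rule invertible_of_nondegenerate)
    fix a assume a: "\<And>b. inner_eta ?g a b = 0"
    have "inner_eta g (A *v a) b = 0" for b
      using a[of "matrix_inv A *v b"] unfolding g'[symmetric] by (simp add: matrix_inv_cancel[OF A(1)])
    then have "A *v a = 0" by (rule inner_eta_nondegenerate[OF g_inv])
    then show "a = 0" using matrix_inv_cancel(2)[OF A(1), of a] by simp
  qed
  then have "flat_chart \<eta> ?V ?\<phi> ?g"
    using eta_sym lp \<epsilon>(1) AV(2)
    by unfold_locales (auto simp: push gram g' local_param_def)
  moreover have "pushforward ?\<phi> v unity = unity" if "v \<in> ?V" for v
    unfolding push[OF that] unity_def[where 'n='n] A(2) by (rule e[OF AV(1)[OF that]])
  moreover have "\<phi> u0 \<in> ?\<phi> ` ?V" using v0 \<epsilon>(1) by (intro image_eqI[of _ _ v0]) auto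
  ultimately show ?thesis using lp by blast
qed

theorem theorem3:
  fixes M N :: "(('k::{real_normed_field,euclidean_space}, 'm::{finite,linorder}) vec) set"
    and F :: "('k, 'm) vec \<Rightarrow> 'k" and \<eta> :: "(('k, 'm) vec, 'm) vec"
    and E :: "('k, 'm) vec \<Rightarrow> ('k, 'm) vec" and dF :: 'k
  assumes "frobenius_manifold M F \<eta> E dF"
    and "standard_form M \<eta> E dF"
    and "flat_submanifold TYPE('n::{finite,linorder}) \<eta> N M"
    and "\<And>p. p \<in> N \<Longrightarrow> perp \<eta> (tangent_space TYPE('n) N p) unity = 0"
    and "\<And>p a b. p \<in> N \<Longrightarrow> a \<in> tangent_space TYPE('n) N p \<Longrightarrow> b \<in> tangent_space TYPE('n) N p \<Longrightarrow>
           perp \<eta> (tangent_space TYPE('n) N p) (frob_mult F \<eta> p a b) = 0"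
    and "\<And>p. p \<in> N \<Longrightarrow> perp \<eta> (tangent_space TYPE('n) N p) (E p) = 0"
  shows "natural_frobenius_submanifold TYPE('n) F \<eta> E N M"
proof -
  note frob = assms(1) and std = assms(2)
  let ?T = "tangent_space TYPE('n) N"
  have sub: "submanifold TYPE('n) N M" and NM: "N \<subseteq> M"
    using assms(3) by (auto simp: flat_submanifold_def submanifold_def)
  have nondeg: "v = 0" if "p \<in> N" "v \<in> ?T p" "\<And>w. w \<in> ?T p \<Longrightarrow> inner_eta \<eta> v w = 0" for p v
    using assms(3) that unfolding flat_submanifold_def by blast
  have eta_sym: "\<eta> $ i $ j = \<eta> $ j $ i" for i j by (rule standard_form_symmetric[OF std])
  have star: "star TYPE('n) F \<eta> N p a b = frob_mult F \<eta> p a b" if "p \<in> N" "a \<in> ?T p" "b \<in> ?T p" for p a b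
    using assms(5)[OF that] by (simp add: star_def perp_def)
  have proj: "orth_proj \<eta> (?T p) unity = unity" "orth_proj \<eta> (?T p) (E p) = E p" if "p \<in> N" for p
    using assms(4,6)[OF that] by (simp_all add: perp_def)
  have in_N: "\<phi> u \<in> N" if "local_param N U \<phi>" "u \<in> U" for U u and \<phi> :: "('k, 'n) vec \<Rightarrow> ('k, 'm) vec"
  proof -
    have "openin (top_of_set N) (\<phi> ` U)" using that(1) by (simp add: local_param_def)
    then have "\<phi> ` U \<subseteq> N" by (rule openin_imp_subset)
    then show ?thesis using that(2) by blast
  qed
  have tangent: "orth_proj \<eta> (?T (\<phi> u)) v \<in> range (pushforward \<phi> u)"
    if lp: "local_param N U \<phi>" and u: "u \<in> U" for U u v and \<phi> :: "('k, 'n) vec \<Rightarrow> ('k, 'm) vec"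
    unfolding tangent_space_eq_range[OF lp u]
  proof (rule orth_proj_in_range)
    show "inj (pushforward \<phi> u)" using lp u by (simp add: local_param_def)
    show "v = 0" if "v \<in> range (pushforward \<phi> u)" "\<And>w. w \<in> range (pushforward \<phi> u) \<Longrightarrow> inner_eta \<eta> v w = 0" for v
      using nondeg[OF in_N[OF lp u]] that unfolding tangent_space_eq_range[OF lp u] by blast
  qed
  have chart: "\<exists>V (\<phi> :: ('k, 'n) vec \<Rightarrow> ('k, 'm) vec) FN \<eta>N EN dN.
        local_param N V \<phi> \<and> p \<in> \<phi> ` V \<and> frobenius_manifold V FN \<eta>N EN dN \<and>
        (\<forall>\<tau>\<in>V.
           (\<forall>a b. inner_eta \<eta>N a b = inner_eta \<eta> (pushforward \<phi> \<tau> a) (pushforward \<phi> \<tau> b)) \<and>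
           (\<forall>a b. pushforward \<phi> \<tau> (frob_mult FN \<eta>N \<tau> a b) =
                  star TYPE('n) F \<eta> N (\<phi> \<tau>) (pushforward \<phi> \<tau> a) (pushforward \<phi> \<tau> b)) \<and>
           pushforward \<phi> \<tau> unity = orth_proj \<eta> (?T (\<phi> \<tau>)) unity \<and>
           pushforward \<phi> \<tau> (EN \<tau>) = orth_proj \<eta> (?T (\<phi> \<tau>)) (E (\<phi> \<tau>)))" if p: "p \<in> N" for p
  proof -
    obtain U g and \<phi>0 :: "('k, 'n) vec \<Rightarrow> ('k, 'm) vec" where lp0: "local_param N U \<phi>0" and "p \<in> \<phi>0 ` U"
      and gram: "\<And>u a b. u \<in> U \<Longrightarrow> inner_eta \<eta> (pushforward \<phi>0 u a) (pushforward \<phi>0 u b) = inner_eta g a b"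
      using assms(3) p unfolding flat_submanifold_def by blast
    then obtain u0 where u0: "u0 \<in> U" "p = \<phi>0 u0" by blast
    have "invertible g"
    proof (rule invertible_of_nondegenerate)
      fix a assume a: "\<And>b. inner_eta g a b = 0"
      have "pushforward \<phi>0 u0 a = 0"
        by (rule nondeg[OF in_N[OF lp0 u0(1)]])
          (auto simp: tangent_space_eq_range[OF lp0 u0(1)] gram[OF u0(1)] a)
      moreover have "inj (pushforward \<phi>0 u0)" using lp0 u0 by (simp add: local_param_def)
      ultimately show "a = 0" using injD[of "pushforward \<phi>0 u0" a 0] by (simp add: pushforward_zero)
    qed
    moreover have "unity \<in> range (pushforward \<phi>0 u)" if "u \<in> U" for u
      using tangent[OF lp0 that, of unity] proj(1)[OF in_N[OF lp0 that]] by simp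
    ultimately obtain V \<eta>N and \<phi> :: "('k, 'n) vec \<Rightarrow> ('k, 'm) vec"
      where lp: "local_param N V \<phi>" and pV: "p \<in> \<phi> ` V"
        and flat: "flat_chart \<eta> V \<phi> \<eta>N" and unit: "\<And>v. v \<in> V \<Longrightarrow> pushforward \<phi> v unity = unity"
      using unital_flat_chart[OF lp0 u0(1) eta_sym gram] u0(2) by metis
    have T: "?T (\<phi> u) = range (pushforward \<phi> u)" if "u \<in> V" for u
      by (rule tangent_space_eq_range[OF lp that])
    have mult: "star TYPE('n) F \<eta> N (\<phi> u) (pushforward \<phi> u a) (pushforward \<phi> u b) =
      frob_mult F \<eta> (\<phi> u) (pushforward \<phi> u a) (pushforward \<phi> u b)" if "u \<in> V" for u a b
      by (rule star[OF in_N[OF lp that]]) (simp_all add: T[OF that])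
    interpret frobenius_chart \<eta> V \<phi> \<eta>N M F E dF
    proof (intro frobenius_chart.intro flat frobenius_chart_axioms.intro frob std)
      fix u assume u: "u \<in> V"
      show "\<phi> u \<in> M" using in_N[OF lp u] NM by blast
      show "pushforward \<phi> u unity = unity" by (rule unit[OF u])
      show "frob_mult F \<eta> (\<phi> u) (pushforward \<phi> u a) (pushforward \<phi> u b) \<in> range (pushforward \<phi> u)" for a b
        using tangent[OF lp u] mult[OF u, of a b] unfolding star_def by metis
      show "E (\<phi> u) \<in> range (pushforward \<phi> u)"
        using tangent[OF lp u, of "E (\<phi> u)"] proj(2)[OF in_N[OF lp u]] by simp
    qed
    obtain FN EN where "frobenius_manifold V FN \<eta>N EN dF" and FN: "\<And>u. u \<in> V \<Longrightarrow>
       (\<forall>a b. pushforward \<phi> u (frob_mult FN \<eta>N u a b) = frob_mult F \<eta> (\<phi> u) (pushforward \<phi> u a) (pushforward \<phi> u b)) \<and>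
       pushforward \<phi> u (EN u) = E (\<phi> u)"
      using induced_frobenius_manifold by blast
    moreover have "\<forall>\<tau>\<in>V.
           (\<forall>a b. inner_eta \<eta>N a b = inner_eta \<eta> (pushforward \<phi> \<tau> a) (pushforward \<phi> \<tau> b)) \<and>
           (\<forall>a b. pushforward \<phi> \<tau> (frob_mult FN \<eta>N \<tau> a b) =
                  star TYPE('n) F \<eta> N (\<phi> \<tau>) (pushforward \<phi> \<tau> a) (pushforward \<phi> \<tau> b)) \<and>
           pushforward \<phi> \<tau> unity = orth_proj \<eta> (?T (\<phi> \<tau>)) unity \<and>
           pushforward \<phi> \<tau> (EN \<tau>) = orth_proj \<eta> (?T (\<phi> \<tau>)) (E (\<phi> \<tau>))"
      using FN gram mult proj in_N[OF lp] unit by simp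
    ultimately show ?thesis using lp pV by blast
  qed
  show ?thesis
    unfolding natural_frobenius_submanifold_def frobenius_submanifold_def
    using sub chart star by blast
qed

end
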